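(* Let $N\ge1$ be an integer, $0<s<1$, $N>2s$, $0<\mu<N$, $p,q>0$, $p+q>1$, and set $\alpha=\frac{N-\mu+2s}{p+q-1}$. Assume that $0<\alpha<N-2s$, $0<\alpha p<N$ and $\mu+\alpha p>N$. Let $u$ be a positive punctured solution of $$(-\Delta)^su=\mathcal H_{p,\mu}[u]\,u^q\quad\text{in }\mathbb R^N\setminus\{0\}.$$ Suppose that, for a sequence $r_n\to0^+$, $$r_n^\alpha u(r_nx)\longrightarrow U(x)\quad\text{locally uniformly in }\mathbb R^N\setminus\{0\},$$ and that $U$ is nonzero, positive, radial, homogeneous of degree $-\alpha$ in the sense that $U(tx)=t^{-\alpha}U(x)$ for every $t>0$ and $x\in\mathbb R^N\setminus\{0\}$, and satisfies $(-\Delta)^sU=\mathcal H_{p,\mu}[U]\,U^q$ in $\mathbb R^N\setminus\{0\}$. Then $$U(x)=A|x|^{-\alpha}\quad\text{for all }x\in\mathbb R^N\setminus\{0\},$$ where $A>0$ is determined by $$A^{p+q-1}=\frac{\Lambda_{N,s}(\alpha)}{\mathcal C_{N,\mu,\alpha,p}} .$$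
   Context: Notation. $\mathcal H_{p,\mu}[u](x)=\int_{\mathbb R^N\setminus\{0\}}\frac{u^p(y)}{|x-y|^\mu}\,dy$; $$\Lambda_{N,s}(\alpha)=2^{2s}\frac{\Gamma\left(\frac{N-\alpha}{2}\right)\Gamma\left(\frac{\alpha+2s}{2}\right)}{\Gamma\left(\frac{\alpha}{2}\right)\Gamma\left(\frac{N-\alpha-2s}{2}\right)},\qquad \mathcal C_{N,\mu,\alpha,p}=\pi^{\frac N2}\frac{\Gamma\left(\frac{N-\mu}{2}\right)\Gamma\left(\frac{N-\alpha p}{2}\right)\Gamma\left(\frac{\mu+\alpha p-N}{2}\right)}{\Gamma\left(\frac{\mu}{2}\right)\Gamma\left(\frac{\alpha p}{2}\right)\Gamma\left(\frac{2N-\mu-\alpha p}{2}\right)} .$$ $\mathcal L_s(\mathbb R^N)=\{u\in L^1_{\rm loc}(\mathbb R^N):\int_{\mathbb R^N}\frac{|u(x)|}{1+|x|^{N+2s}}\,dx<+\infty\}$. For $u\in\mathcal L_s(\mathbb R^N)$ sufficiently regular near $x$, $(-\Delta)^su(x)=C_{N,s}\,\mathrm{P.V.}\int_{\mathbb R^N}\frac{u(x)-u(y)}{|x-y|^{N+2s}}\,dy$, where $C_{N,s}>0$ is the constant for which $(-\Delta)^s$ has Fourier multiplier $|\xi|^{2s}$ (with $\widehat f(\xi)=\int e^{-ix\cdot\xi}f(x)\,dx$). A positive punctured solution is a function $u\in\mathcal L_s(\mathbb R^N)\cap C^{2s+\beta}_{\rm loc}(\mathbb R^N\setminus\{0\})$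 for some $\beta>0$ with $2s+\beta\notin\mathbb N$, such that $u>0$ in $\mathbb R^N\setminus\{0\}$, $\mathcal H_{p,\mu}[u]$ is finite at every point of $\mathbb R^N\setminus\{0\}$, and the equation holds pointwise in $\mathbb R^N\setminus\{0\}$. *)

theory Defs
  imports "HOL-Analysis.Analysis"
begin

text \<open>The ambient space is a Euclidean space \<open>'a\<close>, with \<open>N = DIM('a)\<close>.\<close>

primrec iter_partial :: "'a list \<Rightarrow> ('a::euclidean_space \<Rightarrow> real) \<Rightarrow> 'a \<Rightarrow> real" where
  "iter_partial [] f = f"
| "iter_partial (b # bs) f = (\<lambda>x. frechet_derivative (iter_partial bs f) (at x) b)"

definition schwartz :: "('a::euclidean_space \<Rightarrow> real) \<Rightarrow> bool" where
  "schwartz f \<longleftrightarrow>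
     (\<forall>bs. set bs \<subseteq> Basis \<longrightarrow>
        (\<forall>x. iter_partial bs f differentiable (at x)) \<and>
        (\<forall>m::nat. \<exists>B. \<forall>x. (1 + norm x) ^ m * \<bar>iter_partial bs f x\<bar> \<le> B))"

definition locally_holder :: "real \<Rightarrow> 'a::euclidean_space set \<Rightarrow> ('a \<Rightarrow> real) \<Rightarrow> bool" where
  "locally_holder \<gamma> S f \<longleftrightarrow>
     (\<forall>K. compact K \<and> K \<subseteq> S \<longrightarrow>
        (\<exists>L. \<forall>x\<in>K. \<forall>y\<in>K. \<bar>f x - f y\<bar> \<le> L * dist x y powr \<gamma>))"

text \<open>
  \<open>C\<^sup>\<sigma>\<close>, locally on the open set \<open>S\<close>, for positive non-integral \<open>\<sigma>\<close>:
  \<open>\<lfloor>\<sigma>\<rfloor>\<close> derivatives, those of top order being locally Hoelder of exponent \<open>\<sigma> - \<lfloor>\<sigma>\<rfloor>\<close>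
  (which makes them, and hence all lower ones, continuous).
\<close>

definition C_holder_loc :: "real \<Rightarrow> 'a::euclidean_space set \<Rightarrow> ('a \<Rightarrow> real) \<Rightarrow> bool" where
  "C_holder_loc \<sigma> S f \<longleftrightarrow>
     (\<forall>bs. set bs \<subseteq> Basis \<and> length bs < nat \<lfloor>\<sigma>\<rfloor> \<longrightarrow>
        (\<forall>x\<in>S. iter_partial bs f differentiable (at x))) \<and>
     (\<forall>bs. set bs \<subseteq> Basis \<and> length bs = nat \<lfloor>\<sigma>\<rfloor> \<longrightarrow>
        locally_holder (frac \<sigma>) S (iter_partial bs f))"

definition L_s :: "real \<Rightarrow> ('a::euclidean_space \<Rightarrow> real) set" where
  "L_s s = {u. (\<forall>K. compact K \<longrightarrow> set_integrable lborel K u) \<and>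
               integrable lborel (\<lambda>x. \<bar>u x\<bar> / (1 + norm x powr (real DIM('a) + 2 * s)))}"

text \<open>The principal value integral, without the normalising constant, exists and equals \<open>l\<close>.\<close>

definition has_pv_integral :: "real \<Rightarrow> ('a::euclidean_space \<Rightarrow> real) \<Rightarrow> 'a \<Rightarrow> real \<Rightarrow> bool" where
  "has_pv_integral s u x l \<longleftrightarrow>
     (\<forall>\<epsilon>>0. set_integrable lborel {y. \<epsilon> < norm (x - y)}
              (\<lambda>y. (u x - u y) / norm (x - y) powr (real DIM('a) + 2 * s))) \<and>
     ((\<lambda>\<epsilon>. LINT y:{y. \<epsilon> < norm (x - y)}|lborel.
              (u x - u y) / norm (x - y) powr (real DIM('a) + 2 * s)) \<longlongrightarrow> l) (at_right 0)"

definition fourier :: "('a::euclidean_space \<Rightarrow> real) \<Rightarrow> 'a \<Rightarrow> complex" where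
  "fourier f \<xi> = (LINT x|lborel. exp (- \<i> * complex_of_real (x \<bullet> \<xi>)) * complex_of_real (f x))"

text \<open>
  \<open>C\<close> times the principal value integral acts on Schwartz functions as the Fourier multiplier
  \<open>|\<xi>|\<^sup>2\<^sup>s\<close>.  Real-valued test functions suffice by linearity.
\<close>

definition has_multiplier :: "'a::euclidean_space itself \<Rightarrow> real \<Rightarrow> real \<Rightarrow> bool" where
  "has_multiplier T s C \<longleftrightarrow>
     (\<forall>\<phi> :: 'a \<Rightarrow> real. schwartz \<phi> \<longrightarrow>
        (\<exists>w. (\<forall>x. has_pv_integral s \<phi> x (w x)) \<and> integrable lborel w \<and>
             (\<forall>\<xi>. fourier (\<lambda>x. C * w x) \<xi>
                    = complex_of_real (norm \<xi> powr (2 * s)) * fourier \<phi> \<xi>)))"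

definition frac_lap_const :: "'a::euclidean_space itself \<Rightarrow> real \<Rightarrow> real" where
  "frac_lap_const T s = (THE C. C > 0 \<and> has_multiplier T s C)"

definition has_frac_laplacian :: "real \<Rightarrow> ('a::euclidean_space \<Rightarrow> real) \<Rightarrow> 'a \<Rightarrow> real \<Rightarrow> bool" where
  "has_frac_laplacian s u x v \<longleftrightarrow>
     (\<exists>l. has_pv_integral s u x l \<and> v = frac_lap_const TYPE('a) s * l)"

definition hartree_finite :: "real \<Rightarrow> real \<Rightarrow> ('a::euclidean_space \<Rightarrow> real) \<Rightarrow> 'a \<Rightarrow> bool" where
  "hartree_finite p \<mu> u x \<longleftrightarrow>
     set_integrable lborel (UNIV - {0}) (\<lambda>y. u y powr p / norm (x - y) powr \<mu>)"

definition hartree :: "real \<Rightarrow> real \<Rightarrow> ('a::euclidean_space \<Rightarrow> real) \<Rightarrow> 'a \<Rightarrow> real" where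
  "hartree p \<mu> u x = (LINT y:UNIV - {0}|lborel. u y powr p / norm (x - y) powr \<mu>)"

text \<open>The equation holds pointwise away from the origin, both sides being well defined there.\<close>

definition solves_punctured ::
    "real \<Rightarrow> real \<Rightarrow> real \<Rightarrow> real \<Rightarrow> ('a::euclidean_space \<Rightarrow> real) \<Rightarrow> bool" where
  "solves_punctured s \<mu> p q u \<longleftrightarrow>
     (\<forall>x. x \<noteq> 0 \<longrightarrow>
        hartree_finite p \<mu> u x \<and> has_frac_laplacian s u x (hartree p \<mu> u x * u x powr q))"

definition positive_punctured_solution ::
    "real \<Rightarrow> real \<Rightarrow> real \<Rightarrow> real \<Rightarrow> ('a::euclidean_space \<Rightarrow> real) \<Rightarrow> bool" where
  "positive_punctured_solution s \<mu> p q u \<longleftrightarrow>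
     u \<in> L_s s \<and>
     (\<exists>\<beta>>0. 2 * s + \<beta> \<notin> \<nat> \<and> C_holder_loc (2 * s + \<beta>) (UNIV - {0}) u) \<and>
     (\<forall>x. x \<noteq> 0 \<longrightarrow> u x > 0) \<and>
     solves_punctured s \<mu> p q u"

definition Lambda_const :: "nat \<Rightarrow> real \<Rightarrow> real \<Rightarrow> real" where
  "Lambda_const N s \<alpha> =
     2 powr (2 * s) * (Gamma ((real N - \<alpha>) / 2) * Gamma ((\<alpha> + 2 * s) / 2))
       / (Gamma (\<alpha> / 2) * Gamma ((real N - \<alpha> - 2 * s) / 2))"

definition C_const :: "nat \<Rightarrow> real \<Rightarrow> real \<Rightarrow> real \<Rightarrow> real" where
  "C_const N \<mu> \<alpha> p =
     pi powr (real N / 2) *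
       (Gamma ((real N - \<mu>) / 2) * Gamma ((real N - \<alpha> * p) / 2) * Gamma ((\<mu> + \<alpha> * p - real N) / 2))
       / (Gamma (\<mu> / 2) * Gamma (\<alpha> * p / 2) * Gamma ((2 * real N - \<mu> - \<alpha> * p) / 2))"

end

theory Submission
  imports Defs "HOL-Probability.Characteristic_Functions"
begin

text \<open>
  Radial symmetry and homogeneity leave only one parameter: \<open>U x = A |x|\<^sup>-\<^sup>\<alpha>\<close>, where \<open>A\<close> is the value of
  \<open>U\<close> on the unit sphere.  The equation at a unit vector \<open>e\<close> then fixes \<open>A\<close>: the Hartree integral is
  \<open>A\<^sup>p\<close> times a Riesz composition integral, equal to \<open>C_const\<close>, and the fractional Laplacian is \<open>A\<close>
  times that of \<open>|x|\<^sup>-\<^sup>\<alpha>\<close>, equal to \<open>Lambda_const\<close> at \<open>e\<close>.  Hence \<open>A\<^sup>p\<^sup>+\<^sup>q C = A \<Lambda>\<close>, and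
  \<open>A\<close> is the only positive root because \<open>p + q > 1\<close>.  The substance is the evaluation of the two
  constants.

  Both evaluations rest on subordination: a power \<open>|z|\<^sup>-\<^sup>2\<^sup>a\<close> is the integral of the Gaussians
  \<open>exp (- t |z|\<^sup>2)\<close> against \<open>t\<^sup>a\<^sup>-\<^sup>1 dt / \<Gamma>(a)\<close> (\<open>powr_norm_subordination\<close>), and Gaussian integrals
  are explicit.  The common core is \<open>gaussian_potential\<close>, which expresses
  \<open>\<integral> |y|\<^sup>-\<^sup>\<gamma> exp (- \<sigma> |e - y|\<^sup>2) dy\<close> as a one-dimensional integral over \<open>0 < k < \<sigma>\<close>.  Integrated against
  \<open>\<sigma>\<^bsup>\<mu>/2-1\<^esup>\<close> it gives a Gamma integral times a Beta integral with first argument \<open>(N - \<mu>)/2\<close>; this is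
  \<open>riesz_composition\<close>.  The fractional Laplacian corresponds to \<open>\<mu> = N + 2s\<close>, where that Beta integral
  has first argument \<open>- s\<close> and diverges.  Subtracting the value of the power at \<open>e\<close> regularises it,
  and what appears is the analytic continuation of the Beta function
  (\<open>has_bochner_integral_Beta_continued\<close>); this is \<open>integral_symmetric_kernel_power\<close>.

  The constant in front of the fractional Laplacian is specified by its Fourier multiplier, so it has to
  be computed as well.  By Fubini, the transform of the singular integral of a Schwartz function \<open>\<phi>\<close> at
  \<open>\<xi>\<close> is that of \<open>\<phi>\<close> times \<open>\<integral> (1 - cos (z \<bullet> \<xi>)) |z|\<^bsup>-N-2s\<^esup> dz\<close>, and subordination evaluates this to
  \<open>multiplier_integral\<close> times \<open>|\<xi>|\<^sup>2\<^sup>s\<close>.  The Gaussian, whose transform has no zeros, shows that no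
  other normalisation has the multiplier property (\<open>frac_lap_const_eq\<close>).  In all of this the principal
  value is replaced by an absolutely convergent integral of second differences
  (\<open>has_pv_integral_symmetrize\<close>).
\<close>

section \<open>One-dimensional Gamma and Beta integrals and their continuations\<close>

text \<open>
  An equivalence rather than an implication: the substitutions below have infinite ranges or singular
  end points, and integrability is known sometimes before and sometimes after the substitution.
\<close>

lemma has_bochner_integral_substitution:
  fixes f g g' :: "real \<Rightarrow> real"
  assumes S[measurable]: "S \<in> sets borel" and T[measurable]: "T \<in> sets borel"
    and bij: "bij_betw g S T"
    and der: "\<And>x. x \<in> S \<Longrightarrow> (g has_real_derivative g' x) (at x)"
    and f[measurable]: "f \<in> borel_measurable borel"
    and gm[measurable]: "g \<in> borel_measurable borel" and gm'[measurable]: "g' \<in> borel_measurable borel"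
  shows "has_bochner_integral lborel (\<lambda>y. f y * indicator T y) r \<longleftrightarrow>
         has_bochner_integral lborel (\<lambda>x. \<bar>g' x\<bar> * f (g x) * indicator S x) r"
proof -
  have aux: "has_bochner_integral lborel (\<lambda>x. F x * indicator A x) r \<longleftrightarrow>
      F absolutely_integrable_on A \<and> integral A F = r"
    if [measurable]: "A \<in> sets borel" "F \<in> borel_measurable borel" for F :: "real \<Rightarrow> real" and A
  proof -
    have "has_bochner_integral lborel (\<lambda>x. F x * indicator A x) r \<longleftrightarrow>
       set_integrable lborel A F \<and> (LINT x:A|lborel. F x) = r"
      by (simp add: has_bochner_integral_iff set_integrable_def set_lebesgue_integral_def mult.commute)
    moreover have "set_integrable lborel A F \<longleftrightarrow> F absolutely_integrable_on A"
      unfolding set_integrable_def by (subst integrable_completion) auto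
    moreover have "(LINT x:A|lborel. F x) = integral A F" if "set_integrable lborel A F"
      using set_borel_integral_eq_integral(2)[OF that] .
    ultimately show ?thesis by auto
  qed
  have gS: "g ` S = T" and inj: "inj_on g S" using bij by (auto simp: bij_betw_def)
  have S': "S \<in> sets lebesgue" by simp
  have m: "(\<lambda>x. \<bar>g' x\<bar> * f (g x)) \<in> borel_measurable borel" by measurable
  have "(\<lambda>x. \<bar>g' x\<bar> * f (g x)) absolutely_integrable_on S \<and> integral S (\<lambda>x. \<bar>g' x\<bar> * f (g x)) = r
     \<longleftrightarrow> f absolutely_integrable_on (g ` S) \<and> integral (g ` S) f = r"
    using der by (intro has_absolute_integral_change_of_variables_1' S' inj) (auto intro: DERIV_subset)
  then show ?thesis unfolding aux[OF S m] aux[OF T f] gS by simp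
qed

text \<open>
  Wherever one side is finite the signed substitution rule identifies both sides; so they are also
  infinite together.
\<close>

lemma set_nn_integral_substitution:
  fixes f g g' :: "real \<Rightarrow> real"
  assumes S[measurable]: "S \<in> sets borel" and T[measurable]: "T \<in> sets borel"
    and bij: "bij_betw g S T"
    and der: "\<And>x. x \<in> S \<Longrightarrow> (g has_real_derivative g' x) (at x)"
    and f[measurable]: "f \<in> borel_measurable borel" and nonneg: "\<And>y. y \<in> T \<Longrightarrow> 0 \<le> f y"
    and gm[measurable]: "g \<in> borel_measurable borel" and gm'[measurable]: "g' \<in> borel_measurable borel"
  shows "(\<integral>\<^sup>+y. ennreal (f y * indicator T y) \<partial>lborel) =
         (\<integral>\<^sup>+x. ennreal (\<bar>g' x\<bar> * f (g x) * indicator S x) \<partial>lborel)" (is "?L = ?R")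
proof -
  have gT: "g x \<in> T" if "x \<in> S" for x using bij that by (auto simp: bij_betw_def)
  have key: "?L = ennreal r \<longleftrightarrow> ?R = ennreal r" if r: "0 \<le> r" for r
  proof -
    have "?L = ennreal r \<longleftrightarrow> has_bochner_integral lborel (\<lambda>y. f y * indicator T y) r"
      unfolding has_bochner_integral_iff using nonneg r
      by (intro nn_integral_eq_integrable AE_I2) (auto simp: indicator_def)
    also have "\<dots> \<longleftrightarrow> has_bochner_integral lborel (\<lambda>x. \<bar>g' x\<bar> * f (g x) * indicator S x) r"
      by (rule has_bochner_integral_substitution[OF S T bij der f gm gm'])
    also have "\<dots> \<longleftrightarrow> ?R = ennreal r"
      unfolding has_bochner_integral_iff using nonneg gT r
      by (intro nn_integral_eq_integrable[symmetric] AE_I2) (auto simp: indicator_def)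
    finally show ?thesis .
  qed
  show ?thesis
  proof (cases "?L = \<infinity>")
    case True
    then have "?R \<noteq> ennreal r" if "0 \<le> r" for r using key[OF that] by auto
    then have "?R = \<infinity>" by (metis ennreal_cases infinity_ennreal_def)
    then show ?thesis using True by simp
  next
    case False
    then obtain r where "0 \<le> r" "?L = ennreal r" by (metis ennreal_cases infinity_ennreal_def)
    then show ?thesis using key[of r] by simp
  qed
qed

lemma nn_integral_Gamma:
  assumes "a > 0" "c > (0::real)"
  shows "(\<integral>\<^sup>+t. ennreal (t powr (a - 1) * exp (- c * t) * indicator {0<..} t) \<partial>lborel)
           = ennreal (Gamma a * c powr (- a))"
proof -
  have "(\<integral>\<^sup>+t. ennreal (t powr (a - 1) * exp (- t) * indicator {0<..} t) \<partial>lborel)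
     = (\<integral>\<^sup>+t. ennreal (indicator {0..} t * t powr (a - 1) / exp t) \<partial>lborel)"
    by (intro nn_integral_cong) (auto simp: indicator_def exp_minus field_simps)
  also have "\<dots> = ennreal (Gamma a)"
    using nn_integral_has_integral_lebesgue[OF _ Gamma_integral_real[OF assms(1)]] by (simp add: algebra_simps)
  finally have 1: "(\<integral>\<^sup>+t. ennreal (t powr (a - 1) * exp (- t) * indicator {0<..} t) \<partial>lborel) = ennreal (Gamma a)" .
  have "(\<integral>\<^sup>+t. ennreal (t powr (a - 1) * exp (- c * t) * indicator {0<..} t) \<partial>lborel)
     = (\<integral>\<^sup>+x. ennreal (\<bar>1/c\<bar> * ((x/c) powr (a - 1) * exp (- c * (x/c))) * indicator {0<..} x) \<partial>lborel)"
    using assms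
    by (intro set_nn_integral_substitution[where g = "\<lambda>x. x/c"])
       (auto intro!: derivative_eq_intros bij_betwI[where g="\<lambda>x. c*x"])
  also have "\<dots> = (\<integral>\<^sup>+x. ennreal (c powr (-a)) * ennreal (x powr (a - 1) * exp (- x) * indicator {0<..} x) \<partial>lborel)"
    using assms
    by (intro nn_integral_cong, subst ennreal_mult'[symmetric])
       (auto simp: indicator_def powr_divide powr_minus powr_diff field_simps)
  also have "\<dots> = ennreal (c powr (-a)) * ennreal (Gamma a)"
    by (subst nn_integral_cmult) (auto simp: 1)
  also have "\<dots> = ennreal (Gamma a * c powr (- a))"
    by (simp add: ennreal_mult'' mult.commute)
  finally show ?thesis .
qed

lemma nn_integral_Beta:
  assumes "a > 0" "b > (0::real)"
  shows "(\<integral>\<^sup>+t. ennreal (t powr (a - 1) * (1 - t) powr (b - 1) * indicator {0<..<1} t) \<partial>lborel)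
           = ennreal (Beta a b)"
proof -
  have "(\<integral>\<^sup>+t. ennreal (t powr (a - 1) * (1 - t) powr (b - 1) * indicator {0<..<1} t) \<partial>lborel)
     = (\<integral>\<^sup>+t. ennreal (indicator {0..1} t * (t powr (a - 1) * (1 - t) powr (b - 1))) \<partial>lborel)"
    by (intro nn_integral_cong) (auto simp: indicator_def)
  also have "\<dots> = ennreal (Beta a b)"
    using nn_integral_has_integral_lebesgue[OF _ has_integral_Beta_real[OF assms]] by simp
  finally show ?thesis .
qed

lemma has_bochner_integral_Beta:
  assumes "a > 0" "b > (0::real)"
  shows "has_bochner_integral lborel (\<lambda>t. t powr (a - 1) * (1 - t) powr (b - 1) * indicator {0<..<1} t) (Beta a b)"
proof -
  have "Beta a b \<ge> 0" using assms by (simp add: Beta_def)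
  then show ?thesis
    unfolding has_bochner_integral_iff using nn_integral_Beta[OF assms]
    by (subst nn_integral_eq_integrable[symmetric]) auto
qed

lemma Beta_1_real: "c > (0::real) \<Longrightarrow> Beta 1 c = 1 / c"
proof -
  assume c: "c > 0"
  then have "c \<notin> \<int>\<^sub>\<le>\<^sub>0" by (auto elim!: nonpos_Ints_cases)
  then have "Gamma (1 + c) = c * Gamma c" using Gamma_plus1[of c] by (simp add: add.commute)
  then show ?thesis using Gamma_real_pos[OF c] by (simp add: Beta_def)
qed

lemma nn_integral_powr_Ioi:
  assumes "s > 0" "w > (0::real)"
  shows "(\<integral>\<^sup>+t. ennreal (t powr (- s - 1) * indicator {w<..} t) \<partial>lborel) = ennreal (w powr (-s) / s)"
proof -
  have "((\<lambda>t. - (t powr (-s)) / s) \<longlongrightarrow> - 0 / s) at_top"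
    using assms by (intro tendsto_intros tendsto_neg_powr filterlim_ident) auto
  then have "(\<integral>\<^sup>+t. ennreal (t powr (- s - 1)) * indicator {w..} t \<partial>lborel) = ennreal (- 0 / s - (- (w powr (-s)) / s))"
    using assms
    by (intro nn_integral_FTC_atLeast) (auto intro!: derivative_eq_intros simp: field_simps)
  moreover have "(\<integral>\<^sup>+t. ennreal (t powr (- s - 1)) * indicator {w..} t \<partial>lborel)
     = (\<integral>\<^sup>+t. ennreal (t powr (- s - 1) * indicator {w<..} t) \<partial>lborel)"
    by (intro nn_integral_cong_AE AE_I[where N="{w}"]) (auto simp: indicator_def split: if_splits)
  ultimately show ?thesis by simp
qed

text \<open>
  The Gamma integral of exponent \<open>- s\<close> diverges at \<open>0\<close>; subtracting \<open>1\<close> from the exponential regularises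
  it, and the value is that of the continued function \<open>- \<Gamma>(- s) c\<^sup>s\<close>.  Writing the difference
  \<open>1 - exp (- c t)\<close> as an integral over \<open>0 < w < t\<close> and integrating over \<open>t\<close> first gives
  a convergent Gamma integral.
\<close>

lemma nn_integral_Gamma_regularized:
  assumes s: "0 < s" "s < 1" and c: "c > (0::real)"
  shows "(\<integral>\<^sup>+t. ennreal (t powr (- s - 1) * (1 - exp (- c * t)) * indicator {0<..} t) \<partial>lborel)
           = ennreal (Gamma (1 - s) / s * c powr s)"
proof -
  have inner: "ennreal (t powr (- s - 1) * (1 - exp (- c * t)) * indicator {0<..} t) =
     (\<integral>\<^sup>+w. ennreal (t powr (-s-1) * (c * exp (- c * w)) * indicator {0<..} w * indicator {w<..} t) \<partial>lborel)" for t
  proof (cases "t > 0")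
    case True
    have "(\<integral>\<^sup>+w. ennreal (c * exp (- c * w)) * indicator {0..t} w \<partial>lborel) = ennreal (- exp (- c * t) - (- exp (- c * 0)))"
      using c True by (intro nn_integral_FTC_Icc) (auto intro!: derivative_eq_intros)
    then have "ennreal (t powr (- s - 1)) * (\<integral>\<^sup>+w. ennreal (c * exp (- c * w)) * indicator {0..t} w \<partial>lborel)
       = ennreal (t powr (- s - 1) * (1 - exp (- c * t)))"
      using c True by (simp add: ennreal_mult')
    also have "ennreal (t powr (- s - 1)) * (\<integral>\<^sup>+w. ennreal (c * exp (- c * w)) * indicator {0..t} w \<partial>lborel) =
       (\<integral>\<^sup>+w. ennreal (t powr (- s - 1)) * (ennreal (c * exp (- c * w)) * indicator {0..t} w) \<partial>lborel)"
      by (rule nn_integral_cmult[symmetric]) simp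
    also have "\<dots> = (\<integral>\<^sup>+w. ennreal (t powr (-s-1) * (c * exp (- c * w)) * indicator {0<..} w * indicator {w<..} t) \<partial>lborel)"
      using True c by (intro nn_integral_cong_AE AE_I[where N="{0,t}"])
         (auto simp: indicator_def ennreal_mult' emeasure_lborel_countable split: if_splits)
    finally show ?thesis using True by simp
  next
    case False
    have "(\<integral>\<^sup>+w. ennreal (t powr (-s-1) * (c * exp (- c * w)) * indicator {0<..} w * indicator {w<..} t) \<partial>lborel) = (\<integral>\<^sup>+(w::real). 0 \<partial>lborel)"
      using False by (intro nn_integral_cong) (auto simp: indicator_def)
    then show ?thesis using False by simp
  qed
  have "(\<integral>\<^sup>+t. ennreal (t powr (- s - 1) * (1 - exp (- c * t)) * indicator {0<..} t) \<partial>lborel)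
    = (\<integral>\<^sup>+t. \<integral>\<^sup>+w. ennreal (t powr (-s-1) * (c * exp (- c * w)) * indicator {0<..} w * indicator {w<..} t) \<partial>lborel \<partial>lborel)"
    by (simp only: inner)
  also have "\<dots> = (\<integral>\<^sup>+w. \<integral>\<^sup>+t. ennreal (t powr (-s-1) * (c * exp (- c * w)) * indicator {0<..} w * indicator {w<..} t) \<partial>lborel \<partial>lborel)"
    by (rule lborel_pair.Fubini') (unfold indicator_def greaterThan_iff, measurable)
  also have "\<dots> = (\<integral>\<^sup>+w. ennreal (c/s) * ennreal (w powr ((1-s) - 1) * exp (- c * w) * indicator {0<..} w) \<partial>lborel)"
  proof (intro nn_integral_cong)
    fix w :: real
    show "(\<integral>\<^sup>+t. ennreal (t powr (-s-1) * (c * exp (- c * w)) * indicator {0<..} w * indicator {w<..} t) \<partial>lborel) =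
      ennreal (c/s) * ennreal (w powr ((1-s) - 1) * exp (- c * w) * indicator {0<..} w)"
    proof (cases "w > 0")
      case True
      have "(\<integral>\<^sup>+t. ennreal (t powr (-s-1) * (c * exp (- c * w)) * indicator {0<..} w * indicator {w<..} t) \<partial>lborel)
        = (\<integral>\<^sup>+t. ennreal (c * exp (- c * w)) * ennreal (t powr (-s-1) * indicator {w<..} t) \<partial>lborel)"
        using True c by (intro nn_integral_cong, subst ennreal_mult'[symmetric]) (auto simp: indicator_def)
      also have "\<dots> = ennreal (c * exp (- c * w)) * ennreal (w powr (-s) / s)"
        by (subst nn_integral_cmult) (auto simp: nn_integral_powr_Ioi[OF s(1) True])
      also have "\<dots> = ennreal (c/s) * ennreal (w powr ((1-s) - 1) * exp (- c * w) * indicator {0<..} w)"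
        using True c s by (simp add: ennreal_mult'[symmetric] field_simps)
      finally show ?thesis .
    qed auto
  qed
  also have "\<dots> = ennreal (c/s) * ennreal (Gamma (1-s) * c powr (-(1-s)))"
    using s by (subst nn_integral_cmult, measurable, subst nn_integral_Gamma[OF _ c]) auto
  also have "\<dots> = ennreal (Gamma (1 - s) / s * c powr s)"
    using s c by (simp add: ennreal_mult'[symmetric] powr_diff)
  finally show ?thesis .
qed


text \<open>
  As for the Gamma integral: \<open>1 - (1 - v)\<^sup>c\<close> is an integral over \<open>0 < w < v\<close>, and integrating over \<open>v\<close>
  first leaves convergent Beta integrals.
\<close>

lemma nn_integral_Beta_regularized:
  assumes s: "0 < s" "s < 1" and c: "c > (0::real)"
  shows "(\<integral>\<^sup>+v. ennreal (v powr (- s - 1) * (1 - (1 - v) powr c) * indicator {0<..<1} v) \<partial>lborel)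
           = ennreal ((c * Beta (1 - s) c - 1) / s)"
proof -
  let ?k = "\<lambda>v w. ennreal (v powr (-s-1) * (c * (1 - w) powr (c - 1)) * indicator {0<..<1} w * indicator {w<..<1} v)"
  have inner: "ennreal (v powr (- s - 1) * (1 - (1 - v) powr c) * indicator {0<..<1} v) =
     (\<integral>\<^sup>+w. ?k v w \<partial>lborel)" for v
  proof (cases "v > 0 \<and> v < 1")
    case True
    have "(\<integral>\<^sup>+w. ennreal (c * (1 - w) powr (c - 1)) * indicator {0..v} w \<partial>lborel) = ennreal (- ((1 - v) powr c) - (- ((1 - 0) powr c)))"
      using c True by (intro nn_integral_FTC_Icc) (auto intro!: derivative_eq_intros)
    then have "ennreal (v powr (- s - 1)) * (\<integral>\<^sup>+w. ennreal (c * (1 - w) powr (c - 1)) * indicator {0..v} w \<partial>lborel)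
       = ennreal (v powr (- s - 1) * (1 - (1 - v) powr c))"
      using c True by (simp add: ennreal_mult')
    also have "ennreal (v powr (- s - 1)) * (\<integral>\<^sup>+w. ennreal (c * (1 - w) powr (c - 1)) * indicator {0..v} w \<partial>lborel) =
       (\<integral>\<^sup>+w. ennreal (v powr (- s - 1)) * (ennreal (c * (1 - w) powr (c - 1)) * indicator {0..v} w) \<partial>lborel)"
      by (rule nn_integral_cmult[symmetric]) simp
    also have "\<dots> = (\<integral>\<^sup>+w. ?k v w \<partial>lborel)"
      using True c by (intro nn_integral_cong_AE AE_I[where N="{0,v}"])
         (auto simp: indicator_def ennreal_mult' emeasure_lborel_countable split: if_splits)
    finally show ?thesis using True by simp
  next
    case False
    have "(\<integral>\<^sup>+w. ?k v w \<partial>lborel) = (\<integral>\<^sup>+(w::real). 0 \<partial>lborel)"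
      using False by (intro nn_integral_cong) (auto simp: indicator_def)
    then show ?thesis using False by simp
  qed
  have 1: "integrable lborel (\<lambda>w. w powr ((1-s) - 1) * (1 - w) powr (c - 1) * indicator {0<..<1} w) \<and>
     (LINT w|lborel. w powr ((1-s) - 1) * (1 - w) powr (c - 1) * indicator {0<..<1} w) = Beta (1-s) c"
    using s c has_bochner_integral_Beta[of "1-s" c] has_bochner_integral_Beta[of 1 c] by (simp add: has_bochner_integral_iff)
  have 2: "integrable lborel (\<lambda>w. w powr (1 - 1) * (1 - w) powr (c - 1) * indicator {0<..<1} w) \<and>
     (LINT w|lborel. w powr (1 - 1) * (1 - w) powr (c - 1) * indicator {0<..<1} w) = Beta 1 c"
    using s c has_bochner_integral_Beta[of "1-s" c] has_bochner_integral_Beta[of 1 c] by (simp add: has_bochner_integral_iff)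
  have B1: "Beta 1 c = 1/c" by (rule Beta_1_real[OF c])
  have 3: "integrable lborel (\<lambda>w. c/s * ((1-w) powr (c-1) * (w powr (-s) - 1)) * indicator {0<..<1} w) \<and>
    (LINT w|lborel. c/s * ((1-w) powr (c-1) * (w powr (-s) - 1)) * indicator {0<..<1} w) = (c * Beta (1-s) c - 1)/s"
  proof -
    have eq: "c/s * ((1-w) powr (c-1) * (w powr (-s) - 1)) * indicator {0<..<1} w =
       c/s * (w powr ((1-s) - 1) * (1 - w) powr (c - 1) * indicator {0<..<1} w) -
       c/s * (w powr (1 - 1) * (1 - w) powr (c - 1) * indicator {0<..<1} w)" for w
      by (auto simp: indicator_def algebra_simps)
    show ?thesis unfolding eq using 1 2 B1 c s
      by (subst Bochner_Integration.integral_diff) (auto simp: field_simps)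
  qed
  have pos: "w powr (-s) \<ge> 1" if "0 < w" "w < 1" for w :: real
    using that s by (simp add: powr_minus one_le_inverse powr_le1)
  have "(\<integral>\<^sup>+v. ennreal (v powr (- s - 1) * (1 - (1 - v) powr c) * indicator {0<..<1} v) \<partial>lborel)
    = (\<integral>\<^sup>+v. \<integral>\<^sup>+w. ?k v w \<partial>lborel \<partial>lborel)"
    by (simp only: inner)
  also have "\<dots> = (\<integral>\<^sup>+w. \<integral>\<^sup>+v. ?k v w \<partial>lborel \<partial>lborel)"
    by (rule lborel_pair.Fubini') (unfold indicator_def greaterThanLessThan_iff, measurable)
  also have "\<dots> = (\<integral>\<^sup>+w. ennreal (c/s * ((1-w) powr (c-1) * (w powr (-s) - 1)) * indicator {0<..<1} w) \<partial>lborel)"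
  proof (intro nn_integral_cong)
    fix w :: real
    show "(\<integral>\<^sup>+v. ?k v w \<partial>lborel) = ennreal (c/s * ((1-w) powr (c-1) * (w powr (-s) - 1)) * indicator {0<..<1} w)"
    proof (cases "w > 0 \<and> w < 1")
      case True
      have "(\<integral>\<^sup>+v. ?k v w \<partial>lborel)
        = (\<integral>\<^sup>+v. ennreal (c * (1 - w) powr (c - 1)) * (ennreal (v powr (-s-1)) * indicator {w..1} v) \<partial>lborel)"
        using True c by (intro nn_integral_cong_AE AE_I[where N="{w,1}"])
         (auto simp: indicator_def ennreal_mult'[symmetric] emeasure_lborel_countable split: if_splits)
      also have "\<dots> = ennreal (c * (1 - w) powr (c - 1)) * (\<integral>\<^sup>+v. ennreal (v powr (-s-1)) * indicator {w..1} v \<partial>lborel)"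
        by (subst nn_integral_cmult) auto
      also have "(\<integral>\<^sup>+v. ennreal (v powr (-s-1)) * indicator {w..1} v \<partial>lborel) = ennreal (- (1 powr (-s)) / s - (- (w powr (-s)) / s))"
        using True s by (intro nn_integral_FTC_Icc) (auto intro!: derivative_eq_intros simp: field_simps)
      also have "ennreal (c * (1 - w) powr (c - 1)) * \<dots> = ennreal (c/s * ((1-w) powr (c-1) * (w powr (-s) - 1)) * indicator {0<..<1} w)"
        using True c s by (subst ennreal_mult'[symmetric]) (auto simp: field_simps)
      finally show ?thesis .
    qed (auto simp: indicator_def)
  qed
  also have "\<dots> = ennreal ((c * Beta (1-s) c - 1)/s)"
    using 3 pos c s by (subst nn_integral_eq_integral) (auto simp: indicator_def)
  finally show ?thesis .
qed

text \<open>
  The value is \<open>- B(- s, c)\<close> for the analytically continued Beta function.  As \<open>c < 1\<close> is possible, the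
  integrand need not have a constant sign; the splitting
  \<open>(1 - v)\<^bsup>c-1\<^esup> = (1 - v)\<^sup>c + v (1 - v)\<^bsup>c-1\<^esup>\<close> on \<open>(0, 1)\<close> yields pieces that do.
  For \<open>v > 1\<close> the convention \<open>0 powr a = 0\<close> leaves the tail \<open>v\<^bsup>-s-1\<^esup>\<close>.
\<close>

lemma has_bochner_integral_Beta_continued:
  assumes s: "0 < s" "s < 1" and c: "c > (s::real)"
  shows "has_bochner_integral lborel
      (\<lambda>v. v powr (- s - 1) * (1 - max 0 (1 - v) powr (c - 1)) * indicator {0<..} v)
      (Gamma (1 - s) * Gamma c / (s * Gamma (c - s)))"
proof -
  have c0: "c > 0" using s c by simp
  let ?A = "\<lambda>v. v powr (- s - 1) * (1 - (1 - v) powr c) * indicator {0<..<1} v"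
  let ?B = "\<lambda>v. v powr ((1 - s) - 1) * (1 - v) powr (c - 1) * indicator {0<..<1} v"
  let ?C = "\<lambda>v::real. v powr (- s - 1) * indicator {1<..} v"
  have "(\<integral>\<^sup>+v. ennreal (?A v) \<partial>lborel) = ennreal ((c * Beta (1 - s) c - 1) / s)"
    by (rule nn_integral_Beta_regularized[OF s c0])
  then have "(\<integral>\<^sup>+v. ennreal (?A v) \<partial>lborel) = ennreal (max 0 ((c * Beta (1 - s) c - 1) / s))"
    by (simp add: max_def ennreal_neg)
  then have A': "has_bochner_integral lborel ?A (max 0 ((c * Beta (1 - s) c - 1) / s))"
    unfolding has_bochner_integral_iff using c0
    by (subst nn_integral_eq_integrable[symmetric]) (auto simp: indicator_def powr_le1)
  have ge: "(c * Beta (1 - s) c - 1) / s \<ge> 0"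
  proof -
    have 1: "(\<integral>\<^sup>+v. ennreal (v powr ((1-s) - 1) * (1 - v) powr (c - 1) * indicator {0<..<1} v) \<partial>lborel) = ennreal (Beta (1-s) c)"
      using s c0 by (intro nn_integral_Beta) auto
    have 2: "(\<integral>\<^sup>+v. ennreal (v powr (1 - 1) * (1 - v) powr (c - 1) * indicator {0<..<1} v) \<partial>lborel) = ennreal (Beta 1 c)"
      using s c0 by (intro nn_integral_Beta) auto
    have "ennreal (Beta 1 c) \<le> ennreal (Beta (1-s) c)"
      unfolding 1[symmetric] 2[symmetric]
      using s by (intro nn_integral_mono ennreal_leI) (auto simp: indicator_def powr_minus one_le_inverse powr_le1 intro!: mult_right_mono)
    moreover have "Beta (1-s) c \<ge> 0" using c0 s by (simp add: Beta_def)
    moreover have "Beta 1 c = 1/c" by (rule Beta_1_real[OF c0])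
    ultimately have "1/c \<le> Beta (1-s) c" by simp
    then show ?thesis using c0 s by (simp add: field_simps)
  qed
  have A: "has_bochner_integral lborel ?A ((c * Beta (1 - s) c - 1) / s)" using A' ge by (simp add: max_def)
  have B: "has_bochner_integral lborel ?B (Beta (1 - s) c)"
    using c0 s by (intro has_bochner_integral_Beta) auto
  have C: "has_bochner_integral lborel ?C (1 / s)"
    unfolding has_bochner_integral_iff using s nn_integral_powr_Ioi[OF s(1), of 1]
    by (subst nn_integral_eq_integrable[symmetric]) auto
  have sum: "has_bochner_integral lborel (\<lambda>v. ?A v - ?B v + ?C v) ((c * Beta (1 - s) c - 1) / s - Beta (1 - s) c + 1 / s)"
    by (intro has_bochner_integral_add has_bochner_integral_diff A B C)
  have val: "(c * Beta (1 - s) c - 1) / s - Beta (1 - s) c + 1 / s = Gamma (1 - s) * Gamma c / (s * Gamma (c - s))"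
  proof -
    have "Gamma (1 - s + c) = (c - s) * Gamma (c - s)"
    proof -
      have "c - s \<notin> \<int>\<^sub>\<le>\<^sub>0" using c by (auto elim!: nonpos_Ints_cases)
      then show ?thesis using Gamma_plus1[of "c - s"] by (simp add: algebra_simps)
    qed
    then have "Beta (1 - s) c = Gamma (1 - s) * Gamma c / ((c - s) * Gamma (c - s))" by (simp add: Beta_def)
    moreover have "(c * Beta (1 - s) c - 1) / s - Beta (1 - s) c + 1 / s = (c - s) / s * Beta (1 - s) c"
      using s by (simp add: field_simps)
    ultimately show ?thesis using c by simp
  qed
  have pt: "?A v - ?B v + ?C v = v powr (- s - 1) * (1 - max 0 (1 - v) powr (c - 1)) * indicator {0<..} v"
    if "v \<noteq> 1" for v
  proof -
    consider "v \<le> 0" | "0 < v" "v < 1" | "v > 1" using \<open>v \<noteq> 1\<close> by linarith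
    then show ?thesis
    proof cases
      case 2
      have e1: "v powr (1 - s - 1) = v powr (-s-1) * v"
        using 2 by (simp add: powr_mult_base[symmetric] powr_diff powr_minus divide_simps)
      have e2: "(1 - v) powr c = (1 - v) * (1 - v) powr (c - 1)" using 2 by (simp add: powr_mult_base)
      have "k * (1 - (1 - v) * y) - k * v * y = k * (1 - y)" for k y :: real
        by (simp add: algebra_simps)
      then show ?thesis unfolding e1 e2 using 2 by (simp add: max_def)
    qed (auto simp: max_def)
  qed
  show ?thesis
  proof (rule has_bochner_integralI_AE[OF sum[unfolded val]])
    show "AE v in lborel. ?A v - ?B v + ?C v = v powr (- s - 1) * (1 - max 0 (1 - v) powr (c - 1)) * indicator {0<..} v"
      using AE_lborel_singleton[of 1] by eventually_elim (rule pt)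
  qed measurable
qed

section \<open>Gaussian integrals on a Euclidean space\<close>

lemma lborel_distr_reflect: "distr lborel borel (\<lambda>x::'a::euclidean_space. c - x) = lborel"
  by (subst lborel_affine[of "-1" c]) (auto simp: density_1)

lemma nn_integral_shift:
  fixes f :: "'a::euclidean_space \<Rightarrow> ennreal"
  assumes [measurable]: "f \<in> borel_measurable borel"
  shows "(\<integral>\<^sup>+x. f (c + x) \<partial>lborel) = (\<integral>\<^sup>+x. f x \<partial>lborel)"
  by (subst (2) lborel_distr_plus[of c, symmetric]) (simp add: nn_integral_distr)

lemma has_bochner_integral_shift:
  fixes f :: "'a::euclidean_space \<Rightarrow> 'b::{banach, second_countable_topology}"
  assumes f: "has_bochner_integral lborel f I"
  shows "has_bochner_integral lborel (\<lambda>x. f (c + x)) I"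
proof -
  have "has_bochner_integral (distr lborel borel ((+) c)) f I"
    using f by (simp add: lborel_distr_plus)
  moreover have "f \<in> borel_measurable borel" using f by (auto simp: has_bochner_integral_iff)
  ultimately show ?thesis
    by (simp add: has_bochner_integral_iff integrable_distr_eq integral_distr)
qed

lemma has_bochner_integral_reflect:
  fixes f :: "'a::euclidean_space \<Rightarrow> 'b::{banach, second_countable_topology}"
  assumes f: "has_bochner_integral lborel f I"
  shows "has_bochner_integral lborel (\<lambda>x. f (c - x)) I"
proof -
  have "has_bochner_integral (distr lborel borel (\<lambda>x. c - x)) f I"
    using f by (simp add: lborel_distr_reflect)
  moreover have "f \<in> borel_measurable borel" using f by (auto simp: has_bochner_integral_iff)
  ultimately show ?thesis
    by (simp add: has_bochner_integral_iff integrable_distr_eq integral_distr)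
qed

lemma gaussian_fourier_1d:
  assumes "\<sigma> > 0"
  shows "has_bochner_integral lborel (\<lambda>x. complex_of_real (exp (- \<sigma> * x\<^sup>2)) * iexp (t * x))
           (complex_of_real (sqrt (pi / \<sigma>) * exp (- t\<^sup>2 / (4 * \<sigma>))))"
proof -
  \<comment> \<open>rescaling by \<open>c\<close> turns \<open>exp (- x\<^sup>2/2)\<close> into \<open>exp (- \<sigma> x\<^sup>2)\<close>\<close>
  define c where "c = sqrt (2 * \<sigma>)"
  have c: "c > 0" "c\<^sup>2 = 2 * \<sigma>" using assms by (auto simp: c_def)
  have std: "has_bochner_integral lborel (\<lambda>x. complex_of_real (exp (- x\<^sup>2 / 2)) * iexp (u * x))
     (complex_of_real (sqrt (2 * pi) * exp (- u\<^sup>2 / 2)))" for u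
  proof -
    have i: "integrable lborel (\<lambda>x. std_normal_density x *\<^sub>R iexp (u * x))"
    proof (rule Bochner_Integration.integrable_bound)
      show "integrable lborel (std_normal_density)" by simp
    qed (auto simp: norm_mult)
    have "char std_normal_distribution u = (LINT x|lborel. std_normal_density x *\<^sub>R iexp (u * x))"
      by (simp add: char_def integral_density)
    then have "has_bochner_integral lborel (\<lambda>x. std_normal_density x *\<^sub>R iexp (u * x)) (complex_of_real (exp (- (u^2) / 2)))"
      using i by (simp add: char_std_normal_distribution has_bochner_integral_iff)
    then have "has_bochner_integral lborel (\<lambda>x. complex_of_real (sqrt (2*pi)) * (std_normal_density x *\<^sub>R iexp (u * x)))
       (complex_of_real (sqrt (2*pi)) * complex_of_real (exp (- (u^2) / 2)))"
      by (rule has_bochner_integral_mult_right)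
    moreover have "complex_of_real (sqrt (2*pi)) * (std_normal_density x *\<^sub>R iexp (u * x)) =
       complex_of_real (exp (- x\<^sup>2 / 2)) * iexp (u * x)" for x
      by (simp add: std_normal_density_def scaleR_conv_of_real real_sqrt_mult)
    ultimately show ?thesis by simp
  qed
  have "has_bochner_integral lborel (\<lambda>x. complex_of_real (exp (- (0 + c * x)\<^sup>2 / 2)) * iexp ((t/c) * (0 + c * x)))
     ((complex_of_real (sqrt (2 * pi) * exp (- (t/c)\<^sup>2 / 2))) /\<^sub>R \<bar>c\<bar>)"
    using lborel_has_bochner_integral_real_affine_iff[THEN iffD1, OF _ std[of "t/c"], of c 0] c by simp
  moreover have "(complex_of_real (sqrt (2 * pi) * exp (- (t/c)\<^sup>2 / 2))) /\<^sub>R \<bar>c\<bar> = complex_of_real (sqrt (pi / \<sigma>) * exp (- t\<^sup>2 / (4 * \<sigma>)))"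
  proof -
    have "sqrt (2 * pi) / c = sqrt (pi / \<sigma>)" using assms by (simp add: c_def real_sqrt_divide[symmetric])
    moreover have "- (t/c)\<^sup>2 / 2 = - t\<^sup>2 / (4 * \<sigma>)" using c by (simp add: power_divide)
    moreover have "(complex_of_real (sqrt (2 * pi) * exp (- (t/c)\<^sup>2 / 2))) /\<^sub>R \<bar>c\<bar> = complex_of_real (sqrt (2 * pi) / c * exp (- (t/c)\<^sup>2 / 2))"
      using c by (simp add: scaleR_conv_of_real field_simps)
    ultimately show ?thesis by (simp only:)
  qed
  moreover have "- (0 + c * x)\<^sup>2 / 2 = - \<sigma> * x\<^sup>2" "(t/c) * (0 + c * x) = t * x" for x
    using c by (auto simp: power_mult_distrib)
  ultimately show ?thesis by simp
qed

text \<open>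
  Gaussians and characters both factor over the coordinates, which reduces this to the characteristic
  function of the normal distribution.
\<close>

lemma gaussian_fourier:
  fixes \<xi> :: "'a::euclidean_space"
  assumes \<sigma>: "\<sigma> > 0"
  shows "has_bochner_integral lborel (\<lambda>z::'a. complex_of_real (exp (- \<sigma> * (norm z)\<^sup>2)) * iexp (z \<bullet> \<xi>))
           (complex_of_real ((pi / \<sigma>) powr (real DIM('a) / 2) * exp (- (norm \<xi>)\<^sup>2 / (4 * \<sigma>))))"
proof -
  interpret product_sigma_finite "\<lambda>_::'a. lborel :: real measure" ..
  let ?f = "\<lambda>b x. complex_of_real (exp (- \<sigma> * x\<^sup>2)) * iexp ((\<xi> \<bullet> b) * x)"
  let ?I = "\<lambda>b. complex_of_real (sqrt (pi / \<sigma>) * exp (- (\<xi> \<bullet> b)\<^sup>2 / (4 * \<sigma>)))"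
  let ?P = "\<Pi>\<^sub>M b\<in>(Basis::'a set). (lborel :: real measure)"
  let ?F = "\<lambda>z::'a. complex_of_real (exp (- \<sigma> * (norm z)\<^sup>2)) * iexp (z \<bullet> \<xi>)"
  have 1: "integrable lborel (?f b)" "integral\<^sup>L lborel (?f b) = ?I b" for b
    using gaussian_fourier_1d[OF \<sigma>, of "\<xi> \<bullet> b"] by (auto simp: has_bochner_integral_iff)
  have 2: "has_bochner_integral ?P (\<lambda>x. \<Prod>b\<in>Basis. ?f b (x b)) (\<Prod>b\<in>Basis. ?I b)"
    unfolding has_bochner_integral_iff
    using product_integrable_prod[OF finite_Basis 1(1)] product_integral_prod[OF finite_Basis 1(1)] 1(2) by simp
  have 3: "?F (\<Sum>b\<in>Basis. x b *\<^sub>R b) = (\<Prod>b\<in>Basis. ?f b (x b))" for x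
  proof -
    have n: "(norm (\<Sum>b\<in>Basis. x b *\<^sub>R (b::'a)))\<^sup>2 = (\<Sum>b\<in>Basis. (x b)\<^sup>2)"
      by (subst power2_norm_eq_inner, subst euclidean_inner) (simp add: power2_eq_square)
    have "(\<Sum>b\<in>Basis. x b *\<^sub>R (b::'a)) \<bullet> \<xi> = (\<Sum>b\<in>Basis. (\<xi> \<bullet> b) * x b)"
      unfolding inner_sum_left by (simp add: inner_commute mult.commute)
    moreover have "exp (- \<sigma> * (\<Sum>b\<in>Basis. (x (b::'a))\<^sup>2)) = (\<Prod>b\<in>Basis. exp (- \<sigma> * (x (b::'a))\<^sup>2))"
      by (simp add: sum_distrib_left exp_sum flip: sum_negf)
    moreover have "iexp (\<Sum>b\<in>Basis. (\<xi> \<bullet> b) * x (b::'a)) = (\<Prod>b\<in>Basis. iexp ((\<xi> \<bullet> b) * x (b::'a)))"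
      by (simp add: sum_distrib_left exp_sum)
    ultimately show ?thesis unfolding n by (simp only: prod.distrib of_real_prod)
  qed
  have 4: "(\<Prod>b\<in>Basis. ?I b) = complex_of_real ((pi / \<sigma>) powr (real DIM('a) / 2) * exp (- (norm \<xi>)\<^sup>2 / (4 * \<sigma>)))"
  proof -
    have "(norm \<xi>)\<^sup>2 = (\<Sum>b\<in>Basis. (\<xi> \<bullet> b)\<^sup>2)"
      by (subst power2_norm_eq_inner, subst euclidean_inner) (simp add: power2_eq_square)
    then have e: "(\<Prod>b\<in>Basis. exp (- (\<xi> \<bullet> b)\<^sup>2 / (4 * \<sigma>))) = exp (- (norm \<xi>)\<^sup>2 / (4 * \<sigma>))"
      by (simp add: exp_sum[symmetric] sum_negf sum_divide_distrib)
    have "sqrt (pi / \<sigma>) ^ DIM('a) = (pi / \<sigma>) powr (real DIM('a) / 2)"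
      using \<sigma> by (simp add: powr_half_sqrt[symmetric] powr_powr powr_realpow[symmetric])
    then show ?thesis using e by (simp only: of_real_prod[symmetric] prod.distrib prod_constant)
  qed
  have m: "(\<lambda>x. \<Sum>b\<in>Basis. x b *\<^sub>R (b::'a)) \<in> measurable ?P borel" by measurable
  have mF: "?F \<in> borel_measurable borel" by measurable
  show ?thesis
    unfolding has_bochner_integral_iff using 2[unfolded 4]
    by (subst (1 2) lborel_eq, subst integrable_distr_eq[OF m mF], subst integral_distr[OF m mF])
       (simp only: 3 has_bochner_integral_iff)
qed

lemma gaussian_integral:
  assumes "\<sigma> > 0"
  shows "has_bochner_integral lborel (\<lambda>z::'a::euclidean_space. exp (- \<sigma> * (norm z)\<^sup>2)) ((pi / \<sigma>) powr (real DIM('a) / 2))"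
  using has_bochner_integral_Re[OF gaussian_fourier[OF assms, of "0::'a"]] by simp

lemma gaussian_cos_integral:
  fixes \<xi> :: "'a::euclidean_space"
  assumes "\<sigma> > 0"
  shows "has_bochner_integral lborel (\<lambda>z::'a. exp (- \<sigma> * (norm z)\<^sup>2) * cos (z \<bullet> \<xi>))
           ((pi / \<sigma>) powr (real DIM('a) / 2) * exp (- (norm \<xi>)\<^sup>2 / (4 * \<sigma>)))"
  using has_bochner_integral_Re[OF gaussian_fourier[OF assms, of \<xi>]] by (simp add: Re_exp)

text \<open>
  A negative power of the norm is a mixture of Gaussians; every kernel below is treated through this
  formula.
\<close>

lemma powr_norm_subordination:
  assumes "a > 0" "z \<noteq> 0"
  shows "ennreal (norm z powr (- 2 * a)) =
    (\<integral>\<^sup>+t. ennreal (1 / Gamma a * (t powr (a - 1) * exp (- t * (norm z)\<^sup>2) * indicator {0<..} t)) \<partial>lborel)"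
proof -
  have "(\<integral>\<^sup>+t. ennreal (1 / Gamma a * (t powr (a - 1) * exp (- t * (norm z)\<^sup>2) * indicator {0<..} t)) \<partial>lborel)
    = (\<integral>\<^sup>+t. ennreal (1 / Gamma a) * ennreal (t powr (a - 1) * exp (- (norm z)\<^sup>2 * t) * indicator {0<..} t) \<partial>lborel)"
    using assms by (intro nn_integral_cong, subst ennreal_mult'[symmetric]) (auto simp: mult_ac)
  also have "\<dots> = ennreal (1 / Gamma a) * ennreal (Gamma a * ((norm z)\<^sup>2) powr (- a))"
    using assms by (subst nn_integral_cmult, measurable, subst nn_integral_Gamma) auto
  also have "((norm z)\<^sup>2) powr (- a) = norm z powr (- 2 * a)"
  proof -
    have "(norm z)\<^sup>2 = norm z powr 2" using assms by simp
    then show ?thesis by (simp only: powr_powr) simp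
  qed
  also have "ennreal (1 / Gamma a) * ennreal (Gamma a * norm z powr (- 2 * a)) = ennreal (norm z powr (- 2 * a))"
    using Gamma_real_pos[OF assms(1)] by (subst ennreal_mult'[symmetric]) auto
  finally show ?thesis by simp
qed

text \<open>
  Completing the square: the product is a Gaussian of weight \<open>\<tau> + \<sigma>\<close> about \<open>\<sigma> e / (\<tau> + \<sigma>)\<close>, times the
  harmonic weight \<open>\<tau> \<sigma> / (\<tau> + \<sigma>)\<close> at \<open>e\<close>.
\<close>

lemma gaussian_product_integral:
  fixes e :: "'a::euclidean_space"
  assumes "\<tau> > 0" "\<sigma> > 0"
  shows "(\<integral>\<^sup>+y. ennreal (exp (- \<tau> * (norm y)\<^sup>2) * exp (- \<sigma> * (norm (e - y))\<^sup>2)) \<partial>lborel)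
     = ennreal ((pi / (\<tau> + \<sigma>)) powr (real DIM('a) / 2) * exp (- (\<tau> * \<sigma> / (\<tau> + \<sigma>)) * (norm e)\<^sup>2))"
proof -
  define c where "c = - ((\<sigma> / (\<tau> + \<sigma>)) *\<^sub>R e)"
  have nz: "\<tau> + \<sigma> \<noteq> 0" using assms by simp
  have sq: "\<tau> * (norm y)\<^sup>2 + \<sigma> * (norm (e - y))\<^sup>2 = (\<tau> + \<sigma>) * (norm (c + y))\<^sup>2 + (\<tau> * \<sigma> / (\<tau> + \<sigma>)) * (norm e)\<^sup>2" for y
  proof -
    define k where "k = \<sigma> / (\<tau> + \<sigma>)"
    have k: "\<sigma> = k * (\<tau> + \<sigma>)" using nz by (simp add: k_def)
    have "c + y = y - k *\<^sub>R e" by (simp add: c_def k_def)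
    then have "(norm (c + y))\<^sup>2 = y \<bullet> y - 2 * k * (y \<bullet> e) + k\<^sup>2 * (e \<bullet> e)"
      by (simp only: power2_norm_eq_inner) (simp add: inner_diff_left inner_diff_right inner_commute power2_eq_square algebra_simps)
    then have "(\<tau> + \<sigma>) * (norm (c + y))\<^sup>2 = (\<tau> + \<sigma>) * (y \<bullet> y - 2 * k * (y \<bullet> e) + k\<^sup>2 * (e \<bullet> e))"
      by (simp only:)
    also have "\<dots> = (\<tau> + \<sigma>) * (y \<bullet> y) - 2 * (k * (\<tau> + \<sigma>)) * (y \<bullet> e) + k * (k * (\<tau> + \<sigma>)) * (e \<bullet> e)"
      by (simp add: power2_eq_square algebra_simps)
    also have "\<dots> = (\<tau> + \<sigma>) * (y \<bullet> y) - 2 * \<sigma> * (y \<bullet> e) + \<sigma>\<^sup>2 / (\<tau> + \<sigma>) * (e \<bullet> e)"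
      unfolding k[symmetric] by (simp add: k_def power2_eq_square)
    finally have "(\<tau> + \<sigma>) * (norm (c + y))\<^sup>2 = \<dots>" .
    moreover have "\<tau> * (norm y)\<^sup>2 + \<sigma> * (norm (e - y))\<^sup>2 = (\<tau> + \<sigma>) * (y \<bullet> y) - 2 * \<sigma> * (y \<bullet> e) + \<sigma> * (e \<bullet> e)"
      by (simp add: power2_norm_eq_inner inner_diff_left inner_diff_right inner_commute) (simp add: algebra_simps)
    moreover have "\<sigma> = \<sigma>\<^sup>2 / (\<tau> + \<sigma>) + \<tau> * \<sigma> / (\<tau> + \<sigma>)" 
    proof -
      have "\<sigma>\<^sup>2 + \<tau> * \<sigma> = \<sigma> * (\<tau> + \<sigma>)" by (simp add: power2_eq_square algebra_simps)
      then show ?thesis using nz by (simp add: add_divide_distrib[symmetric])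
    qed
    then have "\<sigma> * (e \<bullet> e) = \<sigma>\<^sup>2 / (\<tau> + \<sigma>) * (e \<bullet> e) + \<tau> * \<sigma> / (\<tau> + \<sigma>) * (e \<bullet> e)" by (metis distrib_right)
    ultimately show ?thesis by (simp add: power2_norm_eq_inner)
  qed
  have "(\<integral>\<^sup>+y. ennreal (exp (- \<tau> * (norm y)\<^sup>2) * exp (- \<sigma> * (norm (e - y))\<^sup>2)) \<partial>lborel)
    = (\<integral>\<^sup>+y. ennreal (exp (- (\<tau> * \<sigma> / (\<tau> + \<sigma>)) * (norm e)\<^sup>2)) * ennreal (exp (- (\<tau> + \<sigma>) * (norm (c + y))\<^sup>2)) \<partial>lborel)"
  proof (intro nn_integral_cong)
    fix y
    have "exp (- \<tau> * (norm y)\<^sup>2) * exp (- \<sigma> * (norm (e - y))\<^sup>2) = exp (- (\<tau> * (norm y)\<^sup>2 + \<sigma> * (norm (e - y))\<^sup>2))"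
      by (simp add: exp_add[symmetric])
    also have "\<dots> = exp (- (\<tau> * \<sigma> / (\<tau> + \<sigma>)) * (norm e)\<^sup>2) * exp (- (\<tau> + \<sigma>) * (norm (c + y))\<^sup>2)"
      unfolding sq exp_add[symmetric] by (simp add: algebra_simps)
    finally show "ennreal (exp (- \<tau> * (norm y)\<^sup>2) * exp (- \<sigma> * (norm (e - y))\<^sup>2)) = ennreal (exp (- (\<tau> * \<sigma> / (\<tau> + \<sigma>)) * (norm e)\<^sup>2)) * ennreal (exp (- (\<tau> + \<sigma>) * (norm (c + y))\<^sup>2))"
      by (simp add: ennreal_mult')
  qed
  also have "\<dots> = ennreal (exp (- (\<tau> * \<sigma> / (\<tau> + \<sigma>)) * (norm e)\<^sup>2)) * (\<integral>\<^sup>+y. ennreal (exp (- (\<tau> + \<sigma>) * (norm (c + y))\<^sup>2)) \<partial>lborel)"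
    by (rule nn_integral_cmult) simp
  also have "(\<integral>\<^sup>+y. ennreal (exp (- (\<tau> + \<sigma>) * (norm (c + y))\<^sup>2)) \<partial>lborel) = (\<integral>\<^sup>+y. ennreal (exp (- (\<tau> + \<sigma>) * (norm (y::'a))\<^sup>2)) \<partial>lborel)"
    by (rule nn_integral_shift) simp
  also have "\<dots> = ennreal ((pi / (\<tau> + \<sigma>)) powr (real DIM('a) / 2))"
    using gaussian_integral[of "\<tau> + \<sigma>", where 'a='a] assms
    by (subst nn_integral_eq_integral) (auto simp: has_bochner_integral_iff)
  finally show ?thesis by (simp add: ennreal_mult' mult.commute)
qed

section \<open>The Riesz composition formula\<close>

text \<open>
  After subordination of the power, the exponential depends on the parameter \<open>t\<close> only through
  \<open>k = t \<sigma> / (t + \<sigma>)\<close>.  Taking \<open>k\<close> as the variable makes the exponential elementary, and the remaining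
  factors become powers of \<open>k\<close> and \<open>1 - k/\<sigma>\<close>.
\<close>

lemma gaussian_potential:
  fixes e :: "'a::euclidean_space"
  defines "N \<equiv> real DIM('a)"
  assumes \<gamma>: "\<gamma> > 0" and \<sigma>: "\<sigma> > 0" and e: "norm e = 1"
  shows "(\<integral>\<^sup>+y. ennreal (norm y powr (- \<gamma>) * exp (- \<sigma> * (norm (e - y))\<^sup>2)) \<partial>lborel)
     = ennreal (pi powr (N / 2) / Gamma (\<gamma> / 2) * \<sigma> powr (- N / 2)) *
       (\<integral>\<^sup>+k. ennreal (k powr (\<gamma> / 2 - 1) * (1 - k / \<sigma>) powr ((N - \<gamma>) / 2 - 1) * exp (- k) * indicator {0<..<\<sigma>} k) \<partial>lborel)"
proof -
  define G where "G = 1 / Gamma (\<gamma> / 2)"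
  have G: "G > 0" using \<gamma> by (simp add: G_def)
  define f where "f t = G * t powr (\<gamma> / 2 - 1) * ((pi / (t + \<sigma>)) powr (N / 2) * exp (- (t * \<sigma> / (t + \<sigma>))))" for t
  let ?h = "\<lambda>y t. ennreal (G * t powr (\<gamma> / 2 - 1) * indicator {0<..} t * (exp (- t * (norm y)\<^sup>2) * exp (- \<sigma> * (norm (e - y))\<^sup>2)))"
  have "(\<integral>\<^sup>+y. ennreal (norm y powr (- \<gamma>) * exp (- \<sigma> * (norm (e - y))\<^sup>2)) \<partial>lborel) =
     (\<integral>\<^sup>+y. \<integral>\<^sup>+t. ?h y t \<partial>lborel \<partial>lborel)"
  proof (rule nn_integral_cong_AE)
    show "AE y in lborel. ennreal (norm y powr (- \<gamma>) * exp (- \<sigma> * (norm (e - y))\<^sup>2)) = (\<integral>\<^sup>+t. ?h y t \<partial>lborel)"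
      using AE_lborel_singleton[of 0]
    proof eventually_elim
      case (elim y)
      have "ennreal (norm y powr (- \<gamma>) * exp (- \<sigma> * (norm (e - y))\<^sup>2)) =
          ennreal (exp (- \<sigma> * (norm (e - y))\<^sup>2)) * ennreal (norm y powr (- 2 * (\<gamma> / 2)))"
        by (subst ennreal_mult'[symmetric]) (auto simp: mult.commute)
      also have "\<dots> = (\<integral>\<^sup>+t. ennreal (exp (- \<sigma> * (norm (e - y))\<^sup>2)) * ennreal (1 / Gamma (\<gamma> / 2) * (t powr (\<gamma> / 2 - 1) * exp (- t * (norm y)\<^sup>2) * indicator {0<..} t)) \<partial>lborel)"
        using \<gamma> elim by (subst powr_norm_subordination) (auto intro!: nn_integral_cmult[symmetric])
      also have "\<dots> = (\<integral>\<^sup>+t. ?h y t \<partial>lborel)"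
        by (intro nn_integral_cong, subst ennreal_mult'[symmetric]) (auto simp: G_def mult_ac)
      finally show ?case .
    qed
  qed
  also have "\<dots> = (\<integral>\<^sup>+t. \<integral>\<^sup>+y. ?h y t \<partial>lborel \<partial>lborel)"
    by (rule lborel_pair.Fubini') measurable
  also have "\<dots> = (\<integral>\<^sup>+t. ennreal (f t * indicator {0<..} t) \<partial>lborel)"
  proof (rule nn_integral_cong)
    fix t :: real
    show "(\<integral>\<^sup>+y. ?h y t \<partial>lborel) = ennreal (f t * indicator {0<..} t)"
    proof (cases "t > 0")
      case True
      have "(\<integral>\<^sup>+y. ?h y t \<partial>lborel) = (\<integral>\<^sup>+y. ennreal (G * t powr (\<gamma> / 2 - 1)) * ennreal (exp (- t * (norm y)\<^sup>2) * exp (- \<sigma> * (norm (e - y))\<^sup>2)) \<partial>lborel)"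
        using True G by (intro nn_integral_cong, subst ennreal_mult'[symmetric]) auto
      also have "\<dots> = ennreal (G * t powr (\<gamma> / 2 - 1)) * ennreal ((pi / (t + \<sigma>)) powr (N / 2) * exp (- (t * \<sigma> / (t + \<sigma>)) * (norm e)\<^sup>2))"
        unfolding N_def by (subst nn_integral_cmult, measurable, subst gaussian_product_integral[OF True \<sigma>]) auto
      also have "\<dots> = ennreal (f t * indicator {0<..} t)"
        using True G e by (subst ennreal_mult'[symmetric]) (auto simp: f_def)
      finally show ?thesis .
    qed auto
  qed
  also have "\<dots> = (\<integral>\<^sup>+k. ennreal (\<bar>1 / (1 - k / \<sigma>)\<^sup>2\<bar> * f (k / (1 - k / \<sigma>)) * indicator {0<..<\<sigma>} k) \<partial>lborel)"
  proof (rule set_nn_integral_substitution)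
    have inv: "y * \<sigma> / (y + \<sigma>) / (1 - y * \<sigma> / (y + \<sigma>) / \<sigma>) = y" if "y > 0" for y
    proof -
      have "1 - y * \<sigma> / (y + \<sigma>) / \<sigma> = 1 - y / (y + \<sigma>)" using that \<sigma> by simp
      also have "\<dots> = \<sigma> / (y + \<sigma>)" using that \<sigma> by (simp add: field_simps)
      finally have "1 - y * \<sigma> / (y + \<sigma>) / \<sigma> = \<sigma> / (y + \<sigma>)" .
      then show ?thesis using that \<sigma> by simp
    qed
    \<comment> \<open>\<open>t = k / (1 - k/\<sigma>)\<close> solves \<open>k = t \<sigma> / (t + \<sigma>)\<close>\<close>
    show "bij_betw (\<lambda>k. k / (1 - k / \<sigma>)) {0<..<\<sigma>} {0<..}"
    proof (rule bij_betwI[where g="\<lambda>t. t * \<sigma> / (t + \<sigma>)"])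
      show "(\<lambda>k. k / (1 - k / \<sigma>)) \<in> {0<..<\<sigma>} \<rightarrow> {0<..}" using \<sigma> by auto
      show "(\<lambda>t. t * \<sigma> / (t + \<sigma>)) \<in> {0<..} \<rightarrow> {0<..<\<sigma>}" using \<sigma> by (auto simp: field_simps)
      show "k / (1 - k / \<sigma>) * \<sigma> / (k / (1 - k / \<sigma>) + \<sigma>) = k" if "k \<in> {0<..<\<sigma>}" for k
        using that \<sigma> by (auto simp: field_simps)
      show "y * \<sigma> / (y + \<sigma>) / (1 - y * \<sigma> / (y + \<sigma>) / \<sigma>) = y" if "y \<in> {0<..}" for y
        using that by (intro inv) simp
    qed
    show "((\<lambda>k. k / (1 - k / \<sigma>)) has_real_derivative 1 / (1 - k / \<sigma>)\<^sup>2) (at k)" if "k \<in> {0<..<\<sigma>}" for k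
    proof -
      have "1 - k / \<sigma> \<noteq> 0" using that \<sigma> by auto
      then have "((\<lambda>k. k / (1 - k / \<sigma>)) has_real_derivative
          (1 * (1 - k / \<sigma>) - k * (0 - 1 / \<sigma>)) / ((1 - k / \<sigma>) * (1 - k / \<sigma>))) (at k)"
        by (intro DERIV_divide DERIV_ident DERIV_diff DERIV_const DERIV_cdivide)
      then show ?thesis by (simp add: power2_eq_square)
    qed
    show "f \<in> borel_measurable borel" unfolding f_def by measurable
    show "0 \<le> f y" if "y \<in> {0<..}" for y using G by (simp add: f_def)
  qed auto
  also have "\<dots> = (\<integral>\<^sup>+k. ennreal (pi powr (N / 2) * G * \<sigma> powr (- N / 2)) *
       ennreal (k powr (\<gamma> / 2 - 1) * (1 - k / \<sigma>) powr ((N - \<gamma>) / 2 - 1) * exp (- k) * indicator {0<..<\<sigma>} k) \<partial>lborel)"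
  proof (rule nn_integral_cong)
    fix k
    show "ennreal (\<bar>1 / (1 - k / \<sigma>)\<^sup>2\<bar> * f (k / (1 - k / \<sigma>)) * indicator {0<..<\<sigma>} k) =
      ennreal (pi powr (N / 2) * G * \<sigma> powr (- N / 2)) *
       ennreal (k powr (\<gamma> / 2 - 1) * (1 - k / \<sigma>) powr ((N - \<gamma>) / 2 - 1) * exp (- k) * indicator {0<..<\<sigma>} k)"
    proof (cases "0 < k \<and> k < \<sigma>")
      case True
      define w where "w = 1 - k / \<sigma>"
      have w: "w > 0" using True by (simp add: w_def)
      have s: "k / w + \<sigma> = \<sigma> / w" using w \<sigma> by (simp add: w_def field_simps)
      have k: "(k / w) * \<sigma> / (k / w + \<sigma>) = k" unfolding s using w \<sigma> by simp
      have p: "(pi / (\<sigma> / w)) powr (N / 2) = pi powr (N / 2) * w powr (N / 2) * \<sigma> powr (- N / 2)"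
        using w \<sigma> by (simp add: powr_mult powr_divide powr_minus field_simps)
      have q: "(k / w) powr r = k powr r * w powr (- r)" for r
        using w True by (simp add: powr_divide powr_minus_divide)
      have "\<bar>1 / w\<^sup>2\<bar> = w powr (-2)" using w by (simp add: powr_minus powr_numeral divide_inverse)
      then have "\<bar>1 / w\<^sup>2\<bar> * f (k / w) = w powr (-2) * (G * (k powr (\<gamma> / 2 - 1) * w powr (- (\<gamma> / 2 - 1))) *
          (pi powr (N / 2) * w powr (N / 2) * \<sigma> powr (- N / 2) * exp (- k)))"
        by (simp only: f_def k) (simp only: s p q)
      also have "\<dots> = pi powr (N / 2) * G * \<sigma> powr (- N / 2) * (k powr (\<gamma> / 2 - 1) * (w powr (-2) * w powr (- (\<gamma> / 2 - 1)) * w powr (N / 2)) * exp (- k))"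
        by (simp only: mult_ac)
      also have "w powr (-2) * w powr (- (\<gamma> / 2 - 1)) * w powr (N / 2) = w powr ((N - \<gamma>) / 2 - 1)"
      proof -
        have "(N - \<gamma>) / 2 - 1 = -2 + - (\<gamma> / 2 - 1) + N / 2" by (simp add: field_simps)
        then show ?thesis by (simp only: powr_add)
      qed
      finally show ?thesis using True G
        by (subst ennreal_mult'[symmetric]) (auto simp: w_def)
    qed auto
  qed
  also have "\<dots> = ennreal (pi powr (N / 2) * G * \<sigma> powr (- N / 2)) *
     (\<integral>\<^sup>+k. ennreal (k powr (\<gamma> / 2 - 1) * (1 - k / \<sigma>) powr ((N - \<gamma>) / 2 - 1) * exp (- k) * indicator {0<..<\<sigma>} k) \<partial>lborel)"
    by (rule nn_integral_cmult) measurable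
  finally show ?thesis by (simp add: G_def)
qed

text \<open>
  Subordinating the second kernel integrates the Gaussian potential against \<open>\<sigma>\<^bsup>\<mu>/2-1\<^esup>\<close>.  In the variable
  \<open>v = k/\<sigma>\<close> the double integral splits into a Beta integral in \<open>v\<close> and a Gamma integral in \<open>k\<close>.
  The constant depends on \<open>\<alpha>\<close> and \<open>p\<close> only through \<open>\<gamma> = \<alpha> p\<close>, hence the last argument \<open>1\<close>.
\<close>

lemma riesz_composition:
  fixes e :: "'a::euclidean_space"
  defines "N \<equiv> real DIM('a)"
  assumes \<gamma>: "\<gamma> > 0" "\<gamma> < N" and \<mu>: "\<mu> > 0" "\<mu> < N" and sum: "\<mu> + \<gamma> > N" and e: "norm e = 1"
  shows "(\<integral>\<^sup>+y. ennreal (norm y powr (- \<gamma>) * norm (e - y) powr (- \<mu>)) \<partial>lborel) = ennreal (C_const DIM('a) \<mu> \<gamma> 1)"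
proof -
  define G where "G = 1 / Gamma (\<mu> / 2)"
  have G: "G > 0" using \<mu> by (simp add: G_def)
  define c where "c = pi powr (N / 2) / Gamma (\<gamma> / 2)"
  have c: "c > 0" using \<gamma> by (simp add: c_def)
  define b where "b = (N - \<gamma>) / 2 - 1"
  let ?F = "\<lambda>\<sigma> k. ennreal (k powr (\<gamma> / 2 - 1) * (1 - k / \<sigma>) powr b * exp (- k) * indicator {0<..<\<sigma>} k)"
  let ?h = "\<lambda>y \<sigma>. ennreal (G * \<sigma> powr (\<mu> / 2 - 1) * indicator {0<..} \<sigma>) * ennreal (norm y powr (- \<gamma>) * exp (- \<sigma> * (norm (e - y))\<^sup>2))"
  let ?H = "\<lambda>\<sigma> k. ennreal (G * c) * ennreal (k powr (\<gamma> / 2 - 1) * exp (- k) * indicator {0<..} k) *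
              ennreal (\<sigma> powr ((\<mu> - N) / 2 - 1) * (1 - k / \<sigma>) powr b * indicator {k<..} \<sigma>)"
  have "(\<integral>\<^sup>+y. ennreal (norm y powr (- \<gamma>) * norm (e - y) powr (- \<mu>)) \<partial>lborel) =
     (\<integral>\<^sup>+y. \<integral>\<^sup>+\<sigma>. ?h y \<sigma> \<partial>lborel \<partial>lborel)"
  proof (rule nn_integral_cong_AE)
    show "AE y in lborel. ennreal (norm y powr (- \<gamma>) * norm (e - y) powr (- \<mu>)) = (\<integral>\<^sup>+\<sigma>. ?h y \<sigma> \<partial>lborel)"
      using AE_lborel_singleton[of e]
    proof eventually_elim
      case (elim y)
      have "ennreal (norm y powr (- \<gamma>) * norm (e - y) powr (- \<mu>)) =
          ennreal (norm y powr (- \<gamma>)) * ennreal (norm (e - y) powr (- 2 * (\<mu> / 2)))"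
        by (subst ennreal_mult'[symmetric]) auto
      also have "\<dots> = (\<integral>\<^sup>+t. ennreal (norm y powr (- \<gamma>)) * ennreal (1 / Gamma (\<mu> / 2) * (t powr (\<mu> / 2 - 1) * exp (- t * (norm (e - y))\<^sup>2) * indicator {0<..} t)) \<partial>lborel)"
        using \<mu> elim by (subst powr_norm_subordination) (auto intro!: nn_integral_cmult[symmetric])
      also have "\<dots> = (\<integral>\<^sup>+\<sigma>. ?h y \<sigma> \<partial>lborel)"
        using G by (intro nn_integral_cong, subst (1 2) ennreal_mult'[symmetric]) (auto simp: G_def mult_ac)
      finally show ?case .
    qed
  qed
  also have "\<dots> = (\<integral>\<^sup>+\<sigma>. \<integral>\<^sup>+y. ?h y \<sigma> \<partial>lborel \<partial>lborel)"
    by (rule lborel_pair.Fubini') measurable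
  also have "\<dots> = (\<integral>\<^sup>+\<sigma>. \<integral>\<^sup>+k. ?H \<sigma> k \<partial>lborel \<partial>lborel)"
  proof (rule nn_integral_cong)
    fix \<sigma> :: real
    show "(\<integral>\<^sup>+y. ?h y \<sigma> \<partial>lborel) = (\<integral>\<^sup>+k. ?H \<sigma> k \<partial>lborel)"
    proof (cases "\<sigma> > 0")
      case True
      have "(\<integral>\<^sup>+y. ?h y \<sigma> \<partial>lborel) = ennreal (G * \<sigma> powr (\<mu> / 2 - 1) * indicator {0<..} \<sigma>) *
         (ennreal (c * \<sigma> powr (- N / 2)) * (\<integral>\<^sup>+k. ?F \<sigma> k \<partial>lborel))"
        unfolding c_def b_def N_def
        by (subst nn_integral_cmult, measurable, subst gaussian_potential[OF \<gamma>(1) True e]) (rule refl)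
      also have "\<dots> = (\<integral>\<^sup>+k. ennreal (G * \<sigma> powr (\<mu> / 2 - 1) * indicator {0<..} \<sigma>) * (ennreal (c * \<sigma> powr (- N / 2)) * ?F \<sigma> k) \<partial>lborel)"
        by (simp add: nn_integral_cmult)
      also have "\<dots> = (\<integral>\<^sup>+k. ?H \<sigma> k \<partial>lborel)"
      proof (rule nn_integral_cong)
        fix k :: real
        have p: "\<sigma> powr ((\<mu> - N) / 2 - 1) = \<sigma> powr (\<mu> / 2 - 1) * \<sigma> powr (- N / 2)"
        proof -
          have "(\<mu> - N) / 2 - 1 = (\<mu> / 2 - 1) + (- N / 2)" by (simp add: field_simps)
          then show ?thesis by (simp only: powr_add)
        qed
        show "ennreal (G * \<sigma> powr (\<mu> / 2 - 1) * indicator {0<..} \<sigma>) * (ennreal (c * \<sigma> powr (- N / 2)) * ?F \<sigma> k) = ?H \<sigma> k"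
          unfolding p using True G c
          by (auto simp: ennreal_mult'[symmetric] ennreal_mult''[symmetric] indicator_def mult_ac)
      qed
      finally show ?thesis .
    next
      case False
      have "(\<integral>\<^sup>+k. ?H \<sigma> k \<partial>lborel) = (\<integral>\<^sup>+(k::real). 0 \<partial>lborel)"
        using False by (intro nn_integral_cong) (auto simp: indicator_def)
      then show ?thesis using False by simp
    qed
  qed
  also have "\<dots> = (\<integral>\<^sup>+k. \<integral>\<^sup>+\<sigma>. ?H \<sigma> k \<partial>lborel \<partial>lborel)"
    by (rule lborel_pair.Fubini') (unfold indicator_def greaterThan_iff, measurable)
  also have "\<dots> = (\<integral>\<^sup>+k. ennreal (G * c * Beta ((N - \<mu>) / 2) ((N - \<gamma>) / 2)) *
      ennreal (k powr ((\<gamma> + \<mu> - N) / 2 - 1) * exp (- 1 * k) * indicator {0<..} k) \<partial>lborel)"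
  proof (rule nn_integral_cong)
    fix k :: real
    show "(\<integral>\<^sup>+\<sigma>. ?H \<sigma> k \<partial>lborel) = ennreal (G * c * Beta ((N - \<mu>) / 2) ((N - \<gamma>) / 2)) *
      ennreal (k powr ((\<gamma> + \<mu> - N) / 2 - 1) * exp (- 1 * k) * indicator {0<..} k)"
    proof (cases "k > 0")
      case True
      have "(\<integral>\<^sup>+\<sigma>. ennreal (\<sigma> powr ((\<mu> - N) / 2 - 1) * (1 - k / \<sigma>) powr b * indicator {k<..} \<sigma>) \<partial>lborel)
        = (\<integral>\<^sup>+v. ennreal (\<bar>- k / v\<^sup>2\<bar> * ((k / v) powr ((\<mu> - N) / 2 - 1) * (1 - k / (k / v)) powr b) * indicator {0<..<1} v) \<partial>lborel)"
        by (rule set_nn_integral_substitution)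
          (use True in \<open>auto intro!: bij_betwI[where g="\<lambda>\<sigma>. k / \<sigma>"] derivative_eq_intros simp: field_simps power2_eq_square\<close>)
      also have "\<dots> = (\<integral>\<^sup>+v. ennreal (k powr ((\<mu> - N) / 2)) * ennreal (v powr ((N - \<mu>) / 2 - 1) * (1 - v) powr ((N - \<gamma>) / 2 - 1) * indicator {0<..<1} v) \<partial>lborel)"
      proof (rule nn_integral_cong)
        fix v :: real
        show "ennreal (\<bar>- k / v\<^sup>2\<bar> * ((k / v) powr ((\<mu> - N) / 2 - 1) * (1 - k / (k / v)) powr b) * indicator {0<..<1} v) =
          ennreal (k powr ((\<mu> - N) / 2)) * ennreal (v powr ((N - \<mu>) / 2 - 1) * (1 - v) powr ((N - \<gamma>) / 2 - 1) * indicator {0<..<1} v)"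
        proof (cases "0 < v \<and> v < 1")
          case v: True
          have "\<bar>- k / v\<^sup>2\<bar> = k powr 1 * v powr (-2)" using v True by (simp add: powr_minus powr_numeral divide_inverse)
          moreover have "(k / v) powr ((\<mu> - N) / 2 - 1) = k powr ((\<mu> - N) / 2 - 1) * v powr ((N - \<mu>) / 2 + 1)"
          proof -
            have "(N - \<mu>) / 2 + 1 = - ((\<mu> - N) / 2 - 1)" by (simp add: field_simps)
            moreover have "(k / v) powr r = k powr r * v powr (- r)" for r
              using v True by (simp add: powr_divide powr_minus_divide)
            ultimately show ?thesis by (simp only:)
          qed
          ultimately have "\<bar>- k / v\<^sup>2\<bar> * (k / v) powr ((\<mu> - N) / 2 - 1) =
             (k powr 1 * k powr ((\<mu> - N) / 2 - 1)) * (v powr (-2) * v powr ((N - \<mu>) / 2 + 1))"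
            by (simp only: mult_ac)
          also have "\<dots> = k powr ((\<mu> - N) / 2) * v powr ((N - \<mu>) / 2 - 1)"
            by (simp only: powr_add[symmetric]) simp
          finally have "\<bar>- k / v\<^sup>2\<bar> * ((k / v) powr ((\<mu> - N) / 2 - 1) * (1 - v) powr b) =
             k powr ((\<mu> - N) / 2) * (v powr ((N - \<mu>) / 2 - 1) * (1 - v) powr b)"
            by (metis mult.assoc)
          moreover have "k / (k / v) = v" using v True by simp
          ultimately show ?thesis using v by (simp only: b_def ennreal_mult'[symmetric] powr_ge_zero) simp
        qed auto
      qed
      also have "\<dots> = ennreal (k powr ((\<mu> - N) / 2)) * ennreal (Beta ((N - \<mu>) / 2) ((N - \<gamma>) / 2))"
        using \<gamma> \<mu> by (subst nn_integral_cmult, measurable, subst nn_integral_Beta) auto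
      finally have 1: "(\<integral>\<^sup>+\<sigma>. ennreal (\<sigma> powr ((\<mu> - N) / 2 - 1) * (1 - k / \<sigma>) powr b * indicator {k<..} \<sigma>) \<partial>lborel)
         = ennreal (k powr ((\<mu> - N) / 2)) * ennreal (Beta ((N - \<mu>) / 2) ((N - \<gamma>) / 2))" .
      have B: "Beta ((N - \<mu>) / 2) ((N - \<gamma>) / 2) > 0"
        unfolding Beta_def using \<gamma> \<mu> by (intro divide_pos_pos mult_pos_pos Gamma_real_pos add_pos_pos) auto
      have "(\<integral>\<^sup>+\<sigma>. ?H \<sigma> k \<partial>lborel) = ennreal (G * c) * ennreal (k powr (\<gamma> / 2 - 1) * exp (- k) * indicator {0<..} k) *
         (ennreal (k powr ((\<mu> - N) / 2)) * ennreal (Beta ((N - \<mu>) / 2) ((N - \<gamma>) / 2)))"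
        unfolding 1[symmetric] by (rule nn_integral_cmult) measurable
      moreover have "k powr ((\<gamma> + \<mu> - N) / 2 - 1) = k powr (\<gamma> / 2 - 1) * k powr ((\<mu> - N) / 2)"
      proof -
        have "(\<gamma> + \<mu> - N) / 2 - 1 = (\<gamma> / 2 - 1) + (\<mu> - N) / 2" by (simp add: field_simps)
        then show ?thesis by (simp only: powr_add)
      qed
      ultimately show ?thesis using True G c B
        by (simp add: ennreal_mult'[symmetric] mult_ac)
    qed auto
  qed
  also have "\<dots> = ennreal (G * c * Beta ((N - \<mu>) / 2) ((N - \<gamma>) / 2)) * ennreal (Gamma ((\<gamma> + \<mu> - N) / 2))"
    using sum nn_integral_Gamma[of "(\<gamma> + \<mu> - N) / 2" 1] by (subst nn_integral_cmult) auto
  also have "\<dots> = ennreal (C_const DIM('a) \<mu> \<gamma> 1)"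
  proof -
    have "Gamma ((\<gamma> + \<mu> - N) / 2) > 0" using sum by simp
    moreover have "(N - \<mu>) / 2 + (N - \<gamma>) / 2 = (2 * N - \<mu> - \<gamma>) / 2" by (simp add: field_simps)
    moreover have "G * c * Beta ((N - \<mu>) / 2) ((N - \<gamma>) / 2) * Gamma ((\<gamma> + \<mu> - N) / 2) = C_const DIM('a) \<mu> \<gamma> 1"
      unfolding C_const_def Beta_def G_def c_def N_def[symmetric] calculation(2)
      by (simp add: add.commute[of \<gamma>])
    ultimately show ?thesis by (simp add: ennreal_mult''[symmetric])
  qed
  finally show ?thesis .
qed

section \<open>The Levy kernel and the symmetrised principal value\<close>

text \<open>
  The integral of \<open>(1 - cos (z \<bullet> \<xi>)) |z|\<^bsup>-N-2s\<^esup>\<close> for a unit vector \<open>\<xi>\<close>; its reciprocal turns out to be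
  the normalising constant of the fractional Laplacian.
\<close>

definition multiplier_integral :: "'a::euclidean_space itself \<Rightarrow> real \<Rightarrow> real" where
  "multiplier_integral T s =
     pi powr (real DIM('a) / 2) * 4 powr (- s) * Gamma (1 - s) / (s * Gamma (real DIM('a) / 2 + s))"

lemma multiplier_integral_pos:
  assumes "0 < s" "s < 1"
  shows "multiplier_integral TYPE('a::euclidean_space) s > 0"
  unfolding multiplier_integral_def using assms
  by (intro divide_pos_pos mult_pos_pos Gamma_real_pos) auto

lemma nn_integral_inverse_Gamma_regularized:
  assumes s: "0 < s" "s < 1" and c: "c \<ge> (0::real)"
  shows "(\<integral>\<^sup>+t. ennreal (t powr (s - 1) * (1 - exp (- c / t)) * indicator {0<..} t) \<partial>lborel)
           = ennreal (Gamma (1 - s) / s * c powr s)"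
proof (cases "c = 0")
  case False
  have "(\<integral>\<^sup>+t. ennreal (t powr (s - 1) * (1 - exp (- c / t)) * indicator {0<..} t) \<partial>lborel) =
    (\<integral>\<^sup>+x. ennreal (\<bar>- (1 / x\<^sup>2)\<bar> * ((1 / x) powr (s - 1) * (1 - exp (- c / (1 / x)))) * indicator {0<..} x) \<partial>lborel)"
    by (rule set_nn_integral_substitution)
      (use c in \<open>auto intro!: bij_betwI[where g="\<lambda>x. 1 / x"] derivative_eq_intros simp: power2_eq_square\<close>)
  also have "\<dots> = (\<integral>\<^sup>+x. ennreal (x powr (- s - 1) * (1 - exp (- c * x)) * indicator {0<..} x) \<partial>lborel)"
  proof (rule nn_integral_cong)
    fix x :: real
    show "ennreal (\<bar>- (1 / x\<^sup>2)\<bar> * ((1 / x) powr (s - 1) * (1 - exp (- c / (1 / x)))) * indicator {0<..} x) =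
      ennreal (x powr (- s - 1) * (1 - exp (- c * x)) * indicator {0<..} x)"
    proof (cases "x > 0")
      case True
      have "(1 / x) powr (s - 1) = x powr (1 - s)" using True
        by (simp add: powr_divide powr_minus_divide[symmetric])
      moreover have "\<bar>- (1 / x\<^sup>2)\<bar> = x powr (-2)" using True by (simp add: powr_minus powr_numeral divide_inverse)
      moreover have "x powr (-2) * x powr (1 - s) = x powr (- s - 1)"
      proof -
        have "- s - 1 = -2 + (1 - s)" by simp
        then show ?thesis by (simp only: powr_add)
      qed
      ultimately show ?thesis using True by (simp add: mult.assoc[symmetric] del: abs_minus_cancel abs_divide)
    qed auto
  qed
  also have "\<dots> = ennreal (Gamma (1 - s) / s * c powr s)"
    using False c by (intro nn_integral_Gamma_regularized s) auto
  finally show ?thesis .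
qed (use s in simp)

text \<open>
  Subordination gives the dependence on \<open>\<xi>\<close> at once, through the Gaussian transform, with no appeal to
  rotations or dilations.
\<close>

lemma nn_integral_cos_kernel:
  fixes \<xi> :: "'a::euclidean_space"
  assumes s: "0 < s" "s < 1"
  shows "(\<integral>\<^sup>+z. ennreal ((1 - cos (z \<bullet> \<xi>)) / norm z powr (real DIM('a) + 2 * s)) \<partial>lborel)
     = ennreal (multiplier_integral TYPE('a) s * norm \<xi> powr (2 * s))"
proof -
  define a where "a = real DIM('a) / 2 + s"
  define G where "G = 1 / Gamma a"
  have a: "a > 0" "real DIM('a) + 2 * s = 2 * a" using s by (auto simp: a_def add_pos_nonneg)
  have G: "G > 0" using a by (simp add: G_def)
  let ?h = "\<lambda>z t. ennreal (G * t powr (a - 1) * indicator {0<..} t * (exp (- t * (norm z)\<^sup>2) * (1 - cos (z \<bullet> \<xi>))))"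
  have "(\<integral>\<^sup>+z. ennreal ((1 - cos (z \<bullet> \<xi>)) / norm z powr (real DIM('a) + 2 * s)) \<partial>lborel) =
     (\<integral>\<^sup>+z. \<integral>\<^sup>+t. ?h z t \<partial>lborel \<partial>lborel)"
  proof (rule nn_integral_cong_AE)
    show "AE z in lborel. ennreal ((1 - cos (z \<bullet> \<xi>)) / norm z powr (real DIM('a) + 2 * s)) = (\<integral>\<^sup>+t. ?h z t \<partial>lborel)"
      using AE_lborel_singleton[of 0]
    proof eventually_elim
      case (elim z)
      have "ennreal ((1 - cos (z \<bullet> \<xi>)) / norm z powr (real DIM('a) + 2 * s)) =
          ennreal (1 - cos (z \<bullet> \<xi>)) * ennreal (norm z powr (- 2 * a))"
        by (subst ennreal_mult'[symmetric]) (auto simp: a(2) powr_minus divide_inverse)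
      also have "\<dots> = (\<integral>\<^sup>+t. ennreal (1 - cos (z \<bullet> \<xi>)) * ennreal (1 / Gamma a * (t powr (a - 1) * exp (- t * (norm z)\<^sup>2) * indicator {0<..} t)) \<partial>lborel)"
        using a elim by (subst powr_norm_subordination) (auto intro!: nn_integral_cmult[symmetric])
      also have "\<dots> = (\<integral>\<^sup>+t. ?h z t \<partial>lborel)"
        by (intro nn_integral_cong, subst ennreal_mult'[symmetric]) (auto simp: G_def mult_ac)
      finally show ?case .
    qed
  qed
  also have "\<dots> = (\<integral>\<^sup>+t. \<integral>\<^sup>+z. ?h z t \<partial>lborel \<partial>lborel)"
    by (rule lborel_pair.Fubini') measurable
  also have "\<dots> = (\<integral>\<^sup>+t. ennreal (G * pi powr (real DIM('a) / 2)) *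
      ennreal (t powr (s - 1) * (1 - exp (- ((norm \<xi>)\<^sup>2 / 4) / t)) * indicator {0<..} t) \<partial>lborel)"
  proof (rule nn_integral_cong)
    fix t :: real
    show "(\<integral>\<^sup>+z. ?h z t \<partial>lborel) = ennreal (G * pi powr (real DIM('a) / 2)) *
      ennreal (t powr (s - 1) * (1 - exp (- ((norm \<xi>)\<^sup>2 / 4) / t)) * indicator {0<..} t)"
    proof (cases "t > 0")
      case True
      have d: "has_bochner_integral lborel (\<lambda>z::'a. exp (- t * (norm z)\<^sup>2) - exp (- t * (norm z)\<^sup>2) * cos (z \<bullet> \<xi>))
          ((pi / t) powr (real DIM('a) / 2) - (pi / t) powr (real DIM('a) / 2) * exp (- (norm \<xi>)\<^sup>2 / (4 * t)))"
        using True by (intro has_bochner_integral_diff gaussian_integral gaussian_cos_integral)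
      have "(\<integral>\<^sup>+z. ennreal (exp (- t * (norm z)\<^sup>2) * (1 - cos (z \<bullet> \<xi>))) \<partial>lborel) =
         ennreal ((pi / t) powr (real DIM('a) / 2) - (pi / t) powr (real DIM('a) / 2) * exp (- (norm \<xi>)\<^sup>2 / (4 * t)))"
        using d by (subst nn_integral_eq_integral) (auto simp: has_bochner_integral_iff right_diff_distrib)
      moreover have "(\<integral>\<^sup>+z. ?h z t \<partial>lborel) = (\<integral>\<^sup>+z. ennreal (G * t powr (a - 1)) * ennreal (exp (- t * (norm z)\<^sup>2) * (1 - cos (z \<bullet> \<xi>))) \<partial>lborel)"
        using True G by (intro nn_integral_cong, subst ennreal_mult'[symmetric]) auto
      ultimately have "(\<integral>\<^sup>+z. ?h z t \<partial>lborel) = ennreal (G * t powr (a - 1)) *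
         ennreal ((pi / t) powr (real DIM('a) / 2) - (pi / t) powr (real DIM('a) / 2) * exp (- (norm \<xi>)\<^sup>2 / (4 * t)))"
        by (simp add: nn_integral_cmult)
      also have "\<dots> = ennreal (G * t powr (a - 1) * ((pi / t) powr (real DIM('a) / 2) * (1 - exp (- (norm \<xi>)\<^sup>2 / (4 * t)))))"
        using G by (subst ennreal_mult'[symmetric]) (auto simp: right_diff_distrib)
      also have "G * t powr (a - 1) * ((pi / t) powr (real DIM('a) / 2) * (1 - exp (- (norm \<xi>)\<^sup>2 / (4 * t)))) =
         G * pi powr (real DIM('a) / 2) * (t powr (s - 1) * (1 - exp (- ((norm \<xi>)\<^sup>2 / 4) / t)))"
      proof -
        have "(pi / t) powr (real DIM('a) / 2) = pi powr (real DIM('a) / 2) * t powr (- (real DIM('a) / 2))"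
          using True by (simp add: powr_divide powr_minus_divide)
        moreover have "s - 1 = (a - 1) + - (real DIM('a) / 2)" by (simp add: a_def)
        then have "t powr (s - 1) = t powr (a - 1) * t powr (- (real DIM('a) / 2))" by (simp only: powr_add)
        ultimately show ?thesis by simp
      qed
      finally show ?thesis using True G by (simp add: ennreal_mult'[symmetric])
    qed auto
  qed
  also have "\<dots> = ennreal (G * pi powr (real DIM('a) / 2)) * ennreal (Gamma (1 - s) / s * ((norm \<xi>)\<^sup>2 / 4) powr s)"
    using s by (subst nn_integral_cmult, measurable, subst nn_integral_inverse_Gamma_regularized) auto
  also have "((norm \<xi>)\<^sup>2 / 4) powr s = norm \<xi> powr (2 * s) * 4 powr (- s)"
  proof (cases "\<xi> = 0")
    case False
    then have "(norm \<xi>)\<^sup>2 = norm \<xi> powr 2" by simp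
    then show ?thesis by (simp only: powr_divide powr_powr powr_minus_divide) simp
  qed (use s in simp)
  also have "ennreal (G * pi powr (real DIM('a) / 2)) * ennreal (Gamma (1 - s) / s * (norm \<xi> powr (2 * s) * 4 powr (- s)))
     = ennreal (multiplier_integral TYPE('a) s * norm \<xi> powr (2 * s))"
    using G by (subst ennreal_mult'[symmetric]) (auto simp: multiplier_integral_def a_def[symmetric] G_def mult_ac)
  finally show ?thesis .
qed

lemma has_bochner_integral_cos_kernel:
  fixes \<xi> :: "'a::euclidean_space"
  assumes s: "0 < s" "s < 1"
  shows "has_bochner_integral lborel (\<lambda>z. (1 - cos (z \<bullet> \<xi>)) / norm z powr (real DIM('a) + 2 * s))
     (multiplier_integral TYPE('a) s * norm \<xi> powr (2 * s))"
  unfolding has_bochner_integral_iff using nn_integral_cos_kernel[OF s, of \<xi>] multiplier_integral_pos[OF s, where 'a='a]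
  by (subst nn_integral_eq_integrable[symmetric]) auto

lemma min_le_one_minus_exp: "min 1 (r\<^sup>2) \<le> 16 * (1 - exp (- (r\<^sup>2 / 8)))" for r :: real
proof -
  define x where "x = r\<^sup>2 / 8"
  have x: "x \<ge> 0" by (simp add: x_def)
  have "exp (- x) \<le> 1 / (1 + x)"
    using exp_ge_add_one_self[of x] x by (simp add: exp_minus field_simps)
  then have "16 * (1 - exp (-x)) \<ge> 16 * (x / (1 + x))" using x by (simp add: field_simps)
  moreover have "16 * (x / (1 + x)) \<ge> min 1 (8 * x)"
  proof (cases "x \<le> 1")
    case True
    have "8 * x * (1 + x) \<le> 8 * x * 2" using True x by (intro mult_left_mono) auto
    then have "8 * x \<le> 16 * (x / (1 + x))" using x by (simp add: field_simps)
    then show ?thesis by linarith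
  next
    case False
    then have "1 \<le> 16 * (x / (1 + x))" by (simp add: field_simps)
    then show ?thesis by linarith
  qed
  ultimately show ?thesis by (simp add: x_def)
qed

text \<open>
  Integrating \<open>1 - cos (z \<bullet> \<xi>)\<close> over \<open>\<xi>\<close> against a Gaussian gives a multiple of \<open>1 - exp (- |z|\<^sup>2/8)\<close>,
  which dominates a multiple of \<open>min 1 |z|\<^sup>2\<close>.  So the claim follows from \<open>nn_integral_cos_kernel\<close> and the finiteness
  of the Gaussian moment of order \<open>2s\<close>.
\<close>

lemma integrable_levy_kernel:
  assumes s: "0 < s" "s < 1"
  shows "integrable lborel (\<lambda>z::'a::euclidean_space. min 1 ((norm z)\<^sup>2) / norm z powr (real DIM('a) + 2 * s))"
proof -
  let ?k = "\<lambda>z::'a. norm z powr (real DIM('a) + 2 * s)"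
  let ?M = "multiplier_integral TYPE('a) s"
  define c where "c = (pi / 2) powr (real DIM('a) / 2)"
  have c: "c > 0" by (simp add: c_def)
  let ?h = "\<lambda>z \<xi>::'a. ennreal (exp (- 2 * (norm \<xi>)\<^sup>2)) * ennreal ((1 - cos (z \<bullet> \<xi>)) / ?k z)"
  have "(\<integral>\<^sup>+z. ennreal (c * (1 - exp (- ((norm z)\<^sup>2 / 8))) / ?k z) \<partial>lborel) = (\<integral>\<^sup>+z. \<integral>\<^sup>+\<xi>. ?h z \<xi> \<partial>lborel \<partial>lborel)"
  proof (rule nn_integral_cong)
    fix z :: 'a
    have d: "has_bochner_integral lborel (\<lambda>\<xi>::'a. exp (- 2 * (norm \<xi>)\<^sup>2) - exp (- 2 * (norm \<xi>)\<^sup>2) * cos (\<xi> \<bullet> z))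
          (c - c * exp (- (norm z)\<^sup>2 / (4 * 2)))"
      unfolding c_def by (intro has_bochner_integral_diff gaussian_integral gaussian_cos_integral) auto
    have "(\<integral>\<^sup>+\<xi>. ?h z \<xi> \<partial>lborel) = (\<integral>\<^sup>+\<xi>. ennreal (1 / ?k z) * ennreal (exp (- 2 * (norm \<xi>)\<^sup>2) - exp (- 2 * (norm \<xi>)\<^sup>2) * cos (\<xi> \<bullet> z)) \<partial>lborel)"
      by (intro nn_integral_cong, subst (1 2) ennreal_mult'[symmetric]) (auto simp: inner_commute right_diff_distrib mult.commute diff_divide_distrib)
    also have "\<dots> = ennreal (1 / ?k z) * ennreal (c - c * exp (- (norm z)\<^sup>2 / (4 * 2)))"
      using d by (subst nn_integral_cmult, measurable, subst nn_integral_eq_integral) (auto simp: has_bochner_integral_iff)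
    also have "\<dots> = ennreal (c * (1 - exp (- ((norm z)\<^sup>2 / 8))) / ?k z)"
      by (subst ennreal_mult'[symmetric]) (auto simp: right_diff_distrib diff_divide_distrib)
    finally show "ennreal (c * (1 - exp (- ((norm z)\<^sup>2 / 8))) / ?k z) = (\<integral>\<^sup>+\<xi>. ?h z \<xi> \<partial>lborel)" by simp
  qed
  also have "\<dots> = (\<integral>\<^sup>+\<xi>. \<integral>\<^sup>+z. ?h z \<xi> \<partial>lborel \<partial>lborel)"
    by (rule lborel_pair.Fubini') measurable
  also have "\<dots> = (\<integral>\<^sup>+\<xi>. ennreal (exp (- 2 * (norm (\<xi>::'a))\<^sup>2)) * ennreal (?M * norm \<xi> powr (2 * s)) \<partial>lborel)"
    by (intro nn_integral_cong, subst nn_integral_cmult, measurable, subst nn_integral_cos_kernel[OF s]) (rule refl)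
  also have "\<dots> \<le> (\<integral>\<^sup>+\<xi>. ennreal (?M * exp (- 1 * (norm (\<xi>::'a))\<^sup>2)) \<partial>lborel)"
  proof (rule nn_integral_mono)
    fix \<xi> :: 'a
    have "norm \<xi> powr (2 * s) \<le> 1 + (norm \<xi>)\<^sup>2"
    proof (cases "norm \<xi> \<le> 1")
      case True
      then have "norm \<xi> powr (2 * s) \<le> 1" using s by (intro powr_le1) auto
      then show ?thesis by (simp add: add_increasing2)
    next
      case False
      then have "norm \<xi> powr (2 * s) \<le> norm \<xi> powr 2" using s by (intro powr_mono) auto
      then show ?thesis using False by simp
    qed
    also have "\<dots> \<le> exp ((norm \<xi>)\<^sup>2)" by (rule exp_ge_add_one_self)
    finally have "exp (- 2 * (norm \<xi>)\<^sup>2) * norm \<xi> powr (2 * s) \<le> exp (- 2 * (norm \<xi>)\<^sup>2) * exp ((norm \<xi>)\<^sup>2)"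
      by (intro mult_left_mono) auto
    also have "\<dots> = exp (- 1 * (norm \<xi>)\<^sup>2)" by (simp add: exp_add[symmetric])
    finally have "?M * (exp (- 2 * (norm \<xi>)\<^sup>2) * norm \<xi> powr (2 * s)) \<le> ?M * exp (- 1 * (norm \<xi>)\<^sup>2)"
      using multiplier_integral_pos[OF s, where 'a='a] by (intro mult_left_mono) auto
    then show "ennreal (exp (- 2 * (norm \<xi>)\<^sup>2)) * ennreal (?M * norm \<xi> powr (2 * s)) \<le> ennreal (?M * exp (- 1 * (norm \<xi>)\<^sup>2))"
      by (subst ennreal_mult'[symmetric]) (auto intro!: ennreal_leI simp: mult_ac)
  qed
  also have "\<dots> < \<infinity>"
    using gaussian_integral[of 1, where 'a='a] multiplier_integral_pos[OF s, where 'a='a]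
    by (subst nn_integral_eq_integral) (auto simp: has_bochner_integral_iff)
  finally have "integrable lborel (\<lambda>z::'a. c * (1 - exp (- ((norm z)\<^sup>2 / 8))) / ?k z)"
    using c by (intro integrableI_nonneg AE_I2) auto
  then have "integrable lborel (\<lambda>z::'a. (16 / c) * (c * (1 - exp (- ((norm z)\<^sup>2 / 8))) / ?k z))"
    by (rule integrable_mult_right)
  then show ?thesis
  proof (rule Bochner_Integration.integrable_bound)
    show "AE z in lborel. norm (min 1 ((norm z)\<^sup>2) / ?k z) \<le> norm ((16 / c) * (c * (1 - exp (- ((norm z)\<^sup>2 / 8))) / ?k z))"
    proof (rule AE_I2)
      fix z :: 'a
      have "min 1 ((norm z)\<^sup>2) / ?k z \<le> 16 * (1 - exp (- ((norm z)\<^sup>2 / 8))) / ?k z"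
        by (intro divide_right_mono min_le_one_minus_exp) auto
      then show "norm (min 1 ((norm z)\<^sup>2) / ?k z) \<le> norm ((16 / c) * (c * (1 - exp (- ((norm z)\<^sup>2 / 8))) / ?k z))"
        using c by simp
    qed
  qed measurable
qed

lemma integrable_kernel_tail:
  assumes s: "0 < s" "s < 1" and \<epsilon>: "\<epsilon> > 0"
  shows "integrable lborel (\<lambda>z::'a::euclidean_space. indicator {z. \<epsilon> < norm z} z / norm z powr (real DIM('a) + 2 * s))"
proof -
  define m where "m = min 1 (\<epsilon>\<^sup>2)"
  have m: "m > 0" using \<epsilon> by (simp add: m_def)
  have "integrable lborel (\<lambda>z::'a. (1 / m) * (min 1 ((norm z)\<^sup>2) / norm z powr (real DIM('a) + 2 * s)))"
    by (intro integrable_mult_right integrable_levy_kernel s)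
  then show ?thesis
  proof (rule Bochner_Integration.integrable_bound)
    show "AE z in lborel. norm (indicator {z. \<epsilon> < norm z} z / norm (z::'a) powr (real DIM('a) + 2 * s)) \<le> norm ((1 / m) * (min 1 ((norm z)\<^sup>2) / norm z powr (real DIM('a) + 2 * s)))"
    proof (rule AE_I2)
      fix z :: 'a
      show "norm (indicator {z. \<epsilon> < norm z} z / norm z powr (real DIM('a) + 2 * s)) \<le> norm ((1 / m) * (min 1 ((norm z)\<^sup>2) / norm z powr (real DIM('a) + 2 * s)))"
      proof (cases "\<epsilon> < norm z")
        case True
        have "m \<le> min 1 ((norm z)\<^sup>2)" unfolding m_def using True \<epsilon> by (intro min.mono power_mono) auto
        then have "1 \<le> 1 / m * min 1 ((norm z)\<^sup>2)" using m by (simp add: field_simps)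
        then have "1 / norm z powr (real DIM('a) + 2 * s) \<le> (1 / m * min 1 ((norm z)\<^sup>2)) / norm z powr (real DIM('a) + 2 * s)"
          by (intro divide_right_mono) auto
        then show ?thesis using True m by simp
      qed auto
    qed
  qed measurable
qed

text \<open>
  Away from the unit ball the function is below the Levy kernel for \<open>s = 1/2\<close>.
\<close>

lemma integrable_polynomial_decay:
  "integrable lborel (\<lambda>x::'a::euclidean_space. 1 / (1 + norm x) ^ (DIM('a) + 1))"
proof -
  have "integrable lborel (\<lambda>z::'a. indicator (cball 0 1) z + indicator {z. 1 < norm z} z / norm z powr (real DIM('a) + 2 * (1/2)))"
    by (intro Bochner_Integration.integrable_add integrable_kernel_tail integrable_real_indicator) (auto simp: emeasure_bounded_finite[unfolded infinity_ennreal_def])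
  then show ?thesis
  proof (rule Bochner_Integration.integrable_bound)
    show "AE x in lborel. norm (1 / (1 + norm (x::'a)) ^ (DIM('a) + 1)) \<le> norm (indicator (cball 0 1) x + indicator {z. 1 < norm z} x / norm x powr (real DIM('a) + 2 * (1/2)))"
    proof (rule AE_I2)
      fix x :: 'a
      show "norm (1 / (1 + norm (x::'a)) ^ (DIM('a) + 1)) \<le> norm (indicator (cball 0 1) x + indicator {z. 1 < norm z} x / norm x powr (real DIM('a) + 2 * (1/2)))"
      proof (cases "norm x \<le> 1")
        case True
        then show ?thesis using one_le_power[of "1 + norm x" "DIM('a) + 1"] by (simp add: divide_le_eq)
      next
        case False
        then have pos: "norm x > 0" by linarith
        have "real DIM('a) + 2 * (1/2) = real (DIM('a) + 1)" by simp
        then have e: "norm x powr (real DIM('a) + 2 * (1/2)) = norm x ^ (DIM('a) + 1)"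
          using powr_realpow[OF pos] by (simp only:)
        show ?thesis unfolding e using False
          by (auto intro!: divide_left_mono power_mono mult_pos_pos zero_less_power simp del: power_Suc)
      qed
    qed
  qed measurable
qed

text \<open>
  The integrand of the absolutely convergent form of the principal value.
\<close>

definition symmetric_kernel :: "real \<Rightarrow> ('a::euclidean_space \<Rightarrow> real) \<Rightarrow> 'a \<Rightarrow> 'a \<Rightarrow> real" where
  "symmetric_kernel s u x z = (2 * u x - u (x + z) - u (x - z)) / (2 * norm z powr (real DIM('a) + 2 * s))"

text \<open>
  The truncated region is symmetric about \<open>x\<close>, so the substitutions \<open>y = x + z\<close> and \<open>y = x - z\<close> give the
  same value and may be averaged.
\<close>

lemma has_bochner_integral_symmetric_kernel_truncated:
  fixes u :: "'a::euclidean_space \<Rightarrow> real"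
  assumes "set_integrable lborel {y. \<epsilon> < norm (x - y)} (\<lambda>y. (u x - u y) / norm (x - y) powr (real DIM('a) + 2 * s))"
  shows "has_bochner_integral lborel (\<lambda>z. indicator {z. \<epsilon> < norm z} z * symmetric_kernel s u x z)
           (LINT y:{y. \<epsilon> < norm (x - y)}|lborel. (u x - u y) / norm (x - y) powr (real DIM('a) + 2 * s))"
proof -
  let ?I = "LINT y:{y. \<epsilon> < norm (x - y)}|lborel. (u x - u y) / norm (x - y) powr (real DIM('a) + 2 * s)"
  have "has_bochner_integral lborel (\<lambda>y. indicator {y. \<epsilon> < norm (x - y)} y *\<^sub>R ((u x - u y) / norm (x - y) powr (real DIM('a) + 2 * s))) ?I"
    using assms by (auto simp: has_bochner_integral_iff set_integrable_def set_lebesgue_integral_def)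
  from has_bochner_integral_mult_right[OF has_bochner_integral_add[OF has_bochner_integral_shift[OF this, of x] has_bochner_integral_reflect[OF this, of x]], of "1/2"]
  have "has_bochner_integral lborel (\<lambda>z. indicator {z. \<epsilon> < norm z} z * symmetric_kernel s u x z) (1/2 * (?I + ?I))"
    by (rule has_bochner_integral_cong[THEN iffD1, rotated 3]) (auto simp: symmetric_kernel_def indicator_def divide_simps)
  then show ?thesis by simp
qed

text \<open>
  After symmetrisation the truncations are restrictions of one integrable function, and dominated
  convergence gives the limit.
\<close>

lemma has_pv_integral_symmetrize:
  fixes u :: "'a::euclidean_space \<Rightarrow> real"
  assumes off: "\<And>\<epsilon>. \<epsilon> > 0 \<Longrightarrow> set_integrable lborel {y. \<epsilon> < norm (x - y)}
              (\<lambda>y. (u x - u y) / norm (x - y) powr (real DIM('a) + 2 * s))"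
    and D: "integrable lborel (symmetric_kernel s u x)"
  shows "has_pv_integral s u x (LINT z|lborel. symmetric_kernel s u x z)"
proof -
  let ?D = "symmetric_kernel s u x"
  define I where "I \<epsilon> = (LINT y:{y. \<epsilon> < norm (x - y)}|lborel. (u x - u y) / norm (x - y) powr (real DIM('a) + 2 * s))" for \<epsilon>
  have I: "I \<epsilon> = (LINT z|lborel. indicator {z. \<epsilon> < norm z} z * ?D z)" if "\<epsilon> > 0" for \<epsilon>
    using has_bochner_integral_symmetric_kernel_truncated[OF off[OF that]] by (auto simp: has_bochner_integral_iff I_def)
  have "(I \<longlongrightarrow> (LINT z|lborel. ?D z)) (at_right 0)"
    unfolding tendsto_at_iff_sequentially comp_def
  proof (intro allI impI)
    fix X :: "nat \<Rightarrow> real" assume X: "\<forall>i. X i \<in> {0<..} - {0}" and lim: "X \<longlonglongrightarrow> 0"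
    have "(\<lambda>i. LINT z|lborel. indicator {z. X i < norm z} z * ?D z) \<longlonglongrightarrow> (LINT z|lborel. ?D z)"
    proof (rule integral_dominated_convergence[where w="\<lambda>z. norm (?D z)"])
      show "AE z in lborel. (\<lambda>i. indicator {z. X i < norm z} z * ?D z) \<longlonglongrightarrow> ?D z"
        using AE_lborel_singleton[of 0]
      proof eventually_elim
        case (elim z)
        then have "eventually (\<lambda>i. X i < norm z) sequentially" using lim by (intro order_tendstoD) auto
        then have "eventually (\<lambda>i. indicator {z. X i < norm z} z * ?D z = ?D z) sequentially"
          by eventually_elim auto
        then show ?case by (rule tendsto_eventually)
      qed
    qed (use D in \<open>auto simp: indicator_def\<close>)
    then show "(\<lambda>i. I (X i)) \<longlonglongrightarrow> (LINT z|lborel. ?D z)"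
      using X by (simp add: I)
  qed
  then show ?thesis using off unfolding has_pv_integral_def I_def by blast
qed

section \<open>Schwartz functions\<close>

text \<open>
  Two applications of the mean value theorem, first to \<open>g t + g (- t)\<close>.
\<close>

lemma second_difference_bound:
  fixes g g' g'' :: "real \<Rightarrow> real"
  assumes 1: "\<And>t. \<bar>t\<bar> \<le> 1 \<Longrightarrow> (g has_real_derivative g' t) (at t)"
    and 2: "\<And>t. \<bar>t\<bar> \<le> 1 \<Longrightarrow> (g' has_real_derivative g'' t) (at t)"
    and M: "\<And>t. \<bar>t\<bar> \<le> 1 \<Longrightarrow> \<bar>g'' t\<bar> \<le> M"
  shows "\<bar>2 * g 0 - g 1 - g (- 1)\<bar> \<le> 2 * M"
proof -
  have "\<exists>t>0. t < 1 \<and> (g 1 + g (- 1)) - (g 0 + g (- 0)) = (1 - 0) * (g' t - g' (- t))"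
  proof (rule MVT2)
    fix t :: real assume t: "0 \<le> t" "t \<le> 1"
    have "((\<lambda>t. g (- t)) has_real_derivative g' (- t) * (- 1)) (at t)"
    proof (rule DERIV_chain2[where f=g and g=uminus])
      show "(g has_real_derivative g' (- t)) (at (- t))" using t by (intro 1) auto
      show "(uminus has_real_derivative - 1) (at t)" by (auto intro!: derivative_eq_intros)
    qed
    then show "((\<lambda>t. g t + g (- t)) has_real_derivative g' t - g' (- t)) (at t)"
      using DERIV_add[OF 1[of t]] t by fastforce
  qed simp
  then obtain t where t: "0 < t" "t < 1" and a: "g 1 + g (- 1) - 2 * g 0 = g' t - g' (- t)" by auto
  have "\<exists>x>- t. x < t \<and> g' t - g' (- t) = (t - - t) * g'' x"
    using t by (intro MVT2[of "- t" t g' g'']) (auto intro: 2)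
  then obtain x where x: "- t < x" "x < t" and b: "g' t - g' (- t) = 2 * t * g'' x" by auto
  have "2 * g 0 - g 1 - g (- 1) = - (2 * t * g'' x)" using a b by simp
  then have "\<bar>2 * g 0 - g 1 - g (- 1)\<bar> = 2 * t * \<bar>g'' x\<bar>" using t by (simp add: abs_mult)
  also have "\<dots> \<le> 2 * 1 * M"
    using t x M[of x] by (intro mult_mono) auto
  finally show ?thesis by simp
qed

lemma has_real_derivative_along_line:
  fixes f :: "'a::euclidean_space \<Rightarrow> real"
  assumes "f differentiable (at (x + t *\<^sub>R z))"
  shows "((\<lambda>t. f (x + t *\<^sub>R z)) has_real_derivative
           (\<Sum>b\<in>Basis. (z \<bullet> b) * frechet_derivative f (at (x + t *\<^sub>R z)) b)) (at t)"
proof -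
  let ?F = "frechet_derivative f (at (x + t *\<^sub>R z))"
  have F: "(f has_derivative ?F) (at (x + t *\<^sub>R z))" using assms by (simp add: frechet_derivative_works)
  then have lin: "linear ?F" by (rule has_derivative_linear)
  have "((\<lambda>t. f (x + t *\<^sub>R z)) has_derivative (\<lambda>h. ?F (h *\<^sub>R z))) (at t)"
  proof (rule has_derivative_compose[where f="\<lambda>t. x + t *\<^sub>R z" and g=f])
    show "((\<lambda>t. x + t *\<^sub>R z) has_derivative (\<lambda>h. h *\<^sub>R z)) (at t)"
      by (auto intro!: derivative_eq_intros)
  qed (rule F)
  moreover have "?F (h *\<^sub>R z) = (\<Sum>b\<in>Basis. (z \<bullet> b) * ?F b) * h" for h
  proof -
    have "?F z = ?F (\<Sum>b\<in>Basis. (z \<bullet> b) *\<^sub>R b)" by (simp add: euclidean_representation)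
    also have "\<dots> = (\<Sum>b\<in>Basis. (z \<bullet> b) * ?F b)" using lin by (simp add: linear_sum linear_scale)
    finally show ?thesis using lin by (simp add: linear_scale mult.commute)
  qed
  ultimately show ?thesis unfolding has_field_derivative_def by (simp only:)
qed

lemma schwartz_differentiable:
  "schwartz f \<Longrightarrow> set bs \<subseteq> Basis \<Longrightarrow> iter_partial bs f differentiable (at x)"
  unfolding schwartz_def by blast

lemma schwartz_continuous: "schwartz f \<Longrightarrow> continuous_on UNIV f"
  using schwartz_differentiable[of f "[]"]
  by (intro differentiable_imp_continuous_on) (simp add: differentiable_on_def)

lemma schwartz_decay:
  assumes "schwartz f" "set bs \<subseteq> Basis"
  obtains B where "B \<ge> 0" "\<And>x. \<bar>iter_partial bs f x\<bar> \<le> B / (1 + norm x) ^ m"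
proof -
  obtain B where B: "\<And>x. (1 + norm x) ^ m * \<bar>iter_partial bs f x\<bar> \<le> B"
    using assms unfolding schwartz_def by blast
  have p: "(1 + norm x) ^ m > 0" for x :: 'a by (simp add: add_pos_nonneg)
  have "0 \<le> (1 + norm (0::'a)) ^ m * \<bar>iter_partial bs f 0\<bar>" by simp
  with B[of 0] have "B \<ge> 0" by linarith
  moreover have "\<bar>iter_partial bs f x\<bar> \<le> B / (1 + norm x) ^ m" for x
    using B[of x] p[of x] by (simp add: pos_le_divide_eq mult.commute)
  ultimately show thesis using that by blast
qed

text \<open>
  A step of length at most \<open>1\<close> changes \<open>1 + |x|\<close> by at most the factor \<open>2\<close>, so the decay of the second
  partial derivatives passes to second differences.
\<close>

lemma schwartz_second_difference:
  fixes f :: "'a::euclidean_space \<Rightarrow> real"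
  assumes f: "schwartz f"
  obtains B where "B \<ge> 0"
    "\<And>x z. norm z \<le> 1 \<Longrightarrow> \<bar>2 * f x - f (x + z) - f (x - z)\<bar> \<le> B * (norm z)\<^sup>2 / (1 + norm x) ^ m"
proof -
  have "\<forall>b\<in>Basis. \<forall>c\<in>Basis. \<exists>B\<ge>0. \<forall>x. \<bar>iter_partial [c, b] f x\<bar> \<le> B / (1 + norm x) ^ m"
  proof (intro ballI)
    fix b c :: 'a assume "b \<in> Basis" "c \<in> Basis"
    then show "\<exists>B\<ge>0. \<forall>x. \<bar>iter_partial [c, b] f x\<bar> \<le> B / (1 + norm x) ^ m"
      using schwartz_decay[OF f, of "[c, b]" m] by (metis empty_subsetI insert_subset list.set)
  qed
  then obtain Bf where Bf: "\<And>b c. b \<in> Basis \<Longrightarrow> c \<in> Basis \<Longrightarrow> Bf b c \<ge> 0"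
    "\<And>b c x. b \<in> Basis \<Longrightarrow> c \<in> Basis \<Longrightarrow> \<bar>iter_partial [c, b] f x\<bar> \<le> Bf b c / (1 + norm x) ^ m"
    by metis
  define S where "S = (\<Sum>b\<in>Basis. \<Sum>c\<in>Basis. Bf b c)"
  have S: "S \<ge> 0" unfolding S_def using Bf(1) by (intro sum_nonneg) auto
  have "\<bar>2 * f x - f (x + z) - f (x - z)\<bar> \<le> (2 * 2 ^ m * S) * (norm z)\<^sup>2 / (1 + norm x) ^ m"
    if z: "norm z \<le> 1" for x z
  proof -
    let ?g = "\<lambda>t. f (x + t *\<^sub>R z)"
    let ?g' = "\<lambda>t. \<Sum>b\<in>Basis. (z \<bullet> b) * iter_partial [b] f (x + t *\<^sub>R z)"
    let ?g'' = "\<lambda>t. \<Sum>b\<in>Basis. (z \<bullet> b) * (\<Sum>c\<in>Basis. (z \<bullet> c) * iter_partial [c, b] f (x + t *\<^sub>R z))"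
    have "\<bar>2 * ?g 0 - ?g 1 - ?g (- 1)\<bar> \<le> 2 * (2 ^ m * S * (norm z)\<^sup>2 / (1 + norm x) ^ m)"
    proof (rule second_difference_bound)
      fix t :: real assume t: "\<bar>t\<bar> \<le> 1"
      show "(?g has_real_derivative ?g' t) (at t)"
        using has_real_derivative_along_line[of f x t z] schwartz_differentiable[OF f, of "[]"] by simp
      show "(?g' has_real_derivative ?g'' t) (at t)"
      proof (intro DERIV_sum DERIV_cmult)
        fix b :: 'a assume "b \<in> Basis"
        then show "((\<lambda>t. iter_partial [b] f (x + t *\<^sub>R z)) has_real_derivative
           (\<Sum>c\<in>Basis. (z \<bullet> c) * iter_partial [c, b] f (x + t *\<^sub>R z))) (at t)"
          using has_real_derivative_along_line[of "iter_partial [b] f" x t z] schwartz_differentiable[OF f, of "[b]"] by simp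
      qed
      have w: "1 / (1 + norm (x + t *\<^sub>R z)) ^ m \<le> 2 ^ m / (1 + norm x) ^ m"
      proof -
        have "norm (t *\<^sub>R z) \<le> 1" using t z by (simp add: mult_le_one)
        moreover have "norm x \<le> norm (x + t *\<^sub>R z) + norm (t *\<^sub>R z)"
          using norm_triangle_ineq4[of "x + t *\<^sub>R z" "t *\<^sub>R z"] by simp
        moreover have "1 + c \<le> 2 * (1 + a)" if "b \<le> 1" "c \<le> a + b" "0 \<le> a" for a b c :: real
          using that by argo
        ultimately have "1 + norm x \<le> 2 * (1 + norm (x + t *\<^sub>R z))"
          using norm_ge_zero by blast
        then have "(1 + norm x) ^ m \<le> (2 * (1 + norm (x + t *\<^sub>R z))) ^ m" by (intro power_mono) auto
        then have "2 ^ m / (2 * (1 + norm (x + t *\<^sub>R z))) ^ m \<le> 2 ^ m / (1 + norm x) ^ m"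
          by (intro divide_left_mono mult_pos_pos zero_less_power) (auto simp: add_pos_nonneg)
        then show ?thesis by (simp only: power_mult_distrib) simp
      qed
      have "\<bar>?g'' t\<bar> \<le> (\<Sum>b\<in>Basis. \<Sum>c\<in>Basis. (norm z)\<^sup>2 * (Bf b c * (2 ^ m / (1 + norm x) ^ m)))"
      proof (rule order_trans[OF sum_abs], rule sum_mono)
        fix b :: 'a assume b: "b \<in> Basis"
        have "\<bar>(z \<bullet> b) * (\<Sum>c\<in>Basis. (z \<bullet> c) * iter_partial [c, b] f (x + t *\<^sub>R z))\<bar>
           \<le> norm z * (\<Sum>c\<in>Basis. norm z * (Bf b c * (2 ^ m / (1 + norm x) ^ m)))"
          unfolding abs_mult
        proof (intro mult_mono order_trans[OF sum_abs] sum_mono)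
          show "\<bar>z \<bullet> b\<bar> \<le> norm z" using b by (rule Basis_le_norm)
          fix c :: 'a assume c: "c \<in> Basis"
          have "\<bar>iter_partial [c, b] f (x + t *\<^sub>R z)\<bar> \<le> Bf b c * (1 / (1 + norm (x + t *\<^sub>R z)) ^ m)"
            using Bf(2)[OF b c] by simp
          also have "\<dots> \<le> Bf b c * (2 ^ m / (1 + norm x) ^ m)"
            using Bf(1)[OF b c] w by (intro mult_left_mono) auto
          finally show "\<bar>(z \<bullet> c) * iter_partial [c, b] f (x + t *\<^sub>R z)\<bar> \<le> norm z * (Bf b c * (2 ^ m / (1 + norm x) ^ m))"
            unfolding abs_mult using Basis_le_norm[OF c, of z] by (intro mult_mono) auto
        qed auto
        then show "\<bar>(z \<bullet> b) * (\<Sum>c\<in>Basis. (z \<bullet> c) * iter_partial [c, b] f (x + t *\<^sub>R z))\<bar>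
           \<le> (\<Sum>c\<in>Basis. (norm z)\<^sup>2 * (Bf b c * (2 ^ m / (1 + norm x) ^ m)))"
          by (simp only: sum_distrib_left power2_eq_square mult.assoc)
      qed
      also have "\<dots> = 2 ^ m * S * (norm z)\<^sup>2 / (1 + norm x) ^ m"
        unfolding S_def by (simp add: sum_distrib_left sum_distrib_right sum_divide_distrib mult_ac)
      finally show "\<bar>?g'' t\<bar> \<le> 2 ^ m * S * (norm z)\<^sup>2 / (1 + norm x) ^ m" .
    qed
    then show ?thesis by (simp add: mult.assoc)
  qed
  then show thesis using that[of "2 * 2 ^ m * S"] S by auto
qed

lemma real_polynomial_function_directional_derivative:
  assumes "real_polynomial_function p"
  shows "\<exists>q. real_polynomial_function q \<and> (\<forall>x. \<exists>F. (p has_derivative F) (at x) \<and> F b = q x)"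
  using assms
proof induction
  case (linear f)
  then show ?case
    by (intro exI[of _ "\<lambda>x. f b"]) (auto intro: bounded_linear_imp_has_derivative)
next
  case (const c)
  then show ?case by (intro exI[of _ "\<lambda>x. 0"]) (auto intro!: exI[of _ "\<lambda>x. 0"])
next
  case (add f g)
  then obtain f' g' where p: "real_polynomial_function f'" "real_polynomial_function g'" and
    d: "\<forall>x. \<exists>F. (f has_derivative F) (at x) \<and> F b = f' x" "\<forall>x. \<exists>F. (g has_derivative F) (at x) \<and> F b = g' x" by blast
  show ?case
  proof (rule exI[of _ "\<lambda>x. f' x + g' x"], intro conjI allI)
    show "real_polynomial_function (\<lambda>x. f' x + g' x)" using p by (rule real_polynomial_function.intros(3))
    fix x
    obtain F G where "(f has_derivative F) (at x)" "F b = f' x" "(g has_derivative G) (at x)" "G b = g' x"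
      using d by metis
    then show "\<exists>H. ((\<lambda>x. f x + g x) has_derivative H) (at x) \<and> H b = f' x + g' x"
      by (intro exI[of _ "\<lambda>h. F h + G h"]) (auto intro: has_derivative_add)
  qed
next
  case (mult f g)
  then obtain f' g' where p: "real_polynomial_function f'" "real_polynomial_function g'" and
    d: "\<forall>x. \<exists>F. (f has_derivative F) (at x) \<and> F b = f' x" "\<forall>x. \<exists>F. (g has_derivative F) (at x) \<and> F b = g' x" by blast
  show ?case
  proof (rule exI[of _ "\<lambda>x. f x * g' x + f' x * g x"], intro conjI allI)
    show "real_polynomial_function (\<lambda>x. f x * g' x + f' x * g x)" 
      using p mult.hyps by (intro real_polynomial_function.intros(3,4))
    fix x
    obtain F G where "(f has_derivative F) (at x)" "F b = f' x" "(g has_derivative G) (at x)" "G b = g' x"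
      using d by metis
    then show "\<exists>H. ((\<lambda>x. f x * g x) has_derivative H) (at x) \<and> H b = f x * g' x + f' x * g x"
      by (intro exI[of _ "\<lambda>h. f x * G h + F h * g x"]) (auto intro: has_derivative_mult)
  qed
qed

lemma real_polynomial_function_growth:
  assumes "real_polynomial_function p"
  shows "\<exists>B m. B \<ge> 0 \<and> (\<forall>x. \<bar>p x\<bar> \<le> B * (1 + norm x) ^ m)"
  using assms
proof induction
  case (linear f)
  then obtain K where K: "K > 0" "\<And>x. norm (f x) \<le> norm x * K" using bounded_linear.pos_bounded by blast
  have "\<bar>f x\<bar> \<le> K * (1 + norm x) ^ 1" for x
    using K(1) K(2)[of x] by (simp add: algebra_simps)
  then show ?case using K(1) by (intro exI[of _ K] exI[of _ 1]) auto
next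
  case (const c)
  then show ?case by (intro exI[of _ "\<bar>c\<bar>"] exI[of _ 0]) auto
next
  case (add f g)
  then obtain B C m n where B: "B \<ge> 0" "\<And>x. \<bar>f x\<bar> \<le> B * (1 + norm x) ^ m"
    and C: "C \<ge> 0" "\<And>x. \<bar>g x\<bar> \<le> C * (1 + norm x) ^ n" by blast
  have "\<bar>f x + g x\<bar> \<le> (B + C) * (1 + norm x) ^ (m + n)" for x
  proof -
    have "B * (1 + norm x) ^ m \<le> B * (1 + norm x) ^ (m + n)" "C * (1 + norm x) ^ n \<le> C * (1 + norm x) ^ (m + n)"
      using B C by (auto intro!: mult_left_mono power_increasing)
    then show ?thesis using B(2)[of x] C(2)[of x] by (simp add: distrib_right)
  qed
  then show ?case using B C by (intro exI[of _ "B + C"] exI[of _ "m + n"]) auto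
next
  case (mult f g)
  then obtain B C m n where B: "B \<ge> 0" "\<And>x. \<bar>f x\<bar> \<le> B * (1 + norm x) ^ m"
    and C: "C \<ge> 0" "\<And>x. \<bar>g x\<bar> \<le> C * (1 + norm x) ^ n" by blast
  have "\<bar>f x * g x\<bar> \<le> (B * C) * (1 + norm x) ^ (m + n)" for x
  proof -
    have "\<bar>f x\<bar> * \<bar>g x\<bar> \<le> (B * (1 + norm x) ^ m) * (C * (1 + norm x) ^ n)"
      using B C by (intro mult_mono) auto
    then show ?thesis by (simp add: abs_mult power_add mult_ac)
  qed
  then show ?case using B C by (intro exI[of _ "B * C"] exI[of _ "m + n"]) auto
qed

lemma polynomial_gaussian_derivative:
  fixes p :: "'a::euclidean_space \<Rightarrow> real"
  assumes "real_polynomial_function p"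
  obtains q where "real_polynomial_function q"
    "\<And>x. \<exists>F. ((\<lambda>x. p x * exp (- (x \<bullet> x))) has_derivative F) (at x) \<and> F b = q x * exp (- (x \<bullet> x))"
proof -
  obtain p' where p': "real_polynomial_function p'" "\<And>x. \<exists>F. (p has_derivative F) (at x) \<and> F b = p' x"
    using real_polynomial_function_directional_derivative[OF assms] by blast
  let ?q = "\<lambda>x. p' x + p x * (- 2 * (x \<bullet> b))"
  have "real_polynomial_function (\<lambda>x::'a. x \<bullet> b)"
    by (rule real_polynomial_function.intros(1)) (rule bounded_linear_inner_left)
  then have "real_polynomial_function ?q"
    using p'(1) assms by (intro real_polynomial_function.intros(3,4) real_polynomial_function.intros(2))
  moreover have "\<exists>F. ((\<lambda>x. p x * exp (- (x \<bullet> x))) has_derivative F) (at x) \<and> F b = ?q x * exp (- (x \<bullet> x))" for x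
  proof -
    obtain F where F: "(p has_derivative F) (at x)" "F b = p' x" using p'(2) by blast
    have "((\<lambda>x. p x * exp (- (x \<bullet> x))) has_derivative
        (\<lambda>h. p x * (exp (- (x \<bullet> x)) * (- (x \<bullet> h + h \<bullet> x))) + F h * exp (- (x \<bullet> x)))) (at x)"
      using F(1) by (auto intro!: derivative_eq_intros)
    then show ?thesis using F(2) by (intro exI conjI) (auto simp: inner_commute algebra_simps)
  qed
  ultimately show thesis using that by blast
qed

text \<open>
  Each partial derivative of the Gaussian is a polynomial times the Gaussian.
\<close>

lemma schwartz_gaussian: "schwartz (\<lambda>x::'a::euclidean_space. exp (- (x \<bullet> x)))"
proof -
  have P: "\<exists>p. real_polynomial_function p \<and> iter_partial bs (\<lambda>x::'a. exp (- (x \<bullet> x))) = (\<lambda>x. p x * exp (- (x \<bullet> x)))" for bs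
  proof (induction bs)
    case Nil
    show ?case by (intro exI[of _ "\<lambda>x. 1"]) auto
  next
    case (Cons b bs)
    then obtain p where p: "real_polynomial_function p" "iter_partial bs (\<lambda>x::'a. exp (- (x \<bullet> x))) = (\<lambda>x. p x * exp (- (x \<bullet> x)))" by blast
    obtain q where q: "real_polynomial_function q"
      "\<And>x. \<exists>F. ((\<lambda>x. p x * exp (- (x \<bullet> x))) has_derivative F) (at x) \<and> F b = q x * exp (- (x \<bullet> x))"
      using polynomial_gaussian_derivative[OF p(1)] by blast
    have "frechet_derivative (\<lambda>x. p x * exp (- (x \<bullet> x))) (at x) b = q x * exp (- (x \<bullet> x))" for x
      using q(2)[of x] by (auto dest: frechet_derivative_at)
    then show ?case using q(1) p(2) by auto
  qed
  show ?thesis unfolding schwartz_def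
  proof (intro allI impI conjI)
    fix bs :: "'a list"
    obtain p where p: "real_polynomial_function p" and eq: "iter_partial bs (\<lambda>x::'a. exp (- (x \<bullet> x))) = (\<lambda>x. p x * exp (- (x \<bullet> x)))"
      using P by blast
    show "iter_partial bs (\<lambda>x::'a. exp (- (x \<bullet> x))) differentiable at x" for x
    proof -
      obtain q where "\<And>x. \<exists>F. ((\<lambda>x. p x * exp (- (x \<bullet> x))) has_derivative F) (at x) \<and> F 0 = q x * exp (- (x \<bullet> x))"
        using polynomial_gaussian_derivative[OF p, of 0] by blast
      then show ?thesis unfolding eq differentiable_def by blast
    qed
    fix m
    obtain B n where B: "B \<ge> 0" "\<And>x. \<bar>p x\<bar> \<le> B * (1 + norm x) ^ n" using real_polynomial_function_growth[OF p] by blast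
    define k where "k = real (m + n)"
    have "(1 + norm x) ^ m * \<bar>p x * exp (- (x \<bullet> x))\<bar> \<le> B * exp (k\<^sup>2)" for x
    proof -
      have "(1 + norm x) ^ m * \<bar>p x * exp (- (x \<bullet> x))\<bar> \<le> (1 + norm x) ^ m * (B * (1 + norm x) ^ n * exp (- (x \<bullet> x)))"
        unfolding abs_mult using B(2)[of x] by (intro mult_left_mono mult_mono) auto
      also have "\<dots> = B * ((1 + norm x) ^ (m + n) * exp (- (x \<bullet> x)))" by (simp add: power_add mult_ac)
      also have "\<dots> \<le> B * (exp (norm x) ^ (m + n) * exp (- (x \<bullet> x)))"
        using B(1) exp_ge_add_one_self[of "norm x"] by (intro mult_left_mono mult_right_mono power_mono) auto
      also have "exp (norm x) ^ (m + n) * exp (- (x \<bullet> x)) = exp (k * norm x - (norm x)\<^sup>2)"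
        by (simp add: k_def power2_norm_eq_inner exp_diff exp_minus divide_inverse flip: exp_of_nat_mult)
      also have "k * norm x - (norm x)\<^sup>2 \<le> k\<^sup>2"
      proof -
        have "0 \<le> (norm x - k / 2)\<^sup>2" by simp
        also have "\<dots> = (norm x)\<^sup>2 - k * norm x + k\<^sup>2 / 4" by (simp add: power2_eq_square algebra_simps)
        finally show ?thesis using zero_le_power2[of k] by linarith
      qed
      finally show ?thesis using B(1) by (simp add: mult_left_mono)
    qed
    then show "\<exists>B. \<forall>x. (1 + norm x) ^ m * \<bar>iter_partial bs (\<lambda>x::'a. exp (- (x \<bullet> x))) x\<bar> \<le> B"
      unfolding eq by blast
  qed
qed

section \<open>The normalising constant of the fractional Laplacian\<close>

text \<open>
  Taylor expansion for \<open>|z| \<le> 1\<close> and decay for \<open>|z| > 1\<close>.  The bound is the Levy kernel in \<open>z\<close> times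
  translates of an integrable function of \<open>x\<close>, hence integrable in the pair \<open>(x, z)\<close>.
\<close>

lemma symmetric_kernel_schwartz_bound:
  fixes \<phi> :: "'a::euclidean_space \<Rightarrow> real"
  assumes \<phi>: "schwartz \<phi>"
  obtains C where "C \<ge> 0" "\<And>x z. \<bar>symmetric_kernel s \<phi> x z\<bar> \<le>
     C * (min 1 ((norm z)\<^sup>2) / norm z powr (real DIM('a) + 2 * s)) *
     (1 / (1 + norm x) ^ (DIM('a) + 1) + 1 / (1 + norm (z + x)) ^ (DIM('a) + 1) + 1 / (1 + norm (- z + x)) ^ (DIM('a) + 1))"
proof -
  define w where "w x = 1 / (1 + norm (x::'a)) ^ (DIM('a) + 1)" for x
  have w: "w x \<ge> 0" for x by (simp add: w_def)
  obtain A where A: "A \<ge> 0" "\<And>x. \<bar>iter_partial [] \<phi> x\<bar> \<le> A / (1 + norm x) ^ (DIM('a) + 1)"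
    using schwartz_decay[OF \<phi>, of "[]" "DIM('a) + 1"] by auto
  then have A': "\<bar>\<phi> x\<bar> \<le> A * w x" for x by (simp add: w_def)
  obtain B where B: "B \<ge> 0"
    "\<And>x z. norm z \<le> 1 \<Longrightarrow> \<bar>2 * \<phi> x - \<phi> (x + z) - \<phi> (x - z)\<bar> \<le> B * (norm z)\<^sup>2 / (1 + norm x) ^ (DIM('a) + 1)"
    using schwartz_second_difference[OF \<phi>, of "DIM('a) + 1"] by blast
  have main: "\<bar>2 * \<phi> x - \<phi> (x + z) - \<phi> (x - z)\<bar> \<le> (B + 2 * A) * min 1 ((norm z)\<^sup>2) * (w x + w (z + x) + w (- z + x))" for x z
  proof (cases "norm z \<le> 1")
    case True
    then have "(norm z)\<^sup>2 \<le> 1" by (simp add: power_le_one)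
    then have m: "min 1 ((norm z)\<^sup>2) = (norm z)\<^sup>2" by simp
    have "\<bar>2 * \<phi> x - \<phi> (x + z) - \<phi> (x - z)\<bar> \<le> B * (norm z)\<^sup>2 * w x"
      using B(2)[OF True, of x] by (simp add: w_def)
    also have "\<dots> \<le> (B + 2 * A) * (norm z)\<^sup>2 * (w x + w (z + x) + w (- z + x))"
      using A(1) B(1) w[of x] w[of "z + x"] w[of "- z + x"] by (intro mult_mono) auto
    finally show ?thesis by (simp only: m)
  next
    case False
    then have "(norm z)\<^sup>2 \<ge> 1" by (simp add: one_le_power)
    then have m: "min 1 ((norm z)\<^sup>2) = 1" by simp
    have "\<bar>2 * \<phi> x - \<phi> (x + z) - \<phi> (x - z)\<bar> \<le> 2 * (A * w x) + A * w (x + z) + A * w (x - z)"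
      using A'[of x] A'[of "x + z"] A'[of "x - z"] by linarith
    also have "\<dots> \<le> 2 * A * (w x + w (z + x) + w (- z + x))"
      using A(1) w by (simp add: algebra_simps)
    also have "\<dots> \<le> (B + 2 * A) * (w x + w (z + x) + w (- z + x))"
      using B(1) w[of x] w[of "z + x"] w[of "- z + x"] by (intro mult_right_mono) auto
    finally show ?thesis by (simp add: m)
  qed
  have "\<bar>symmetric_kernel s \<phi> x z\<bar> \<le> (B + 2 * A) * (min 1 ((norm z)\<^sup>2) / norm z powr (real DIM('a) + 2 * s)) *
     (w x + w (z + x) + w (- z + x))" for x z
  proof -
    let ?k = "norm z powr (real DIM('a) + 2 * s)"
    have "\<bar>symmetric_kernel s \<phi> x z\<bar> = \<bar>2 * \<phi> x - \<phi> (x + z) - \<phi> (x - z)\<bar> / ?k / 2"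
      by (simp add: symmetric_kernel_def abs_mult)
    also have "\<dots> \<le> \<bar>2 * \<phi> x - \<phi> (x + z) - \<phi> (x - z)\<bar> / ?k"
    proof -
      have half: "y / 2 \<le> y" if "y \<ge> 0" for y :: real using that by simp
      show ?thesis by (rule half) simp
    qed
    also have "\<dots> \<le> (B + 2 * A) * min 1 ((norm z)\<^sup>2) * (w x + w (z + x) + w (- z + x)) / ?k"
      by (intro divide_right_mono main) auto
    finally show ?thesis by simp
  qed
  then show thesis using A(1) B(1) by (intro that[of "B + 2 * A"]) (auto simp: w_def)
qed

lemma integrable_translates_of_decay:
  fixes z :: "'a::euclidean_space"
  defines "w \<equiv> \<lambda>x::'a. 1 / (1 + norm x) ^ (DIM('a) + 1)"
  shows "has_bochner_integral lborel (\<lambda>x. w x + w (z + x) + w (- z + x)) (3 * integral\<^sup>L lborel w)"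
proof -
  have w: "has_bochner_integral lborel w (integral\<^sup>L lborel w)"
    using integrable_polynomial_decay[where 'a='a] by (simp add: has_bochner_integral_iff w_def)
  have "has_bochner_integral lborel (\<lambda>x. w x + w (z + x) + w (- z + x)) (integral\<^sup>L lborel w + integral\<^sup>L lborel w + integral\<^sup>L lborel w)"
    by (intro has_bochner_integral_add has_bochner_integral_shift w)
  then show ?thesis by simp
qed

lemma schwartz_measurable: "schwartz \<phi> \<Longrightarrow> \<phi> \<in> borel_measurable borel"
  by (intro borel_measurable_continuous_onI schwartz_continuous)

lemma measurable_symmetric_kernel:
  assumes [measurable]: "u \<in> borel_measurable borel"
  shows "(\<lambda>(x, z). symmetric_kernel s u x z) \<in> borel_measurable (lborel \<Otimes>\<^sub>M lborel)"
proof -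
  have "borel_measurable (lborel \<Otimes>\<^sub>M lborel) = borel_measurable (borel \<Otimes>\<^sub>M (borel :: 'a measure))"
    by (intro measurable_cong_sets sets_pair_measure_cong) auto
  moreover have "(\<lambda>(x, z). symmetric_kernel s u x z) \<in> borel_measurable (borel \<Otimes>\<^sub>M borel)"
    unfolding symmetric_kernel_def by measurable
  ultimately show ?thesis by simp
qed

text \<open>
  The second claim is what permits exchanging the Fourier integral with the singular integral.
\<close>

lemma integrable_symmetric_kernel_schwartz:
  fixes \<phi> :: "'a::euclidean_space \<Rightarrow> real"
  assumes \<phi>: "schwartz \<phi>" and s: "0 < s" "s < 1"
  shows "integrable lborel (symmetric_kernel s \<phi> x)"
    and "integrable (lborel \<Otimes>\<^sub>M lborel) (\<lambda>(x, z). symmetric_kernel s \<phi> x z)"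
proof -
  define w where "w x = 1 / (1 + norm (x::'a)) ^ (DIM('a) + 1)" for x
  define k where "k z = min 1 ((norm z)\<^sup>2) / norm (z::'a) powr (real DIM('a) + 2 * s)" for z
  have wk[measurable]: "w \<in> borel_measurable borel" "k \<in> borel_measurable borel"
    unfolding w_def k_def by measurable
  have w: "0 \<le> w x" "w x \<le> 1" for x
    using one_le_power[of "1 + norm x" "DIM('a) + 1"] by (auto simp: w_def divide_le_eq)
  have k: "0 \<le> k z" for z by (simp add: k_def)
  have ik: "integrable lborel k" unfolding k_def by (rule integrable_levy_kernel[OF s])
  obtain C where C: "C \<ge> 0" "\<And>x z. \<bar>symmetric_kernel s \<phi> x z\<bar> \<le> C * k z * (w x + w (z + x) + w (- z + x))"
    using symmetric_kernel_schwartz_bound[OF \<phi>, of s] unfolding w_def k_def by blast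
  note [measurable] = schwartz_measurable[OF \<phi>] measurable_symmetric_kernel[OF schwartz_measurable[OF \<phi>], of s]
  show "integrable lborel (symmetric_kernel s \<phi> x)"
  proof (rule Bochner_Integration.integrable_bound)
    show "integrable lborel (\<lambda>z. 3 * C * k z)" using ik by (rule integrable_mult_right)
    show "symmetric_kernel s \<phi> x \<in> borel_measurable lborel" unfolding symmetric_kernel_def by measurable
    show "AE z in lborel. norm (symmetric_kernel s \<phi> x z) \<le> norm (3 * C * k z)"
    proof (rule AE_I2)
      fix z
      have "C * k z * (w x + w (z + x) + w (- z + x)) \<le> C * k z * 3"
        using C(1) k[of z] w(2)[of x] w(2)[of "z + x"] w(2)[of "- z + x"] by (intro mult_left_mono) auto
      then show "norm (symmetric_kernel s \<phi> x z) \<le> norm (3 * C * k z)"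
        using C(2)[of x z] C(1) k[of z] by (simp add: abs_mult mult_ac)
    qed
  qed
  show "integrable (lborel \<Otimes>\<^sub>M lborel) (\<lambda>(x, z). symmetric_kernel s \<phi> x z)"
  proof (rule integrableI_bounded)
    have "(\<integral>\<^sup>+p. ennreal (norm (case p of (x, z) \<Rightarrow> symmetric_kernel s \<phi> x z)) \<partial>(lborel \<Otimes>\<^sub>M lborel))
      = (\<integral>\<^sup>+z. \<integral>\<^sup>+x. ennreal \<bar>symmetric_kernel s \<phi> x z\<bar> \<partial>lborel \<partial>lborel)"
      by (subst lborel_pair.nn_integral_snd[symmetric]) auto
    also have "\<dots> \<le> (\<integral>\<^sup>+z. ennreal (C * k z) * ennreal (3 * integral\<^sup>L lborel w) \<partial>lborel)"
    proof (rule nn_integral_mono)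
      fix z :: 'a
      have "(\<integral>\<^sup>+x. ennreal \<bar>symmetric_kernel s \<phi> x z\<bar> \<partial>lborel) \<le> (\<integral>\<^sup>+x. ennreal (C * k z) * ennreal (w x + w (z + x) + w (- z + x)) \<partial>lborel)"
        using C k w(1) by (intro nn_integral_mono, subst ennreal_mult'[symmetric]) (auto intro!: ennreal_leI)
      also have "\<dots> = ennreal (C * k z) * (\<integral>\<^sup>+x. ennreal (w x + w (z + x) + w (- z + x)) \<partial>lborel)"
        by (rule nn_integral_cmult) measurable
      also have "(\<integral>\<^sup>+x. ennreal (w x + w (z + x) + w (- z + x)) \<partial>lborel) = ennreal (3 * integral\<^sup>L lborel w)"
        using integrable_translates_of_decay[of z] w(1) unfolding w_def[symmetric, abs_def]
        by (subst nn_integral_eq_integral) (auto simp: has_bochner_integral_iff)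
      finally show "(\<integral>\<^sup>+x. ennreal \<bar>symmetric_kernel s \<phi> x z\<bar> \<partial>lborel) \<le> ennreal (C * k z) * ennreal (3 * integral\<^sup>L lborel w)" .
    qed
    also have "\<dots> = (\<integral>\<^sup>+z. ennreal (C * k z) \<partial>lborel) * ennreal (3 * integral\<^sup>L lborel w)"
      by (rule nn_integral_multc) measurable
    also have "(\<integral>\<^sup>+z. ennreal (C * k z) \<partial>lborel) = ennreal (C * integral\<^sup>L lborel k)"
      using ik C(1) k by (subst nn_integral_eq_integral) auto
    finally show "(\<integral>\<^sup>+p. ennreal (norm (case p of (x, z) \<Rightarrow> symmetric_kernel s \<phi> x z)) \<partial>(lborel \<Otimes>\<^sub>M lborel)) < \<infinity>"
      by (rule le_less_trans) (simp add: ennreal_mult_less_top)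
  qed measurable
qed

lemma has_pv_integral_schwartz:
  fixes \<phi> :: "'a::euclidean_space \<Rightarrow> real"
  assumes \<phi>: "schwartz \<phi>" and s: "0 < s" "s < 1"
  shows "has_pv_integral s \<phi> x (LINT z|lborel. symmetric_kernel s \<phi> x z)"
proof (rule has_pv_integral_symmetrize)
  note [measurable] = schwartz_measurable[OF \<phi>]
  show "integrable lborel (symmetric_kernel s \<phi> x)" by (rule integrable_symmetric_kernel_schwartz(1)[OF assms])
  fix \<epsilon> :: real assume \<epsilon>: "\<epsilon> > 0"
  obtain A where A: "A \<ge> 0" "\<And>x. \<bar>iter_partial [] \<phi> x\<bar> \<le> A / (1 + norm x) ^ 0"
    using schwartz_decay[OF \<phi>, of "[]" 0] by auto
  have "integrable lborel (\<lambda>z::'a. indicator {z. \<epsilon> < norm z} (x - z) / norm (x - z) powr (real DIM('a) + 2 * s))"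
    using has_bochner_integral_reflect[OF has_bochner_integral_integrable[OF integrable_kernel_tail[OF s \<epsilon>]], of x]
    by (simp add: has_bochner_integral_iff)
  then have "integrable lborel (\<lambda>z::'a. 2 * A * (indicator {z. \<epsilon> < norm z} (x - z) / norm (x - z) powr (real DIM('a) + 2 * s)))"
    by (rule integrable_mult_right)
  then show "set_integrable lborel {y. \<epsilon> < norm (x - y)} (\<lambda>y. (\<phi> x - \<phi> y) / norm (x - y) powr (real DIM('a) + 2 * s))"
    unfolding set_integrable_def
  proof (rule Bochner_Integration.integrable_bound)
    show "AE y in lborel. norm (indicator {y. \<epsilon> < norm (x - y)} y *\<^sub>R ((\<phi> x - \<phi> y) / norm (x - y) powr (real DIM('a) + 2 * s)))
        \<le> norm (2 * A * (indicator {z. \<epsilon> < norm z} (x - y) / norm (x - y) powr (real DIM('a) + 2 * s)))"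
    proof (rule AE_I2)
      fix y
      have "\<bar>\<phi> x - \<phi> y\<bar> \<le> 2 * A" using A(2)[of x] A(2)[of y] by simp
      then show "norm (indicator {y. \<epsilon> < norm (x - y)} y *\<^sub>R ((\<phi> x - \<phi> y) / norm (x - y) powr (real DIM('a) + 2 * s)))
        \<le> norm (2 * A * (indicator {z. \<epsilon> < norm z} (x - y) / norm (x - y) powr (real DIM('a) + 2 * s)))"
        using A(1) by (auto simp: indicator_def abs_mult intro!: divide_right_mono)
    qed
  qed measurable
qed

lemma integrable_schwartz:
  fixes \<phi> :: "'a::euclidean_space \<Rightarrow> real"
  assumes \<phi>: "schwartz \<phi>"
  shows "integrable lborel \<phi>"
proof -
  note [measurable] = schwartz_measurable[OF \<phi>]
  obtain A where A: "A \<ge> 0" "\<And>x. \<bar>iter_partial [] \<phi> x\<bar> \<le> A / (1 + norm x) ^ (DIM('a) + 1)"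
    using schwartz_decay[OF \<phi>, of "[]" "DIM('a) + 1"] by auto
  have "integrable lborel (\<lambda>x::'a. A * (1 / (1 + norm x) ^ (DIM('a) + 1)))"
    by (intro integrable_mult_right integrable_polynomial_decay)
  then show ?thesis
  proof (rule Bochner_Integration.integrable_bound)
    show "AE x in lborel. norm (\<phi> x) \<le> norm (A * (1 / (1 + norm x) ^ (DIM('a) + 1)))"
    proof (rule AE_I2)
      fix x :: 'a
      have "norm (A * (1 / (1 + norm x) ^ (DIM('a) + 1))) = A / (1 + norm x) ^ (DIM('a) + 1)"
        using A(1) by (simp del: power_Suc)
      moreover have "norm (\<phi> x) \<le> A / (1 + norm x) ^ (DIM('a) + 1)" using A(2)[of x] by simp
      ultimately show "norm (\<phi> x) \<le> norm (A * (1 / (1 + norm x) ^ (DIM('a) + 1)))" by (simp only:)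
    qed
  qed measurable
qed

text \<open>
  A translation by \<open>\<plusminus> z\<close> multiplies the transform by \<open>exp (\<plusminus> \<i> (z \<bullet> \<xi>))\<close>, and the two factors add up to
  \<open>2 cos (z \<bullet> \<xi>)\<close>.
\<close>

lemma fourier_symmetric_kernel:
  fixes \<phi> :: "'a::euclidean_space \<Rightarrow> real"
  assumes \<phi>: "schwartz \<phi>"
  shows "(LINT x|lborel. exp (- \<i> * complex_of_real (x \<bullet> \<xi>)) * complex_of_real (symmetric_kernel s \<phi> x z))
    = complex_of_real ((1 - cos (z \<bullet> \<xi>)) / norm z powr (real DIM('a) + 2 * s)) * fourier \<phi> \<xi>"
proof -
  note [measurable] = schwartz_measurable[OF \<phi>]
  define E where "E x = exp (- \<i> * complex_of_real (x \<bullet> \<xi>))" for x :: 'a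
  have Eadd: "E (x + y) = E x * E y" for x y
    by (simp add: E_def inner_add_left exp_add[symmetric] algebra_simps)
  have E1: "E (- y) * E y = 1" for y by (simp add: Eadd[symmetric]) (simp add: E_def)
  have nE: "norm (E x) = 1" for x by (simp add: E_def)
  have [measurable]: "E \<in> borel_measurable borel" unfolding E_def by measurable
  have base: "has_bochner_integral lborel (\<lambda>x. E x * complex_of_real (\<phi> x)) (fourier \<phi> \<xi>)"
  proof -
    have "integrable lborel (\<lambda>x. E x * complex_of_real (\<phi> x))"
      by (rule Bochner_Integration.integrable_bound[OF integrable_schwartz[OF \<phi>]]) (auto simp: norm_mult nE)
    then show ?thesis by (simp add: has_bochner_integral_iff fourier_def E_def)
  qed
  have shift: "has_bochner_integral lborel (\<lambda>x. E x * complex_of_real (\<phi> (x + y))) (E (- y) * fourier \<phi> \<xi>)" for y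
  proof -
    have "has_bochner_integral lborel (\<lambda>x. E (- y) * (E (y + x) * complex_of_real (\<phi> (y + x)))) (E (- y) * fourier \<phi> \<xi>)"
      by (intro has_bochner_integral_mult_right has_bochner_integral_shift[OF base])
    moreover have "E (- y) * (E (y + x) * complex_of_real (\<phi> (y + x))) = E x * complex_of_real (\<phi> (x + y))" for x
      using E1[of y] by (simp add: Eadd mult.assoc[symmetric] add.commute)
    ultimately show ?thesis by simp
  qed
  let ?k = "complex_of_real (norm z powr (real DIM('a) + 2 * s))"
  have "has_bochner_integral lborel (\<lambda>x. (1 / (2 * ?k)) *
      (2 * (E x * complex_of_real (\<phi> x)) - E x * complex_of_real (\<phi> (x + z)) - E x * complex_of_real (\<phi> (x + - z))))
     ((1 / (2 * ?k)) * (2 * fourier \<phi> \<xi> - E (- z) * fourier \<phi> \<xi> - E (- (- z)) * fourier \<phi> \<xi>))"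
    by (intro has_bochner_integral_mult_right has_bochner_integral_diff shift base)
  moreover have "(1 / (2 * ?k)) * (2 * (E x * complex_of_real (\<phi> x)) - E x * complex_of_real (\<phi> (x + z)) - E x * complex_of_real (\<phi> (x + - z)))
     = E x * complex_of_real (symmetric_kernel s \<phi> x z)" for x
    by (simp add: symmetric_kernel_def algebra_simps diff_divide_distrib)
  moreover have "(1 / (2 * ?k)) * (2 * fourier \<phi> \<xi> - E (- z) * fourier \<phi> \<xi> - E (- (- z)) * fourier \<phi> \<xi>)
     = complex_of_real ((1 - cos (z \<bullet> \<xi>)) / norm z powr (real DIM('a) + 2 * s)) * fourier \<phi> \<xi>"
  proof -
    have "E (- z) + E z = 2 * complex_of_real (cos (z \<bullet> \<xi>))"
      by (simp add: E_def cos_exp_eq flip: cos_of_real)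
    then have "2 * fourier \<phi> \<xi> - E (- z) * fourier \<phi> \<xi> - E (- (- z)) * fourier \<phi> \<xi>
       = 2 * (1 - complex_of_real (cos (z \<bullet> \<xi>))) * fourier \<phi> \<xi>"
      by (metis (no_types, lifting) add.inverse_inverse diff_diff_eq left_diff_distrib distrib_right mult.assoc mult.right_neutral right_diff_distrib)
    moreover have "(1 / (2 * ?k)) * (2 * A * F) = (A / ?k) * F" for A F by simp
    ultimately show ?thesis by (simp only: of_real_divide of_real_diff of_real_1)
  qed
  ultimately have "has_bochner_integral lborel (\<lambda>x. E x * complex_of_real (symmetric_kernel s \<phi> x z))
     (complex_of_real ((1 - cos (z \<bullet> \<xi>)) / norm z powr (real DIM('a) + 2 * s)) * fourier \<phi> \<xi>)"
    by simp
  then show ?thesis by (simp only: E_def has_bochner_integral_iff)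
qed

lemma fourier_cmult: "fourier (\<lambda>x. c * w x) \<xi> = complex_of_real c * fourier w \<xi>"
proof -
  have "fourier (\<lambda>x. c * w x) \<xi> = (LINT x|lborel. complex_of_real c * (exp (- \<i> * complex_of_real (x \<bullet> \<xi>)) * complex_of_real (w x)))"
    unfolding fourier_def by (intro Bochner_Integration.integral_cong) auto
  then show ?thesis unfolding fourier_def by simp
qed

lemma fourier_pv_schwartz:
  fixes \<phi> :: "'a::euclidean_space \<Rightarrow> real"
  assumes \<phi>: "schwartz \<phi>" and s: "0 < s" "s < 1"
  shows "fourier (\<lambda>x. LINT z|lborel. symmetric_kernel s \<phi> x z) \<xi> =
     complex_of_real (multiplier_integral TYPE('a) s * norm \<xi> powr (2 * s)) * fourier \<phi> \<xi>"
proof -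
  define E where "E x = exp (- \<i> * complex_of_real (x \<bullet> \<xi>))" for x :: 'a
  have nE: "norm (E x) = 1" for x by (simp add: E_def)
  have [measurable]: "E \<in> borel_measurable borel" unfolding E_def by measurable
  note [measurable] = schwartz_measurable[OF \<phi>] measurable_symmetric_kernel[OF schwartz_measurable[OF \<phi>], of s]
  have int: "integrable (lborel \<Otimes>\<^sub>M lborel) (\<lambda>(x, z). E x * complex_of_real (symmetric_kernel s \<phi> x z))"
    by (rule Bochner_Integration.integrable_bound[OF integrable_symmetric_kernel_schwartz(2)[OF assms]])
       (auto simp: norm_mult nE split: prod.split)
  have "fourier (\<lambda>x. LINT z|lborel. symmetric_kernel s \<phi> x z) \<xi> =
     (LINT x|lborel. LINT z|lborel. E x * complex_of_real (symmetric_kernel s \<phi> x z))"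
    unfolding fourier_def E_def[symmetric] by simp
  also have "\<dots> = (LINT z|lborel. LINT x|lborel. E x * complex_of_real (symmetric_kernel s \<phi> x z))"
    by (rule lborel_pair.Fubini_integral[OF int, symmetric])
  also have "\<dots> = (LINT z|lborel. complex_of_real ((1 - cos (z \<bullet> \<xi>)) / norm z powr (real DIM('a) + 2 * s)) * fourier \<phi> \<xi>)"
    unfolding E_def fourier_symmetric_kernel[OF \<phi>] ..
  also have "\<dots> = complex_of_real (multiplier_integral TYPE('a) s * norm \<xi> powr (2 * s)) * fourier \<phi> \<xi>"
    using has_bochner_integral_cos_kernel[OF s, of \<xi>]
    by (simp add: has_bochner_integral_iff integral_complex_of_real del: of_real_divide of_real_diff of_real_mult)
  finally show ?thesis .
qed

lemma has_multiplier_inverse_multiplier_integral: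
  assumes s: "0 < s" "s < 1"
  shows "has_multiplier TYPE('a::euclidean_space) s (1 / multiplier_integral TYPE('a) s)"
  unfolding has_multiplier_def
proof (intro allI impI exI conjI)
  fix \<phi> :: "'a \<Rightarrow> real" assume \<phi>: "schwartz \<phi>"
  show "has_pv_integral s \<phi> x (LINT z|lborel. symmetric_kernel s \<phi> x z)" for x
    by (rule has_pv_integral_schwartz[OF \<phi> s])
  show "integrable lborel (\<lambda>x. LINT z|lborel. symmetric_kernel s \<phi> x z)"
    by (rule lborel_pair.integrable_fst[OF integrable_symmetric_kernel_schwartz(2)[OF \<phi> s]])
  show "fourier (\<lambda>x. 1 / multiplier_integral TYPE('a) s * (LINT z|lborel. symmetric_kernel s \<phi> x z)) \<xi> =
     complex_of_real (norm \<xi> powr (2 * s)) * fourier \<phi> \<xi>" for \<xi>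
    unfolding fourier_cmult fourier_pv_schwartz[OF \<phi> s]
    using multiplier_integral_pos[OF s, where 'a='a] by simp
qed

lemma fourier_gaussian_nonzero: "fourier (\<lambda>x::'a::euclidean_space. exp (- (x \<bullet> x))) \<xi> \<noteq> 0"
proof -
  have "fourier (\<lambda>x::'a. exp (- (x \<bullet> x))) \<xi> =
     (LINT x|lborel. complex_of_real (exp (- 1 * (norm x)\<^sup>2)) * iexp (x \<bullet> (- \<xi>)))"
    unfolding fourier_def by (intro Bochner_Integration.integral_cong) (auto simp: power2_norm_eq_inner mult.commute)
  also have "\<dots> = complex_of_real ((pi / 1) powr (real DIM('a) / 2) * exp (- (norm (- \<xi>))\<^sup>2 / (4 * 1)))"
    using gaussian_fourier[of 1 "- \<xi>"] by (simp only: has_bochner_integral_iff zero_less_one)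
  finally show ?thesis by simp
qed

lemma has_pv_integral_unique: "has_pv_integral s u x l \<Longrightarrow> has_pv_integral s u x l' \<Longrightarrow> l = l'"
  unfolding has_pv_integral_def by (auto intro: tendsto_unique[OF trivial_limit_at_right_real])

text \<open>
  Uniqueness needs one test function whose transform does not vanish at some \<open>\<xi> \<noteq> 0\<close>; the Gaussian
  serves.
\<close>

theorem frac_lap_const_eq:
  assumes s: "0 < s" "s < 1"
  shows "frac_lap_const TYPE('a::euclidean_space) s = 1 / multiplier_integral TYPE('a) s"
  unfolding frac_lap_const_def
proof (rule the_equality)
  let ?K = "multiplier_integral TYPE('a) s"
  show "0 < 1 / ?K \<and> has_multiplier TYPE('a) s (1 / ?K)"
    using has_multiplier_inverse_multiplier_integral[OF s] multiplier_integral_pos[OF s, where 'a='a] by auto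
  fix C assume C: "0 < C \<and> has_multiplier TYPE('a) s C"
  let ?g = "\<lambda>x::'a. exp (- (x \<bullet> x))"
  let ?w = "\<lambda>x. LINT z|lborel. symmetric_kernel s ?g x z"
  obtain b :: 'a where b: "b \<in> Basis" using nonempty_Basis by blast
  obtain w where w: "\<forall>x. has_pv_integral s ?g x (w x)"
     "\<forall>\<xi>. fourier (\<lambda>x. C * w x) \<xi> = complex_of_real (norm \<xi> powr (2 * s)) * fourier ?g \<xi>"
    using C schwartz_gaussian unfolding has_multiplier_def by blast
  have "w = ?w"
    using w(1) has_pv_integral_schwartz[OF schwartz_gaussian s] by (intro ext) (blast intro: has_pv_integral_unique)
  then have "complex_of_real C * (complex_of_real ?K * fourier ?g b) = fourier ?g b"
    using w(2)[rule_format, of b] b fourier_pv_schwartz[OF schwartz_gaussian s, of b]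
    unfolding fourier_cmult by (simp add: norm_Basis)
  then have "complex_of_real (C * ?K) * fourier ?g b = 1 * fourier ?g b" by simp
  then have "complex_of_real (C * ?K) = 1" using fourier_gaussian_nonzero mult_right_cancel by blast
  then have "C * ?K = 1" by (metis of_real_eq_1_iff)
  then show "C = 1 / ?K" by (metis eq_divide_eq mult_zero_right zero_neq_one)
qed

section \<open>Second differences of a power of the norm\<close>

text \<open>
  On the segment from \<open>e - z\<close> to \<open>e + z\<close> the squared norm is a quadratic polynomial \<open>Q\<close> of the parameter,
  with \<open>Q \<ge> 1/4\<close> if \<open>|z| \<le> 1/2\<close>; so the power stays away from its singularity and is \<open>Q\<^bsup>-\<alpha>/2\<^esup>\<close>.
\<close>

lemma power_second_difference_bound:
  fixes e :: "'a::euclidean_space"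
  assumes e: "norm e = 1" and \<alpha>: "\<alpha> > 0"
  obtains B where "B \<ge> 0" "\<And>z. norm z \<le> 1/2 \<Longrightarrow>
    \<bar>2 * norm e powr (- \<alpha>) - norm (e + z) powr (- \<alpha>) - norm (e - z) powr (- \<alpha>)\<bar> \<le> B * (norm z)\<^sup>2"
proof -
  define h where "h = \<alpha> / 2"
  have h: "h > 0" using \<alpha> by (simp add: h_def)
  define M where "M = h * ((h + 1) * 4 powr (h + 2) * 9 + 4 powr (h + 1) * 2)"
  have M: "M \<ge> 0" using h by (simp add: M_def)
  have "\<bar>2 * norm e powr (- \<alpha>) - norm (e + z) powr (- \<alpha>) - norm (e - z) powr (- \<alpha>)\<bar> \<le> 2 * (M * (norm z)\<^sup>2)"
    if z: "norm z \<le> 1/2" for z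
  proof -
    define c where "c = e \<bullet> z"
    define d where "d = (norm z)\<^sup>2"
    define Q where "Q t = 1 + 2 * t * c + t\<^sup>2 * d" for t
    have Q: "(norm (e + t *\<^sub>R z))\<^sup>2 = Q t" for t
    proof -
      have "(norm (e + t *\<^sub>R z))\<^sup>2 = e \<bullet> e + 2 * t * (e \<bullet> z) + t\<^sup>2 * (z \<bullet> z)"
        by (simp only: power2_norm_eq_inner) (simp add: inner_add_left inner_add_right inner_commute power2_eq_square)
      moreover have "e \<bullet> e = 1" using e by (simp add: norm_eq_sqrt_inner)
      ultimately show ?thesis by (simp add: Q_def c_def d_def power2_norm_eq_inner)
    qed
    have Q4: "Q t \<ge> 1/4" if "\<bar>t\<bar> \<le> 1" for t
    proof -
      have "norm (t *\<^sub>R z) \<le> 1 * (1/2)" unfolding norm_scaleR using that z by (intro mult_mono) auto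
      then have "norm (e + t *\<^sub>R z) \<ge> 1/2" using norm_diff_ineq[of e "t *\<^sub>R z"] e by argo
      then have "(norm (e + t *\<^sub>R z))\<^sup>2 \<ge> (1/2)\<^sup>2" by (intro power_mono) auto
      then show ?thesis unfolding Q by (simp add: power2_eq_square)
    qed
    have pw: "norm (e + t *\<^sub>R z) powr (- \<alpha>) = Q t powr (- h)" if "\<bar>t\<bar> \<le> 1" for t
    proof -
      have "norm (e + t *\<^sub>R z) = sqrt (Q t)" using Q[of t] by (metis norm_ge_zero real_sqrt_unique)
      also have "\<dots> = Q t powr (1/2)" using Q4[OF that] by (simp add: powr_half_sqrt)
      finally show ?thesis by (simp add: powr_powr h_def)
    qed
    let ?g' = "\<lambda>t. - h * Q t powr (- h - 1) * (2 * c + 2 * t * d)"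
    let ?g'' = "\<lambda>t. - h * ((- h - 1) * Q t powr (- h - 2) * (2 * c + 2 * t * d)\<^sup>2 + Q t powr (- h - 1) * (2 * d))"
    have dQ: "(Q has_real_derivative (2 * c + 2 * t * d)) (at t)" for t
      unfolding Q_def by (auto intro!: derivative_eq_intros)
    have dp: "((\<lambda>t. Q t powr r) has_real_derivative r * Q t powr (r - 1) * (2 * c + 2 * t * d)) (at t)" if "\<bar>t\<bar> \<le> 1" for t r
      using DERIV_fun_powr[OF dQ, of t r] Q4[OF that] by simp
    have "\<bar>2 * Q 0 powr (- h) - Q 1 powr (- h) - Q (- 1) powr (- h)\<bar> \<le> 2 * (M * (norm z)\<^sup>2)"
    proof (rule second_difference_bound)
      fix t :: real assume t: "\<bar>t\<bar> \<le> 1"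
      show "((\<lambda>t. Q t powr (- h)) has_real_derivative ?g' t) (at t)" by (rule dp[OF t])
      have "((\<lambda>t. Q t powr (- h - 1) * (2 * c + 2 * t * d)) has_real_derivative
         ((- h - 1) * Q t powr (- h - 1 - 1) * (2 * c + 2 * t * d)) * (2 * c + 2 * t * d) + (2 * d) * Q t powr (- h - 1)) (at t)"
        by (intro DERIV_mult dp[OF t]) (auto intro!: derivative_eq_intros)
      then have d: "((\<lambda>t. - h * (Q t powr (- h - 1) * (2 * c + 2 * t * d))) has_real_derivative
         - h * (((- h - 1) * Q t powr (- h - 1 - 1) * (2 * c + 2 * t * d)) * (2 * c + 2 * t * d) + (2 * d) * Q t powr (- h - 1))) (at t)"
        by (rule DERIV_cmult)
      have g': "?g' = (\<lambda>t. - h * (Q t powr (- h - 1) * (2 * c + 2 * t * d)))" by (simp add: fun_eq_iff)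
      have x: "- h - 1 - 1 = - h - 2" by simp
      have eq: "(p * l) * l + m * r = p * l\<^sup>2 + r * m" for p l m r :: real
        by (simp add: power2_eq_square)
      note eq = eq[of "(- h - 1) * Q t powr (- h - 2)" "2 * c + 2 * t * d" "2 * d" "Q t powr (- h - 1)"]
      show "(?g' has_real_derivative ?g'' t) (at t)" using d unfolding g' x eq .
      have small: "Q t powr (- r) \<le> 4 powr r" if "r > 0" for r
      proof -
        have "Q t powr (- r) \<le> (1/4) powr (- r)" using Q4[OF t] that by (intro powr_mono2') auto
        also have "(1/4) powr (- r) = 4 powr r" by (simp add: powr_minus_divide powr_divide)
        finally show ?thesis .
      qed
      have s2: "Q t powr (- h - 2) \<le> 4 powr (h + 2)" "Q t powr (- h - 1) \<le> 4 powr (h + 1)"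
      proof -
        have "- (h + 2) = - h - 2" "- (h + 1) = - h - 1" by simp_all
        then show "Q t powr (- h - 2) \<le> 4 powr (h + 2)" "Q t powr (- h - 1) \<le> 4 powr (h + 1)"
          using small[of "h + 2"] small[of "h + 1"] h by (simp_all only:)
      qed
      have lin: "(2 * c + 2 * t * d)\<^sup>2 \<le> 9 * (norm z)\<^sup>2"
      proof -
        have "\<bar>c\<bar> \<le> norm z" unfolding c_def using Cauchy_Schwarz_ineq2[of e z] e by simp
        moreover have "\<bar>t * d\<bar> \<le> 1 * (norm z * (1/2))" unfolding d_def abs_mult power2_eq_square using t z by (intro mult_mono) auto
        ultimately have "\<bar>2 * c + 2 * t * d\<bar> \<le> 3 * norm z" by (simp add: abs_le_iff) argo
        then have "\<bar>2 * c + 2 * t * d\<bar>\<^sup>2 \<le> (3 * norm z)\<^sup>2" by (intro power_mono) auto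
        then show ?thesis by (simp add: power_mult_distrib)
      qed
      have "\<bar>?g'' t\<bar> = h * \<bar>(- h - 1) * Q t powr (- h - 2) * (2 * c + 2 * t * d)\<^sup>2 + Q t powr (- h - 1) * (2 * d)\<bar>"
      proof -
        have "\<bar>- h * y\<bar> = h * \<bar>y\<bar>" for y using h by (simp add: abs_mult)
        then show ?thesis .
      qed
      also have "\<dots> \<le> h * (\<bar>(- h - 1) * Q t powr (- h - 2) * (2 * c + 2 * t * d)\<^sup>2\<bar> + \<bar>Q t powr (- h - 1) * (2 * d)\<bar>)"
        using h by (intro mult_left_mono abs_triangle_ineq) auto
      also have "\<dots> = h * ((h + 1) * Q t powr (- h - 2) * (2 * c + 2 * t * d)\<^sup>2 + Q t powr (- h - 1) * (2 * d))"
        using h by (simp add: abs_mult d_def)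
      also have "\<dots> \<le> h * ((h + 1) * 4 powr (h + 2) * (9 * (norm z)\<^sup>2) + 4 powr (h + 1) * (2 * (norm z)\<^sup>2))"
        using h s2 lin by (intro mult_left_mono add_mono mult_mono) (auto simp: d_def)
      also have "\<dots> = M * (norm z)\<^sup>2" by (simp add: M_def algebra_simps)
      finally show "\<bar>?g'' t\<bar> \<le> M * (norm z)\<^sup>2" .
    qed
    then show ?thesis using pw[of 0] pw[of 1] pw[of "- 1"] by simp
  qed
  then show thesis using that[of "2 * M"] M by (simp add: mult.assoc)
qed

text \<open>
  Near \<open>z = 0\<close> the second difference is quadratic; elsewhere the kernel is an average of two translates
  of the truncated integrand.  In particular the singularities at \<open>z = \<plusminus> e\<close> are covered by the
  integrability of the truncation.
\<close>

lemma integrable_symmetric_kernel_power: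
  fixes e :: "'a::euclidean_space"
  assumes e: "norm e = 1" and \<alpha>: "\<alpha> > 0" and s: "0 < s" "s < 1"
    and off: "set_integrable lborel {y. 1/2 < norm (e - y)}
       (\<lambda>y. (norm e powr (- \<alpha>) - norm y powr (- \<alpha>)) / norm (e - y) powr (real DIM('a) + 2 * s))"
  shows "integrable lborel (symmetric_kernel s (\<lambda>y. norm y powr (- \<alpha>)) e)"
proof -
  let ?D = "symmetric_kernel s (\<lambda>y. norm y powr (- \<alpha>)) e"
  have [measurable]: "?D \<in> borel_measurable borel" unfolding symmetric_kernel_def by measurable
  obtain B where B: "B \<ge> 0" "\<And>z. norm z \<le> 1/2 \<Longrightarrow>
    \<bar>2 * norm e powr (- \<alpha>) - norm (e + z) powr (- \<alpha>) - norm (e - z) powr (- \<alpha>)\<bar> \<le> B * (norm z)\<^sup>2"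
    using power_second_difference_bound[OF e \<alpha>] by blast
  have 1: "integrable lborel (\<lambda>z. indicator {z. 1/2 < norm z} z * ?D z)"
    using has_bochner_integral_symmetric_kernel_truncated[OF off] by (auto simp: has_bochner_integral_iff)
  have "integrable lborel (\<lambda>z::'a. B * (min 1 ((norm z)\<^sup>2) / norm z powr (real DIM('a) + 2 * s)))"
    by (intro integrable_mult_right integrable_levy_kernel s)
  then have 2: "integrable lborel (\<lambda>z. indicator {z. norm z \<le> 1/2} z * ?D z)"
  proof (rule Bochner_Integration.integrable_bound)
    show "AE z in lborel. norm (indicator {z. norm z \<le> 1/2} z * ?D z) \<le> norm (B * (min 1 ((norm z)\<^sup>2) / norm z powr (real DIM('a) + 2 * s)))"
    proof (rule AE_I2)
      fix z :: 'a
      show "norm (indicator {z. norm z \<le> 1/2} z * ?D z) \<le> norm (B * (min 1 ((norm z)\<^sup>2) / norm z powr (real DIM('a) + 2 * s)))"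
      proof (cases "norm z \<le> 1/2")
        case True
        let ?k = "norm z powr (real DIM('a) + 2 * s)"
        have "(norm z)\<^sup>2 \<le> 1" using True by (intro power_le_one) auto
        then have m: "min 1 ((norm z)\<^sup>2) = (norm z)\<^sup>2" by simp
        have half: "y / 2 \<le> y" if "y \<ge> 0" for y :: real using that by simp
        let ?n = "\<bar>2 * norm e powr (- \<alpha>) - norm (e + z) powr (- \<alpha>) - norm (e - z) powr (- \<alpha>)\<bar>"
        have "norm (indicator {z. norm z \<le> 1/2} z * ?D z) = ?n / ?k / 2"
          using True by (simp add: symmetric_kernel_def abs_mult)
        also have "\<dots> \<le> ?n / ?k" by (rule half) simp
        also have "\<dots> \<le> B * (norm z)\<^sup>2 / ?k" by (intro divide_right_mono B(2) True) auto
        also have "\<dots> = norm (B * (min 1 ((norm z)\<^sup>2) / ?k))" using B(1) unfolding m by simp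
        finally show ?thesis .
      qed auto
    qed
  qed measurable
  show ?thesis
    by (rule Bochner_Integration.integrable_cong[THEN iffD1, OF refl _ Bochner_Integration.integrable_add[OF 1 2]])
       (auto simp: indicator_def)
qed

section \<open>The fractional Laplacian of a power of the norm\<close>

lemma has_bochner_integral_Gamma:
  assumes "a > (0::real)"
  shows "has_bochner_integral lborel (\<lambda>t. t powr (a - 1) * exp (- t) * indicator {0<..} t) (Gamma a)"
  unfolding has_bochner_integral_iff using assms nn_integral_Gamma[OF assms zero_less_one]
  by (subst nn_integral_eq_integrable[symmetric]) auto

text \<open>
  The substitution \<open>v = k/\<sigma>\<close>.
\<close>

lemma has_bochner_integral_inversion:
  fixes \<phi> :: "real \<Rightarrow> real"
  assumes [measurable]: "\<phi> \<in> borel_measurable borel" and k: "k > 0"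
    and M: "has_bochner_integral lborel (\<lambda>v. v powr (- s - 1) * \<phi> v * indicator {0<..} v) M"
  shows "has_bochner_integral lborel (\<lambda>\<sigma>. \<sigma> powr (s - 1) * \<phi> (k / \<sigma>) * indicator {0<..} \<sigma>) (k powr s * M)"
proof -
  have "has_bochner_integral lborel (\<lambda>\<sigma>. \<bar>- (k / \<sigma>\<^sup>2)\<bar> * ((k / \<sigma>) powr (- s - 1) * \<phi> (k / \<sigma>)) * indicator {0<..} \<sigma>) M"
    using M k by (intro has_bochner_integral_substitution[THEN iffD1, rotated -1])
      (auto intro!: bij_betwI[where g="\<lambda>x. k / x"] derivative_eq_intros simp: power2_eq_square)
  from has_bochner_integral_mult_right[OF this, of "k powr s"]
  show ?thesis
  proof (rule has_bochner_integral_cong[THEN iffD1, rotated 3])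
    fix \<sigma> :: real
    show "k powr s * (\<bar>- (k / \<sigma>\<^sup>2)\<bar> * ((k / \<sigma>) powr (- s - 1) * \<phi> (k / \<sigma>)) * indicator {0<..} \<sigma>) = \<sigma> powr (s - 1) * \<phi> (k / \<sigma>) * indicator {0<..} \<sigma>"
    proof (cases "\<sigma> > 0")
      case True
      have 1: "\<bar>- (k / \<sigma>\<^sup>2)\<bar> = k powr 1 * \<sigma> powr (-2)" using True k by (simp add: powr_minus powr_numeral divide_inverse)
      have "(k / \<sigma>) powr r = k powr r * \<sigma> powr (- r)" for r
        using True k by (simp add: powr_divide powr_minus_divide)
      then have 2: "(k / \<sigma>) powr (- s - 1) = k powr (- s - 1) * \<sigma> powr (- (- s - 1))" .
      have "k powr s * k powr 1 * k powr (- s - 1) = 1" using k by (simp only: powr_add[symmetric]) simp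
      moreover have "\<sigma> powr (-2) * \<sigma> powr (- (- s - 1)) = \<sigma> powr (s - 1)" by (simp only: powr_add[symmetric]) simp
      ultimately have "k powr s * (\<bar>- (k / \<sigma>\<^sup>2)\<bar> * (k / \<sigma>) powr (- s - 1)) = \<sigma> powr (s - 1)"
        unfolding 1 2 by (metis (no_types, lifting) mult.assoc mult.commute mult.left_neutral)
      then show ?thesis using True by (simp only: mult.assoc[symmetric] indicator_simps(1) greaterThan_iff)
    qed auto
  qed auto
qed

text \<open>
  Integrated over \<open>k\<close> and multiplied by \<open>\<sigma>\<^bsup>1-s\<^esup>\<close>, this is the (signed) amount by which the incomplete
  integral in \<open>gaussian_potential\<close> falls short of its limit \<open>\<Gamma>(r)\<close> as \<open>\<sigma>\<close> grows.  The \<open>max\<close> encodes the range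
  \<open>k < \<sigma>\<close>, since \<open>0 powr a = 0\<close>.
\<close>

definition gamma_deficit :: "real \<Rightarrow> real \<Rightarrow> real \<Rightarrow> real \<Rightarrow> real \<Rightarrow> real" where
  "gamma_deficit s c r k \<sigma> = (\<sigma> powr (s - 1) * (1 - max 0 (1 - k / \<sigma>) powr (c - 1)) * indicator {0<..} \<sigma>) *
     (k powr (r - 1) * exp (- k) * indicator {0<..} k)"

text \<open>
  For fixed \<open>k\<close> the integral over \<open>\<sigma>\<close> is the continued Beta integral times \<open>k\<^sup>s\<close>; what remains is a Gamma
  integral over \<open>k\<close>.  The same scaling applied to the absolute value gives integrability in the pair.
\<close>

lemma gamma_deficit_integral:
  assumes s: "0 < s" "s < 1" and c: "c > s" and r: "r > 0"
  shows "integrable (lborel \<Otimes>\<^sub>M lborel) (\<lambda>(k, \<sigma>). gamma_deficit s c r k \<sigma>)"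
    and "(LINT \<sigma>|lborel. LINT k|lborel. gamma_deficit s c r k \<sigma>) = Gamma (r + s) * (Gamma (1 - s) * Gamma c / (s * Gamma (c - s)))"
proof -
  define \<phi> where "\<phi> v = 1 - max 0 (1 - v) powr (c - 1)" for v
  have [measurable]: "\<phi> \<in> borel_measurable borel" unfolding \<phi>_def by measurable
  define M where "M = Gamma (1 - s) * Gamma c / (s * Gamma (c - s))"
  have M: "has_bochner_integral lborel (\<lambda>v. v powr (- s - 1) * \<phi> v * indicator {0<..} v) M"
    unfolding \<phi>_def M_def by (rule has_bochner_integral_Beta_continued[OF s c])
  define M' where "M' = (LINT v|lborel. v powr (- s - 1) * \<bar>\<phi> v\<bar> * indicator {0<..} v)"
  have M': "has_bochner_integral lborel (\<lambda>v. v powr (- s - 1) * \<bar>\<phi> v\<bar> * indicator {0<..} v) M'"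
  proof -
    have "integrable lborel (\<lambda>v. \<bar>v powr (- s - 1) * \<phi> v * indicator {0<..} v\<bar>)"
      using M by (auto simp: has_bochner_integral_iff)
    then show ?thesis by (simp add: has_bochner_integral_iff M'_def abs_mult)
  qed
  have inner: "has_bochner_integral lborel (gamma_deficit s c r k) (M * (k powr ((r + s) - 1) * exp (- k) * indicator {0<..} k))"
    "has_bochner_integral lborel (\<lambda>\<sigma>. \<bar>gamma_deficit s c r k \<sigma>\<bar>) (M' * (k powr ((r + s) - 1) * exp (- k) * indicator {0<..} k))" for k
  proof -
    have "has_bochner_integral lborel (gamma_deficit s c r k) (M * (k powr ((r + s) - 1) * exp (- k) * indicator {0<..} k)) \<and>
      has_bochner_integral lborel (\<lambda>\<sigma>. \<bar>gamma_deficit s c r k \<sigma>\<bar>) (M' * (k powr ((r + s) - 1) * exp (- k) * indicator {0<..} k))"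
    proof (cases "k > 0")
      case True
      have p: "k powr ((r + s) - 1) = k powr (r - 1) * k powr s"
      proof -
        have "(r + s) - 1 = (r - 1) + s" by simp
        then show ?thesis by (simp only: powr_add)
      qed
      have 1: "has_bochner_integral lborel (\<lambda>\<sigma>. \<sigma> powr (s - 1) * \<phi> (k / \<sigma>) * indicator {0<..} \<sigma> * (k powr (r - 1) * exp (- k) * indicator {0<..} k))
         (k powr s * M * (k powr (r - 1) * exp (- k) * indicator {0<..} k))"
        by (intro has_bochner_integral_mult_left has_bochner_integral_inversion True M) measurable
      have 2: "has_bochner_integral lborel (\<lambda>\<sigma>. \<sigma> powr (s - 1) * \<bar>\<phi> (k / \<sigma>)\<bar> * indicator {0<..} \<sigma> * (k powr (r - 1) * exp (- k) * indicator {0<..} k))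
         (k powr s * M' * (k powr (r - 1) * exp (- k) * indicator {0<..} k))"
        by (intro has_bochner_integral_mult_left has_bochner_integral_inversion[where \<phi>="\<lambda>v. \<bar>\<phi> v\<bar>"] True M') measurable
      show ?thesis using 1 2 True unfolding p
        by (simp add: gamma_deficit_def[abs_def] \<phi>_def abs_mult mult_ac)
    qed (auto simp: gamma_deficit_def[abs_def])
    then show "has_bochner_integral lborel (gamma_deficit s c r k) (M * (k powr ((r + s) - 1) * exp (- k) * indicator {0<..} k))"
      "has_bochner_integral lborel (\<lambda>\<sigma>. \<bar>gamma_deficit s c r k \<sigma>\<bar>) (M' * (k powr ((r + s) - 1) * exp (- k) * indicator {0<..} k))"
      by auto
  qed
  have G: "has_bochner_integral lborel (\<lambda>k. m * (k powr ((r + s) - 1) * exp (- k) * indicator {0<..} k)) (m * Gamma (r + s))" for m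
    using r s by (intro has_bochner_integral_mult_right has_bochner_integral_Gamma) auto
  have [measurable]: "(\<lambda>(k, \<sigma>). gamma_deficit s c r k \<sigma>) \<in> borel_measurable (lborel \<Otimes>\<^sub>M lborel)"
    unfolding gamma_deficit_def by measurable
  show int: "integrable (lborel \<Otimes>\<^sub>M lborel) (\<lambda>(k, \<sigma>). gamma_deficit s c r k \<sigma>)"
  proof (rule lborel_pair.Fubini_integrable)
    show "integrable lborel (\<lambda>k. LINT \<sigma>|lborel. norm (case (k, \<sigma>) of (k, \<sigma>) \<Rightarrow> gamma_deficit s c r k \<sigma>))"
      using inner(2) G[of M'] by (simp add: has_bochner_integral_iff)
    show "AE k in lborel. integrable lborel (\<lambda>\<sigma>. case (k, \<sigma>) of (k, \<sigma>) \<Rightarrow> gamma_deficit s c r k \<sigma>)"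
      using inner(1) by (intro AE_I2) (simp add: has_bochner_integral_iff)
  qed measurable
  have "(LINT \<sigma>|lborel. LINT k|lborel. gamma_deficit s c r k \<sigma>) = (LINT k|lborel. LINT \<sigma>|lborel. gamma_deficit s c r k \<sigma>)"
    by (rule lborel_pair.Fubini_integral[OF int])
  also have "\<dots> = M * Gamma (r + s)"
    using inner(1) G[of M] by (simp add: has_bochner_integral_iff)
  finally show "(LINT \<sigma>|lborel. LINT k|lborel. gamma_deficit s c r k \<sigma>) = Gamma (r + s) * (Gamma (1 - s) * Gamma c / (s * Gamma (c - s)))"
    by (simp add: M_def mult.commute)
qed

lemma gaussian_average_power:
  fixes e :: "'a::euclidean_space"
  defines "N \<equiv> real DIM('a)"
  assumes \<alpha>: "\<alpha> > 0" and \<sigma>: "\<sigma> > 0" and e: "norm e = 1"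
    and int: "integrable lborel (\<lambda>k. gamma_deficit s ((N - \<alpha>) / 2) (\<alpha> / 2) k \<sigma>)"
  shows "has_bochner_integral lborel (\<lambda>y. norm y powr (- \<alpha>) * exp (- \<sigma> * (norm (e - y))\<^sup>2))
     (pi powr (N / 2) / Gamma (\<alpha> / 2) * \<sigma> powr (- N / 2) *
       (Gamma (\<alpha> / 2) - \<sigma> powr (1 - s) * (LINT k|lborel. gamma_deficit s ((N - \<alpha>) / 2) (\<alpha> / 2) k \<sigma>)))"
proof -
  let ?q = "\<lambda>k. k powr (\<alpha> / 2 - 1) * (1 - k / \<sigma>) powr ((N - \<alpha>) / 2 - 1) * exp (- k) * indicator {0<..<\<sigma>} k"
  let ?W = "LINT k|lborel. gamma_deficit s ((N - \<alpha>) / 2) (\<alpha> / 2) k \<sigma>"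
  define I where "I = Gamma (\<alpha> / 2) - \<sigma> powr (1 - s) * ?W"
  have "has_bochner_integral lborel (\<lambda>k. k powr (\<alpha> / 2 - 1) * exp (- k) * indicator {0<..} k -
      \<sigma> powr (1 - s) * gamma_deficit s ((N - \<alpha>) / 2) (\<alpha> / 2) k \<sigma>) I"
    unfolding I_def using \<alpha> int
    by (intro has_bochner_integral_diff has_bochner_integral_Gamma has_bochner_integral_mult_right has_bochner_integral_integrable) auto
  moreover have "k powr (\<alpha> / 2 - 1) * exp (- k) * indicator {0<..} k - \<sigma> powr (1 - s) * gamma_deficit s ((N - \<alpha>) / 2) (\<alpha> / 2) k \<sigma> = ?q k" for k
  proof (cases "k > 0")
    case True
    have "\<sigma> powr (1 - s) * \<sigma> powr (s - 1) = 1" using \<sigma> by (simp add: powr_add[symmetric])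
    moreover have "x * (y * (1 - m) * z) = (x * y) * (z * (1 - m))" for x y z m :: real by simp
    ultimately have "\<sigma> powr (1 - s) * gamma_deficit s ((N - \<alpha>) / 2) (\<alpha> / 2) k \<sigma>
       = (k powr (\<alpha> / 2 - 1) * exp (- k)) * (1 - max 0 (1 - k / \<sigma>) powr ((N - \<alpha>) / 2 - 1))"
      using True \<sigma> by (simp add: gamma_deficit_def)
    then have "k powr (\<alpha> / 2 - 1) * exp (- k) * indicator {0<..} k - \<sigma> powr (1 - s) * gamma_deficit s ((N - \<alpha>) / 2) (\<alpha> / 2) k \<sigma>
       = k powr (\<alpha> / 2 - 1) * exp (- k) * max 0 (1 - k / \<sigma>) powr ((N - \<alpha>) / 2 - 1)"
      using True by (simp add: right_diff_distrib)
    also have "\<dots> = ?q k" using True \<sigma> by (cases "k < \<sigma>") (auto simp: max_def)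
    finally show ?thesis .
  qed (auto simp: gamma_deficit_def)
  ultimately have q: "has_bochner_integral lborel ?q I" by simp
  have I0: "I \<ge> 0"
    using q unfolding has_bochner_integral_iff by (auto intro!: Bochner_Integration.integral_nonneg)
  have "(\<integral>\<^sup>+k. ennreal (?q k) \<partial>lborel) = ennreal I"
    using q by (subst nn_integral_eq_integral) (auto simp: has_bochner_integral_iff)
  then have "(\<integral>\<^sup>+y. ennreal (norm y powr (- \<alpha>) * exp (- \<sigma> * (norm (e - y))\<^sup>2)) \<partial>lborel)
     = ennreal (pi powr (N / 2) / Gamma (\<alpha> / 2) * \<sigma> powr (- N / 2) * I)"
    unfolding N_def gaussian_potential[OF \<alpha> \<sigma> e] using I0 by (simp add: ennreal_mult''[symmetric])
  then show ?thesis
    unfolding has_bochner_integral_iff I_def[symmetric] using I0 \<alpha>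
    by (subst nn_integral_eq_integrable[symmetric]) auto
qed

lemma has_bochner_integral_subordination:
  assumes "a > 0" "z \<noteq> 0"
  shows "has_bochner_integral lborel (\<lambda>t. 1 / Gamma a * (t powr (a - 1) * exp (- t * (norm z)\<^sup>2) * indicator {0<..} t)) (norm z powr (- 2 * a))"
  unfolding has_bochner_integral_iff using assms powr_norm_subordination[OF assms]
  by (subst nn_integral_eq_integrable[symmetric]) auto

text \<open>
  Subordinate the kernel.  For fixed \<open>\<sigma>\<close> the integral over \<open>z\<close> is the difference between the total mass of
  the Gaussian and the Gaussian average of the power about \<open>e\<close>, that is, a multiple of the
  integrated \<open>gamma_deficit\<close>; its integral over \<open>\<sigma>\<close> is known.
\<close>

lemma integral_symmetric_kernel_power:
  fixes e :: "'a::euclidean_space"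
  defines "N \<equiv> real DIM('a)"
  assumes e: "norm e = 1" and \<alpha>: "\<alpha> > 0" "\<alpha> < N - 2 * s" and s: "0 < s" "s < 1"
    and D: "integrable lborel (symmetric_kernel s (\<lambda>y. norm y powr (- \<alpha>)) e)"
  shows "(LINT z|lborel. symmetric_kernel s (\<lambda>y. norm y powr (- \<alpha>)) e z) =
    pi powr (N / 2) / (Gamma (N / 2 + s) * Gamma (\<alpha> / 2)) *
     (Gamma (\<alpha> / 2 + s) * (Gamma (1 - s) * Gamma ((N - \<alpha>) / 2) / (s * Gamma ((N - \<alpha>) / 2 - s))))"
proof -
  define f where "f y = norm (y::'a) powr (- \<alpha>)" for y
  have [measurable]: "f \<in> borel_measurable borel" unfolding f_def by measurable
  define a where "a = N / 2 + s"
  have a: "a > 0" "N + 2 * s = 2 * a" using s by (auto simp: a_def N_def add_pos_nonneg)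
  define G where "G = 1 / Gamma a"
  define num where "num z = (2 * f e - f (e + z) - f (e - z)) / 2" for z
  have [measurable]: "num \<in> borel_measurable borel" unfolding num_def by measurable
  define H where "H z \<sigma> = num z * (G * (\<sigma> powr (a - 1) * exp (- \<sigma> * (norm z)\<^sup>2) * indicator {0<..} \<sigma>))" for z \<sigma>
  let ?D = "symmetric_kernel s f e"
  have D': "?D z = num z * norm z powr (- 2 * a)" for z
    using a(2) by (simp add: symmetric_kernel_def num_def N_def powr_minus_divide)
  have Hz: "has_bochner_integral lborel (H z) (?D z)" if "z \<noteq> 0" for z
    unfolding H_def[abs_def] D' G_def by (intro has_bochner_integral_mult_right has_bochner_integral_subordination a that)
  have Hm[measurable]: "(\<lambda>(z, \<sigma>). H z \<sigma>) \<in> borel_measurable (lborel \<Otimes>\<^sub>M lborel)"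
  proof -
    have "borel_measurable (lborel \<Otimes>\<^sub>M lborel) = borel_measurable (borel \<Otimes>\<^sub>M (borel :: real measure) :: ('a \<times> real) measure)"
      by (intro measurable_cong_sets sets_pair_measure_cong) auto
    moreover have "(\<lambda>(z, \<sigma>). H z \<sigma>) \<in> borel_measurable (borel \<Otimes>\<^sub>M borel)"
      unfolding H_def by measurable
    ultimately show ?thesis by simp
  qed
  have Hint: "integrable (lborel \<Otimes>\<^sub>M lborel) (\<lambda>(z, \<sigma>). H z \<sigma>)"
  proof (rule lborel_pair.Fubini_integrable)
    have nH: "(LINT \<sigma>|lborel. \<bar>H z \<sigma>\<bar>) = \<bar>?D z\<bar>" if "z \<noteq> 0" for z
    proof -
      have "has_bochner_integral lborel (\<lambda>\<sigma>. \<bar>num z\<bar> * (1 / Gamma a * (\<sigma> powr (a - 1) * exp (- \<sigma> * (norm z)\<^sup>2) * indicator {0<..} \<sigma>))) (\<bar>num z\<bar> * norm z powr (- 2 * a))"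
        by (intro has_bochner_integral_mult_right has_bochner_integral_subordination a that)
      moreover have "\<bar>H z \<sigma>\<bar> = \<bar>num z\<bar> * (1 / Gamma a * (\<sigma> powr (a - 1) * exp (- \<sigma> * (norm z)\<^sup>2) * indicator {0<..} \<sigma>))" for \<sigma>
        using Gamma_real_pos[OF a(1)] by (simp add: H_def G_def abs_mult)
      ultimately show ?thesis by (simp add: has_bochner_integral_iff D' abs_mult)
    qed
    have "integrable lborel (\<lambda>z. \<bar>?D z\<bar>)" using D unfolding f_def[abs_def] by auto
    then show "integrable lborel (\<lambda>z. LINT \<sigma>|lborel. norm (case (z, \<sigma>) of (z, \<sigma>) \<Rightarrow> H z \<sigma>))"
    proof (rule integrable_cong_AE_imp)
      show "AE z in lborel. \<bar>?D z\<bar> = (LINT \<sigma>|lborel. norm (case (z, \<sigma>) of (z, \<sigma>) \<Rightarrow> H z \<sigma>))"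
        using AE_lborel_singleton[of 0] by eventually_elim (simp add: nH)
    qed measurable
    show "AE z in lborel. integrable lborel (\<lambda>\<sigma>. case (z, \<sigma>) of (z, \<sigma>) \<Rightarrow> H z \<sigma>)"
      using AE_lborel_singleton[of 0]
    proof eventually_elim
      case (elim z)
      then show ?case using Hz[OF elim] by (simp add: has_bochner_integral_iff)
    qed
  qed measurable
  let ?R = "gamma_deficit s ((N - \<alpha>) / 2) (\<alpha> / 2)"
  have c: "(N - \<alpha>) / 2 > s" "\<alpha> / 2 > 0" using \<alpha> by auto
  note R = gamma_deficit_integral[OF s c]
  have "(LINT z|lborel. ?D z) = (LINT z|lborel. LINT \<sigma>|lborel. H z \<sigma>)"
  proof (rule integral_cong_AE)
    show "AE z in lborel. ?D z = (LINT \<sigma>|lborel. H z \<sigma>)"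
      using AE_lborel_singleton[of 0]
    proof eventually_elim
      case (elim z)
      then show ?case using Hz[OF elim] by (simp add: has_bochner_integral_iff)
    qed
    show "?D \<in> borel_measurable lborel" using D unfolding f_def[abs_def] by auto
  qed measurable
  also have "\<dots> = (LINT \<sigma>|lborel. LINT z|lborel. H z \<sigma>)"
    by (rule lborel_pair.Fubini_integral[OF Hint, symmetric])
  also have "\<dots> = (LINT \<sigma>|lborel. G * pi powr (N / 2) / Gamma (\<alpha> / 2) * (LINT k|lborel. ?R k \<sigma>))"
  proof (rule integral_cong_AE)
    show "(\<lambda>\<sigma>. LINT z|lborel. H z \<sigma>) \<in> borel_measurable lborel"
      by (rule borel_measurable_integrable[OF lborel_pair.integrable_snd[OF Hint]])
    show "(\<lambda>\<sigma>. G * pi powr (N / 2) / Gamma (\<alpha> / 2) * (LINT k|lborel. ?R k \<sigma>)) \<in> borel_measurable lborel"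
      by (intro borel_measurable_times borel_measurable_const borel_measurable_integrable[OF lborel_pair.integrable_snd[OF R(1)]])
    show "AE \<sigma> in lborel. (LINT z|lborel. H z \<sigma>) = G * pi powr (N / 2) / Gamma (\<alpha> / 2) * (LINT k|lborel. ?R k \<sigma>)"
      using lborel_pair.AE_integrable_snd[OF R(1)]
    proof eventually_elim
      case (elim \<sigma>)
      show ?case
      proof (cases "\<sigma> > 0")
        case True
        let ?W = "LINT k|lborel. ?R k \<sigma>"
        let ?P = "pi powr (N / 2) / Gamma (\<alpha> / 2) * \<sigma> powr (- N / 2) * (Gamma (\<alpha> / 2) - \<sigma> powr (1 - s) * ?W)"
        have P: "has_bochner_integral lborel (\<lambda>y. f y * exp (- \<sigma> * (norm (e - y))\<^sup>2)) ?P"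
          unfolding f_def N_def using elim by (intro gaussian_average_power \<alpha>(1) True e) (simp add: N_def)
        have "has_bochner_integral lborel (\<lambda>z. G * \<sigma> powr (a - 1) / 2 *
             (2 * exp (- \<sigma> * (norm z)\<^sup>2) - f (e + z) * exp (- \<sigma> * (norm (e - (e + z)))\<^sup>2) - f (e - z) * exp (- \<sigma> * (norm (e - (e - z)))\<^sup>2)))
           (G * \<sigma> powr (a - 1) / 2 * (2 * (pi / \<sigma>) powr (N / 2) - ?P - ?P))"
          unfolding N_def
          by (intro has_bochner_integral_mult_right has_bochner_integral_diff gaussian_integral True
              has_bochner_integral_shift[OF P[unfolded N_def]] has_bochner_integral_reflect[OF P[unfolded N_def]])
        moreover have "G * \<sigma> powr (a - 1) / 2 *
             (2 * exp (- \<sigma> * (norm z)\<^sup>2) - f (e + z) * exp (- \<sigma> * (norm (e - (e + z)))\<^sup>2) - f (e - z) * exp (- \<sigma> * (norm (e - (e - z)))\<^sup>2)) = H z \<sigma>" for z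
        proof -
          have "f e = 1" by (simp add: f_def e)
          then show ?thesis using True by (simp add: H_def num_def algebra_simps)
        qed
        ultimately have "has_bochner_integral lborel (\<lambda>z. H z \<sigma>) (G * \<sigma> powr (a - 1) / 2 * (2 * (pi / \<sigma>) powr (N / 2) - ?P - ?P))"
          by (simp only:)
        moreover have "x / 2 * (2 * y - w - w) = x * (y - w)" for x y w :: real by (simp add: field_simps)
        ultimately have "(LINT z|lborel. H z \<sigma>) = G * \<sigma> powr (a - 1) * ((pi / \<sigma>) powr (N / 2) - ?P)"
          by (simp only: has_bochner_integral_iff)
        also have "(pi / \<sigma>) powr (N / 2) - ?P = pi powr (N / 2) / Gamma (\<alpha> / 2) * (\<sigma> powr (- N / 2) * \<sigma> powr (1 - s)) * ?W"
        proof -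
          have "(pi / \<sigma>) powr (N / 2) = pi powr (N / 2) * \<sigma> powr (- N / 2)"
            using True by (simp add: powr_divide powr_minus_divide)
          moreover have "Gamma (\<alpha> / 2) \<noteq> 0" using \<alpha> by (intro less_imp_neq[THEN not_sym] Gamma_real_pos) simp
          ultimately show ?thesis by (simp add: right_diff_distrib)
        qed
        also have "G * \<sigma> powr (a - 1) * \<dots> = G * pi powr (N / 2) / Gamma (\<alpha> / 2) * (\<sigma> powr (a - 1) * \<sigma> powr (- N / 2) * \<sigma> powr (1 - s)) * ?W"
          by simp
        also have "\<sigma> powr (a - 1) * \<sigma> powr (- N / 2) * \<sigma> powr (1 - s) = 1"
          using True by (simp only: powr_add[symmetric]) (simp add: a_def)
        finally show ?thesis by simp
      qed (simp add: H_def gamma_deficit_def)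
    qed
  qed
  also have "\<dots> = G * pi powr (N / 2) / Gamma (\<alpha> / 2) * (Gamma (\<alpha> / 2 + s) * (Gamma (1 - s) * Gamma ((N - \<alpha>) / 2) / (s * Gamma ((N - \<alpha>) / 2 - s))))"
    by (simp only: integral_mult_right_zero R(2))
  finally show ?thesis unfolding f_def[abs_def] G_def a_def by (simp add: mult_ac)
qed

theorem frac_laplacian_power:
  fixes e :: "'a::euclidean_space"
  assumes e: "norm e = 1" and \<alpha>: "\<alpha> > 0" "\<alpha> < real DIM('a) - 2 * s" and s: "0 < s" "s < 1"
    and pv: "has_pv_integral s (\<lambda>y. norm y powr (- \<alpha>)) e l"
  shows "frac_lap_const TYPE('a) s * l = Lambda_const DIM('a) s \<alpha>"
proof -
  let ?N = "real DIM('a)"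
  have off: "set_integrable lborel {y. \<epsilon> < norm (e - y)}
       (\<lambda>y. (norm e powr (- \<alpha>) - norm y powr (- \<alpha>)) / norm (e - y) powr (real DIM('a) + 2 * s))" if "\<epsilon> > 0" for \<epsilon>
    using pv that unfolding has_pv_integral_def by blast
  have D: "integrable lborel (symmetric_kernel s (\<lambda>y. norm y powr (- \<alpha>)) e)"
    by (rule integrable_symmetric_kernel_power[OF e \<alpha>(1) s off]) simp
  have "l = (LINT z|lborel. symmetric_kernel s (\<lambda>y. norm y powr (- \<alpha>)) e z)"
    by (rule has_pv_integral_unique[OF pv has_pv_integral_symmetrize[OF off D]])
  also note integral_symmetric_kernel_power[OF e \<alpha> s D]
  finally have l: "l = pi powr (?N / 2) / (Gamma (?N / 2 + s) * Gamma (\<alpha> / 2)) *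
     (Gamma (\<alpha> / 2 + s) * (Gamma (1 - s) * Gamma ((?N - \<alpha>) / 2) / (s * Gamma ((?N - \<alpha>) / 2 - s))))" .
  have nz: "Gamma (?N / 2 + s) \<noteq> 0" "Gamma (1 - s) \<noteq> 0"
    using s by (auto intro!: less_imp_neq[THEN not_sym] Gamma_real_pos add_nonneg_pos simp del: Gamma_eq_zero_iff)
  have halves: "(\<alpha> + 2 * s) / 2 = \<alpha> / 2 + s" "(?N - \<alpha> - 2 * s) / 2 = (?N - \<alpha>) / 2 - s" by (simp_all add: field_simps)
  have "2 powr (2 * s) = (4::real) powr s" by (simp add: powr_powr[symmetric])
  then have four: "2 powr (2 * s) = 1 / (4::real) powr (- s)" by (simp add: powr_minus divide_inverse)
  show ?thesis
    using s nz unfolding l frac_lap_const_eq[OF s] multiplier_integral_def Lambda_const_def halves four by simp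
qed

section \<open>The amplitude of a homogeneous solution\<close>

text \<open>
  The two functions may disagree at the origin, where \<open>0 powr a = 0\<close> while the value of \<open>u\<close> is
  arbitrary; this is a null set, and \<open>x\<close> lies off it.
\<close>

lemma has_pv_integral_scale:
  fixes u v :: "'a::euclidean_space \<Rightarrow> real"
  assumes pv: "has_pv_integral s u x l" and x: "x \<noteq> 0" and A: "A \<noteq> 0"
    and v[measurable]: "v \<in> borel_measurable borel"
    and eq: "\<And>y. y \<noteq> 0 \<Longrightarrow> u y = A * v y"
  shows "has_pv_integral s v x (l / A)"
proof -
  let ?K = "\<lambda>\<epsilon> w y. indicator {y. \<epsilon> < norm (x - y)} y *\<^sub>R ((w x - w y) / norm (x - y) powr (real DIM('a) + 2 * s))"
  have K: "?K \<epsilon> v y = ?K \<epsilon> u y / A" if "y \<noteq> 0" for y \<epsilon>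
    using eq[OF that] eq[OF x] A by (simp add: right_diff_distrib[symmetric])
  have AE: "AE y in lborel. ?K \<epsilon> u y / A = ?K \<epsilon> v y" for \<epsilon>
    using AE_lborel_singleton[of 0] by eventually_elim (rule K[symmetric])
  have u: "integrable lborel (?K \<epsilon> u)" if "\<epsilon> > 0" for \<epsilon>
    using pv that unfolding has_pv_integral_def set_integrable_def by blast
  have mv: "?K \<epsilon> v \<in> borel_measurable lborel" for \<epsilon> by measurable
  have iv: "integrable lborel (?K \<epsilon> v)" if "\<epsilon> > 0" for \<epsilon>
    by (rule integrable_cong_AE_imp[OF integrable_divide[OF u[OF that]] mv AE])
  have val: "integral\<^sup>L lborel (?K \<epsilon> v) = integral\<^sup>L lborel (?K \<epsilon> u) / A" if "\<epsilon> > 0" for \<epsilon>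
  proof -
    have "integral\<^sup>L lborel (?K \<epsilon> v) = (LINT y|lborel. ?K \<epsilon> u y / A)"
      by (rule integral_cong_AE[symmetric, OF borel_measurable_integrable[OF integrable_divide[OF u[OF that]]] mv AE])
    then show ?thesis by (simp only: Bochner_Integration.integral_divide_zero)
  qed
  have "((\<lambda>\<epsilon>. integral\<^sup>L lborel (?K \<epsilon> u) / A) \<longlongrightarrow> l / A) (at_right 0)"
    using pv A unfolding has_pv_integral_def set_lebesgue_integral_def by (intro tendsto_divide tendsto_const) auto
  moreover have "eventually (\<lambda>\<epsilon>. integral\<^sup>L lborel (?K \<epsilon> u) / A = integral\<^sup>L lborel (?K \<epsilon> v)) (at_right 0)"
    using eventually_at_right_less by eventually_elim (rule val[symmetric])
  ultimately have "((\<lambda>\<epsilon>. integral\<^sup>L lborel (?K \<epsilon> v)) \<longlongrightarrow> l / A) (at_right 0)"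
    by (rule Lim_transform_eventually)
  then show ?thesis
    unfolding has_pv_integral_def set_lebesgue_integral_def set_integrable_def using iv by blast
qed

lemma hartree_power:
  fixes e :: "'a::euclidean_space"
  assumes e: "norm e = 1" and A: "A > 0" and U: "\<And>y. y \<noteq> 0 \<Longrightarrow> U y = A * norm y powr (- \<alpha>)"
    and \<alpha>: "0 < \<alpha> * p" "\<alpha> * p < real DIM('a)" and \<mu>: "0 < \<mu>" "\<mu> < real DIM('a)"
    and sum: "\<mu> + \<alpha> * p > real DIM('a)"
  shows "hartree p \<mu> U e = A powr p * C_const DIM('a) \<mu> \<alpha> p"
proof -
  let ?f = "\<lambda>y::'a. norm y powr (- (\<alpha> * p)) * norm (e - y) powr (- \<mu>)"
  have C: "C_const DIM('a) \<mu> (\<alpha> * p) 1 = C_const DIM('a) \<mu> \<alpha> p" by (simp add: C_const_def)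
  have "(\<integral>\<^sup>+y. ennreal (?f y) \<partial>lborel) = ennreal (C_const DIM('a) \<mu> \<alpha> p)"
    using riesz_composition[OF \<alpha> \<mu> sum e] unfolding C .
  moreover have "C_const DIM('a) \<mu> \<alpha> p \<ge> 0"
    unfolding C_const_def using \<alpha> \<mu> sum
    by (intro divide_nonneg_nonneg mult_nonneg_nonneg less_imp_le[OF Gamma_real_pos] powr_ge_zero) auto
  ultimately have f: "has_bochner_integral lborel ?f (C_const DIM('a) \<mu> \<alpha> p)"
    unfolding has_bochner_integral_iff by (subst nn_integral_eq_integrable[symmetric]) auto
  have "hartree p \<mu> U e = (LINT y|lborel. A powr p * ?f y)"
    unfolding hartree_def set_lebesgue_integral_def
  proof (rule Bochner_Integration.integral_cong[OF refl])
    fix y :: 'a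
    show "indicator (UNIV - {0}) y *\<^sub>R (U y powr p / norm (e - y) powr \<mu>) = A powr p * ?f y"
    proof (cases "y = 0")
      case False
      have "U y powr p = A powr p * norm y powr (- (\<alpha> * p))"
        using A by (simp add: U[OF False] powr_mult powr_powr)
      then show ?thesis using False by (simp add: powr_minus_divide)
    qed simp
  qed
  then show ?thesis using f by (simp add: has_bochner_integral_iff)
qed

theorem mainTheorem4:
  fixes u U :: "'a::euclidean_space \<Rightarrow> real"
    and N :: nat
    and s \<mu> p q \<alpha> :: real
    and r :: "nat \<Rightarrow> real"
  assumes "N = DIM('a)"
    and "0 < s" and "s < 1" and "2 * s < real N"
    and "0 < \<mu>" and "\<mu> < real N"
    and "p > 0" and "q > 0" and "p + q > 1"
    and "\<alpha> = (real N - \<mu> + 2 * s) / (p + q - 1)"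
    and "0 < \<alpha>" and "\<alpha> < real N - 2 * s"
    and "0 < \<alpha> * p" and "\<alpha> * p < real N" and "\<mu> + \<alpha> * p > real N"
    and "positive_punctured_solution s \<mu> p q u"
    and "filterlim r (at_right 0) sequentially"
    and "\<And>K. compact K \<Longrightarrow> K \<subseteq> UNIV - {0} \<Longrightarrow>
           uniform_limit K (\<lambda>n x. r n powr \<alpha> * u (r n *\<^sub>R x)) U sequentially"
    and "\<exists>x. x \<noteq> 0 \<and> U x \<noteq> 0"
    and "\<And>x. x \<noteq> 0 \<Longrightarrow> U x > 0"
    and "\<And>x y. x \<noteq> 0 \<Longrightarrow> y \<noteq> 0 \<Longrightarrow> norm x = norm y \<Longrightarrow> U x = U y"
    and "\<And>t x. t > 0 \<Longrightarrow> x \<noteq> 0 \<Longrightarrow> U (t *\<^sub>R x) = t powr (- \<alpha>) * U x"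
    and "solves_punctured s \<mu> p q U"
  shows "\<exists>A>0. (\<forall>B>0. B powr (p + q - 1) = Lambda_const N s \<alpha> / C_const N \<mu> \<alpha> p \<longleftrightarrow> B = A) \<and>
               (\<forall>x. x \<noteq> 0 \<longrightarrow> U x = A * norm x powr (- \<alpha>))"
proof -
  note N = assms(1) and s = assms(2,3) and \<mu> = assms(5,6) and pq = assms(7-9) and \<alpha> = assms(11,12)
    and \<alpha>p = assms(13-15) and pos = assms(20) and radial = assms(21) and homogeneous = assms(22) and eqn = assms(23)
  obtain e :: 'a where "e \<in> Basis" using nonempty_Basis by blast
  then have e: "norm e = 1" "e \<noteq> 0" by (auto simp: norm_Basis)
  define A where "A = U e"
  have A: "A > 0" using pos[OF e(2)] by (simp add: A_def)
  have U: "U x = A * norm x powr (- \<alpha>)" if "x \<noteq> 0" for x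
  proof -
    have "U x = U (norm x *\<^sub>R ((1 / norm x) *\<^sub>R x))" using that by simp
    also have "\<dots> = norm x powr (- \<alpha>) * U ((1 / norm x) *\<^sub>R x)"
      using that by (intro homogeneous) auto
    also have "U ((1 / norm x) *\<^sub>R x) = A"
      unfolding A_def using that e by (intro radial) auto
    finally show ?thesis by simp
  qed
  obtain l where l: "has_pv_integral s U e l" "hartree p \<mu> U e * U e powr q = frac_lap_const TYPE('a) s * l"
    using eqn e(2) unfolding solves_punctured_def has_frac_laplacian_def by blast
  have "has_pv_integral s (\<lambda>y. norm y powr (- \<alpha>)) e (l / A)"
    using A U by (intro has_pv_integral_scale[OF l(1) e(2)]) auto
  then have "frac_lap_const TYPE('a) s * (l / A) = Lambda_const N s \<alpha>"
    unfolding N using \<alpha> s N by (intro frac_laplacian_power[OF e(1)]) simp_all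
  then have Lap: "frac_lap_const TYPE('a) s * l = A * Lambda_const N s \<alpha>" using A by (simp add: field_simps)
  have H: "hartree p \<mu> U e = A powr p * C_const N \<mu> \<alpha> p"
    unfolding N using \<alpha>p \<mu> by (intro hartree_power e(1) A U) (auto simp: N)
  have C: "C_const N \<mu> \<alpha> p > 0"
    unfolding C_const_def using \<alpha> \<alpha>p \<mu> pq
    by (intro divide_pos_pos mult_pos_pos Gamma_real_pos) auto
  have "A powr p * C_const N \<mu> \<alpha> p * A powr q = A * Lambda_const N s \<alpha>"
    using l(2) unfolding Lap H A_def[symmetric] .
  moreover have "A powr p * A powr q = A * A powr (p + q - 1)"
    using A by (simp add: powr_add[symmetric] powr_mult_base)
  ultimately have "A * (A powr (p + q - 1) * C_const N \<mu> \<alpha> p) = A * Lambda_const N s \<alpha>"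
    by (metis mult.assoc mult.commute)
  then have AA: "A powr (p + q - 1) = Lambda_const N s \<alpha> / C_const N \<mu> \<alpha> p"
    using A C by (simp add: field_simps)
  have inj: "B = A" if "B > 0" "B powr (p + q - 1) = A powr (p + q - 1)" for B
  proof -
    have "B = (B powr (p + q - 1)) powr (1 / (p + q - 1))" using that(1) pq by (simp add: powr_powr)
    also have "\<dots> = A" unfolding that(2) using A pq by (simp add: powr_powr)
    finally show ?thesis .
  qed
  show ?thesis
  proof (intro exI[of _ A] conjI allI impI)
    show "A > 0" by (rule A)
    show "U x = A * norm x powr (- \<alpha>)" if "x \<noteq> 0" for x using that by (rule U)
    show "B powr (p + q - 1) = Lambda_const N s \<alpha> / C_const N \<mu> \<alpha> p \<longleftrightarrow> B = A" if "B > 0" for B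
      using inj[OF that] unfolding AA[symmetric] by blast
  qed
qed

end
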